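(* Let $F$ be a computable field. (1) The association sending a quaternion algebra $B$ over $F$ to the conic $C\subset\mathbb{P}(B_0)\cong\mathbb{P}^2_F$ defined by $\operatorname{nrd}_0=0$ gives a bijection between quaternion algebras over $F$ up to isomorphism and conics over $F$ up to isomorphism. (2) The problems (IsMatrixRing) and (ExhibitMatrixRing) over $F$ are deterministic polynomial-time equivalent to the problems (HasPoint) and (ExhibitPoint) over $F$, respectively.
   Context: A field $F$ is computable if its elements are encoded in bits with deterministic algorithms for addition, subtraction, multiplication and testing equality with $0$, together with an algorithm for division by nonzero elements. A quaternion algebra over $F$ is a central simple $F$-algebra of dimension $4$. It is represented in standard form $B=\left(\frac{a,b}{F}\right)$: the $F$-algebra with basis $1,i,j,ij$ where, if $\operatorname{char}F\ne 2$, $i^2=a$, $j^2=b$, $ji=-ij$ with $a,b\in F^\times$, and, if $\operatorname{char}F=2$, $i^2+i=a$, $j^2=b$, $ji=(i+1)j$ with $a\in F$, $b\in F^\times$. Every quaternion algebra $B$ has a unique standard involution $x\mapsto\overline{x}$ (an $F$-linear map with $\overline{1}=1$, $\overline{xy}=\overline{y}\,\overline{x}$, $\overline{\overline{x}}=x$ and $x\overline{x}\in F$ for all $x,y\in B$); put $\operatorname{trd}(x)=x+\overline{x}$, $\operatorname{nrd}(x)=x\overline{x}$, $B_0=\{x\in B:\operatorname{trd}(x)=0\}$ (a $3$-dimensional $F$-space) and $\operatorname{nrd}_0=\operatorname{nrd}|_{B_0}$, a quadratic form. A conic over $F$ is a nonsingular projective plane curve $C\subset\mathbb{P}^2_F$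 of degree $2$, given by its defining quadratic form; isomorphisms of conics are given by elements of $\operatorname{PGL}_3(F)$. Problems: (IsMatrixRing): given a quaternion algebra $B$ over $F$, determine if $B\cong\mathrm{M}_2(F)$. (ExhibitMatrixRing): given a quaternion algebra $B$ over $F$, determine if $B\cong\mathrm{M}_2(F)$ and, if so, output such an isomorphism. (HasPoint): given a conic $C$ over $F$, determine if $C$ has an $F$-rational point. (ExhibitPoint): given a conic $C$ over $F$, determine if $C$ has an $F$-rational point and, if so, output such a point. Two problems are deterministic polynomial-time equivalent if each is reducible to the other by a deterministic polynomial-time algorithm. *)

theory Defs
  imports
    "HOL-Analysis.Determinants"
    "HOL-Algebra.Algebraic_Closure_Type"
begin

unbundle no Formal_Power_Series.fps_syntax

section \<open>Quaternion algebras\<close>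

locale unital_algebra = vector_space scale
  for scale :: "'f::field \<Rightarrow> 'b::ab_group_add \<Rightarrow> 'b" +
  fixes mult :: "'b \<Rightarrow> 'b \<Rightarrow> 'b" and one :: 'b
  assumes linear_left: "Vector_Spaces.linear scale scale (\<lambda>x. mult x y)"
    and linear_right: "Vector_Spaces.linear scale scale (mult x)"
    and mult_assoc: "mult (mult x y) z = mult x (mult y z)"
    and one_left: "mult one x = x"
    and one_right: "mult x one = x"
begin

definition standard_involution :: "('b \<Rightarrow> 'b) \<Rightarrow> bool" where
  "standard_involution \<sigma> \<longleftrightarrow>
     Vector_Spaces.linear scale scale \<sigma> \<and> \<sigma> one = one \<and>
     (\<forall>x y. \<sigma> (mult x y) = mult (\<sigma> y) (\<sigma> x)) \<and>
     (\<forall>x. \<sigma> (\<sigma> x) = x) \<and>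
     (\<forall>x. mult x (\<sigma> x) \<in> range (\<lambda>c. scale c one))"

definition conjugate :: "'b \<Rightarrow> 'b" where
  "conjugate = (THE \<sigma>. standard_involution \<sigma>)"

definition trd :: "'b \<Rightarrow> 'f" where
  "trd x = (THE c. scale c one = x + conjugate x)"

definition nrd :: "'b \<Rightarrow> 'f" where
  "nrd x = (THE c. scale c one = mult x (conjugate x))"

definition trace_zero :: "'b set" where
  "trace_zero = {x. trd x = 0}"

definition two_sided_ideal :: "'b set \<Rightarrow> bool" where
  "two_sided_ideal I \<longleftrightarrow>
     0 \<in> I \<and> (\<forall>x\<in>I. \<forall>y\<in>I. x - y \<in> I) \<and> (\<forall>x\<in>I. \<forall>y. mult x y \<in> I \<and> mult y x \<in> I)"

end

locale quaternion_algebra = unital_algebra +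
  assumes dimension: "dim UNIV = 4"
    and central: "{z. \<forall>x. mult z x = mult x z} = range (\<lambda>c. scale c one)"
    and simple: "two_sided_ideal I \<Longrightarrow> I = {0} \<or> I = UNIV"

definition algebra_iso ::
  "('f::field \<Rightarrow> 'b::ab_group_add \<Rightarrow> 'b) \<Rightarrow> ('b \<Rightarrow> 'b \<Rightarrow> 'b) \<Rightarrow> 'b \<Rightarrow>
   ('f \<Rightarrow> 'c::ab_group_add \<Rightarrow> 'c) \<Rightarrow> ('c \<Rightarrow> 'c \<Rightarrow> 'c) \<Rightarrow> 'c \<Rightarrow> ('b \<Rightarrow> 'c) \<Rightarrow> bool" where
  "algebra_iso s m e s' m' e' \<phi> \<longleftrightarrow>
     Vector_Spaces.linear s s' \<phi> \<and> bij \<phi> \<and>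
     (\<forall>x y. \<phi> (m x y) = m' (\<phi> x) (\<phi> y)) \<and> \<phi> e = e'"

text \<open>
  Every four-dimensional algebra is isomorphic to one whose underlying vector space is
  \<open>'f ^ 4\<close>, so isomorphism classes of quaternion algebras are classes of pairs
  (multiplication, unit element) on that space.
\<close>

type_synonym 'f algebra4 = "(('f ^ 4) \<Rightarrow> ('f ^ 4) \<Rightarrow> ('f ^ 4)) \<times> ('f ^ 4)"

definition quaternion_algebras :: "'f::field algebra4 set" where
  "quaternion_algebras = {(m, e). quaternion_algebra (*s) m e}"

definition quaternion_iso :: "('f::field algebra4 \<times> 'f algebra4) set" where
  "quaternion_iso = {((m, e), (m', e')).
     (m, e) \<in> quaternion_algebras \<and> (m', e') \<in> quaternion_algebras \<and>
     (\<exists>\<phi>. algebra_iso (*s) m e (*s) m' e' \<phi>)}"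

section \<open>Conics\<close>

text \<open>
  The tuple \<open>(a, b, c, d, e, f)\<close> is the ternary quadratic form
  \<open>a X\<^sup>2 + b Y\<^sup>2 + c Z\<^sup>2 + d X Y + e X Z + f Y Z\<close>.
\<close>

type_synonym 'a qform = "'a \<times> 'a \<times> 'a \<times> 'a \<times> 'a \<times> 'a"

fun qeval :: "'a::comm_ring_1 qform \<Rightarrow> 'a ^ 3 \<Rightarrow> 'a" where
  "qeval (a, b, c, d, e, f) v =
     a * (v $ 1)\<^sup>2 + b * (v $ 2)\<^sup>2 + c * (v $ 3)\<^sup>2 +
     d * v $ 1 * v $ 2 + e * v $ 1 * v $ 3 + f * v $ 2 * v $ 3"

fun singular_at :: "'a::comm_ring_1 qform \<Rightarrow> 'a ^ 3 \<Rightarrow> bool" where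
  "singular_at (a, b, c, d, e, f) v \<longleftrightarrow>
     qeval (a, b, c, d, e, f) v = 0 \<and>
     2 * a * v $ 1 + d * v $ 2 + e * v $ 3 = 0 \<and>
     d * v $ 1 + 2 * b * v $ 2 + f * v $ 3 = 0 \<and>
     e * v $ 1 + f * v $ 2 + 2 * c * v $ 3 = 0"

fun qmap :: "('a \<Rightarrow> 'b) \<Rightarrow> 'a qform \<Rightarrow> 'b qform" where
  "qmap h (a, b, c, d, e, f) = (h a, h b, h c, h d, h e, h f)"

text \<open>
  Nonsingularity is geometric: there is no singular point over the algebraic closure.  Over an
  imperfect field of characteristic 2 it does not suffice to look at rational points.
\<close>

definition conics :: "'f::field qform set" where
  "conics = {Q. \<forall>v::'f alg_closure ^ 3. v \<noteq> 0 \<longrightarrow> \<not> singular_at (qmap to_ac Q) v}"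

text \<open>
  The scalar \<open>c\<close> is there because a form and its nonzero multiples define the same curve.  A
  quadratic form is determined by its values, even over a finite field, so comparing values is
  the same as comparing polynomials.
\<close>

definition conic_iso :: "('f::field qform \<times> 'f qform) set" where
  "conic_iso = {(Q, Q'). Q \<in> conics \<and> Q' \<in> conics \<and>
     (\<exists>(g::'f ^ 3 ^ 3) c. invertible g \<and> c \<noteq> 0 \<and> (\<forall>v. qeval Q' (g *v v) = c * qeval Q v))}"

text \<open>
  \<open>Q\<close> is the reduced norm on the trace zero space, written in the coordinates that \<open>\<phi>\<close> puts on
  this space.
\<close>

definition associated_conic :: "'f::field algebra4 \<Rightarrow> 'f qform \<Rightarrow> bool" where
  "associated_conic B Q \<longleftrightarrow> (case B of (m, e) \<Rightarrow>
     \<exists>\<phi>::'f ^ 3 \<Rightarrow> 'f ^ 4. Vector_Spaces.linear (*s) (*s) \<phi> \<and> inj \<phi> \<and>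
       range \<phi> = unital_algebra.trace_zero (*s) m e \<and>
       (\<forall>v. qeval Q v = unital_algebra.nrd (*s) m e (\<phi> v)))"

section \<open>Algorithms\<close>

text \<open>
  Structured programs on registers that hold stacks of bits, i.e. multitape Turing machines with
  structured control and nonrecursive procedure calls.  \<open>Call p rs d\<close> runs \<open>p\<close> on fresh
  registers, loaded with the contents of \<open>rs\<close>, and puts its first register into \<open>d\<close>.
\<close>

type_synonym bits = "bool list"

type_synonym state = "nat \<Rightarrow> bits"

datatype prog =
    Skip
  | Push bool nat
  | Pop nat
  | Seq prog prog
  | Branch nat prog prog prog
  | While nat prog
  | Call prog "nat list" nat

definition load :: "bits list \<Rightarrow> state" where
  "load ws = (\<lambda>i. if i < length ws then ws ! i else [])"

definition bit_size :: "bits list \<Rightarrow> nat" where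
  "bit_size ws = sum_list (map length ws)"

text \<open>
  \<open>exec U p s n s'\<close>: started in \<open>s\<close>, the program \<open>p\<close> halts in \<open>s'\<close> after time \<open>n\<close>.  Calls of
  programs in \<open>U\<close> are charged as one step.  All other calls are charged the running time of the
  callee and the cost of copying its arguments and its result, so for \<open>U = {}\<close> the time is the
  number of bit operations.
\<close>

inductive exec :: "prog set \<Rightarrow> prog \<Rightarrow> state \<Rightarrow> nat \<Rightarrow> state \<Rightarrow> bool" for U where
  Skip: "exec U Skip s 1 s"
| Push: "exec U (Push b r) s 1 (s(r := b # s r))"
| Pop: "exec U (Pop r) s 1 (s(r := tl (s r)))"
| Seq: "exec U p s m s' \<Longrightarrow> exec U q s' n s'' \<Longrightarrow> exec U (Seq p q) s (m + n) s''"
| Branch_True: "s r = True # w \<Longrightarrow> exec U p s n s' \<Longrightarrow> exec U (Branch r p q e) s (1 + n) s'"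
| Branch_False: "s r = False # w \<Longrightarrow> exec U q s n s' \<Longrightarrow> exec U (Branch r p q e) s (1 + n) s'"
| Branch_Empty: "s r = [] \<Longrightarrow> exec U e s n s' \<Longrightarrow> exec U (Branch r p q e) s (1 + n) s'"
| While_Stop: "s r = [] \<Longrightarrow> exec U (While r p) s 1 s"
| While_Step: "s r \<noteq> [] \<Longrightarrow> exec U p s m s' \<Longrightarrow> exec U (While r p) s' n s'' \<Longrightarrow>
    exec U (While r p) s (1 + m + n) s''"
| Call: "exec U p (load (map s rs)) n s' \<Longrightarrow>
    exec U (Call p rs d) s
      (if p \<in> U then 1 else 1 + n + bit_size (map s rs) + length (s' 0)) (s(d := s' 0))"

definition outputs :: "prog set \<Rightarrow> prog \<Rightarrow> bits list \<Rightarrow> nat \<Rightarrow> bits list \<Rightarrow> bool" where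
  "outputs U p ws n zs \<longleftrightarrow> (\<exists>s. exec U p (load ws) n s \<and> (\<forall>i<length zs. s i = zs ! i))"

section \<open>Computable fields\<close>

text \<open>
  An element may have several codes (for instance unreduced fractions), which is why a field comes
  with a zero test.
\<close>

record 'f presentation =
  decode :: "bits \<Rightarrow> 'f option"
  add_alg :: prog
  sub_alg :: prog
  mul_alg :: prog
  div_alg :: prog
  zero_alg :: prog

definition field_algorithms :: "'f presentation \<Rightarrow> prog set" where
  "field_algorithms K = {add_alg K, sub_alg K, mul_alg K, div_alg K, zero_alg K}"

definition computes_op :: "'f presentation \<Rightarrow> prog \<Rightarrow> 'f set \<Rightarrow> ('f \<Rightarrow> 'f \<Rightarrow> 'f) \<Rightarrow> bool" where
  "computes_op K p D f \<longleftrightarrow>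
     (\<forall>u v x y. decode K u = Some x \<longrightarrow> decode K v = Some y \<longrightarrow> y \<in> D \<longrightarrow>
       (\<exists>n w. outputs {} p [u, v] n [w] \<and> decode K w = Some (f x y)))"

definition computable_field :: "'f::field presentation \<Rightarrow> bool" where
  "computable_field K \<longleftrightarrow>
     (\<forall>x. \<exists>w. decode K w = Some x) \<and>
     computes_op K (add_alg K) UNIV (+) \<and>
     computes_op K (sub_alg K) UNIV (-) \<and>
     computes_op K (mul_alg K) UNIV (*) \<and>
     computes_op K (div_alg K) (- {0}) (/) \<and>
     (\<forall>w x. decode K w = Some x \<longrightarrow> (\<exists>n. outputs {} (zero_alg K) [w] n [[x = 0]]))"

definition poly_time_field :: "'f::field presentation \<Rightarrow> bool" where
  "poly_time_field K \<longleftrightarrow> (\<exists>P::nat poly. \<forall>u v x y.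
     decode K u = Some x \<longrightarrow> decode K v = Some y \<longrightarrow>
       (\<forall>p \<in> {add_alg K, sub_alg K, mul_alg K} \<union> (if y \<noteq> 0 then {div_alg K} else {}).
          \<exists>n s. exec {} p (load [u, v]) n s \<and> n \<le> poly P (bit_size [u, v])) \<and>
       (\<exists>n s. exec {} (zero_alg K) (load [u]) n s \<and> n \<le> poly P (bit_size [u])))"

section \<open>Problems and polynomial-time equivalence\<close>

text \<open>
  A decision problem is the set of its instances together with the set of its yes-instances.  A
  search problem is the set of its instances together with the set of correct answers to each
  instance.
\<close>

type_synonym decision_problem = "bits list set \<times> bits list set"

type_synonym search_problem = "bits list set \<times> (bits list \<Rightarrow> bits list set)"

text \<open>
  The running time is measured by the cost model \<open>U\<close> and the input length by \<open>len\<close>; it is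
  \<open>({}, bit_size)\<close> for bit complexity and \<open>(field_algorithms K, length)\<close> for arithmetic complexity,
  in which one field element counts as one unit of input and one field operation as one step.
\<close>

definition decision_reducible ::
  "prog set \<Rightarrow> (bits list \<Rightarrow> nat) \<Rightarrow> decision_problem \<Rightarrow> decision_problem \<Rightarrow> bool" where
  "decision_reducible U len = (\<lambda>(I, Y) (I', Y').
     \<exists>p (P::nat poly). \<forall>x\<in>I. \<exists>n y.
       outputs U p x n y \<and> n \<le> poly P (len x) \<and> y \<in> I' \<and> (y \<in> Y' \<longleftrightarrow> x \<in> Y))"

text \<open>
  \<open>p\<close> translates instances, and \<open>q\<close> turns any correct answer to the translated instance into a
  correct answer to the original one.
\<close>

definition search_reducible ::
  "prog set \<Rightarrow> (bits list \<Rightarrow> nat) \<Rightarrow> search_problem \<Rightarrow> search_problem \<Rightarrow> bool" where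
  "search_reducible U len = (\<lambda>(I, A) (I', A').
     \<exists>p q (P::nat poly). \<forall>x\<in>I. \<exists>n y.
       outputs U p x n y \<and> n \<le> poly P (len x) \<and> y \<in> I' \<and>
       (\<forall>w\<in>A' y. \<exists>m z. outputs U q (x @ w) m z \<and> m \<le> poly P (len (x @ w)) \<and> z \<in> A x))"

definition decision_equivalent ::
  "prog set \<Rightarrow> (bits list \<Rightarrow> nat) \<Rightarrow> decision_problem \<Rightarrow> decision_problem \<Rightarrow> bool" where
  "decision_equivalent U len D D' \<longleftrightarrow>
     decision_reducible U len D D' \<and> decision_reducible U len D' D"

definition search_equivalent ::
  "prog set \<Rightarrow> (bits list \<Rightarrow> nat) \<Rightarrow> search_problem \<Rightarrow> search_problem \<Rightarrow> bool" where
  "search_equivalent U len D D' \<longleftrightarrow>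
     search_reducible U len D D' \<and> search_reducible U len D' D"

definition codes :: "'f presentation \<Rightarrow> bits list \<Rightarrow> 'f list \<Rightarrow> bool" where
  "codes K = list_all2 (\<lambda>w x. decode K w = Some x)"

subsection \<open>Quaternion algebras in standard form\<close>

definition standard_pair :: "'f::field \<Rightarrow> 'f \<Rightarrow> bool" where
  "standard_pair a b \<longleftrightarrow> b \<noteq> 0 \<and> (CHAR('f) \<noteq> 2 \<longrightarrow> a \<noteq> 0)"

definition vec4 :: "'f \<Rightarrow> 'f \<Rightarrow> 'f \<Rightarrow> 'f \<Rightarrow> 'f ^ 4" where
  "vec4 w x y z = (\<chi> k. if k = 1 then w else if k = 2 then x else if k = 3 then y else z)"

text \<open>
  Coordinates with respect to \<open>1, i, j, ij\<close>.  Both characteristics are covered by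
  \<open>i\<^sup>2 = t i + a\<close>, \<open>j\<^sup>2 = b\<close>, \<open>j i = (t - i) j\<close>, where \<open>t = 1\<close> in characteristic 2 and
  \<open>t = 0\<close> otherwise.  The original relations are derived below.
\<close>

definition quat_mult :: "'f::field \<Rightarrow> 'f \<Rightarrow> 'f ^ 4 \<Rightarrow> 'f ^ 4 \<Rightarrow> 'f ^ 4" where
  "quat_mult a b x y = (let t = (if CHAR('f) = 2 then 1 else 0) in vec4
     (x$1 * y$1 + a * x$2 * y$2 + b * (x$3 * (y$3 + t * y$4) - a * x$4 * y$4))
     (x$1 * y$2 + x$2 * y$1 + t * x$2 * y$2 + b * (x$4 * y$3 - x$3 * y$4))
     (x$1 * y$3 + a * x$2 * y$4 + x$3 * (y$1 + t * y$2) - a * x$4 * y$2)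
     (x$1 * y$4 + x$2 * y$3 + t * x$2 * y$4 + x$4 * y$1 - x$3 * y$2))"

definition quat_one :: "'f::field ^ 4" where
  "quat_one = axis 1 1"

lemma quat_mult_relations:
  fixes a b :: "'f::field"
  defines "i \<equiv> axis 2 1 :: 'f ^ 4" and "j \<equiv> axis 3 1 :: 'f ^ 4" and "k \<equiv> axis 4 1 :: 'f ^ 4"
  shows "quat_mult a b i j = k"
    and "quat_mult a b j j = b *s quat_one"
    and "CHAR('f) \<noteq> 2 \<Longrightarrow> quat_mult a b i i = a *s quat_one"
    and "CHAR('f) \<noteq> 2 \<Longrightarrow> quat_mult a b j i = - quat_mult a b i j"
    and "CHAR('f) = 2 \<Longrightarrow> quat_mult a b i i + i = a *s quat_one"
    and "CHAR('f) = 2 \<Longrightarrow> quat_mult a b j i = quat_mult a b (i + quat_one) j"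
proof -
  have two: "CHAR('f) = 2 \<Longrightarrow> (1::'f) + 1 = 0"
    by (metis of_nat_CHAR of_nat_numeral one_add_one)
  then have neg: "CHAR('f) = 2 \<Longrightarrow> - (1::'f) = 1"
    by (simp add: eq_neg_iff_add_eq_0 minus_equation_iff)
  note defs = quat_mult_def vec4_def axis_def vec_eq_iff forall_4 quat_one_def i_def j_def k_def Let_def
  show "quat_mult a b i j = k" by (simp add: defs)
  show "quat_mult a b j j = b *s quat_one" by (simp add: defs)
  show "CHAR('f) \<noteq> 2 \<Longrightarrow> quat_mult a b i i = a *s quat_one" by (simp add: defs)
  show "CHAR('f) \<noteq> 2 \<Longrightarrow> quat_mult a b j i = - quat_mult a b i j" by (simp add: defs)
  show "CHAR('f) = 2 \<Longrightarrow> quat_mult a b i i + i = a *s quat_one" using two by (simp add: defs)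
  show "CHAR('f) = 2 \<Longrightarrow> quat_mult a b j i = quat_mult a b (i + quat_one) j" using neg by (simp add: defs)
qed

lemma unital_algebra_quat_mult: "unital_algebra (*s) (quat_mult a b) quat_one"
  by unfold_locales
    (simp_all add: quat_mult_def vec4_def vec_eq_iff forall_4 quat_one_def axis_def Let_def algebra_simps)

subsection \<open>The four problems\<close>

definition matrix_scale :: "'f::field \<Rightarrow> 'f ^ 2 ^ 2 \<Rightarrow> 'f ^ 2 ^ 2" where
  "matrix_scale c M = (\<chi> r s. c * M $ r $ s)"

definition splitting :: "'f::field \<Rightarrow> 'f \<Rightarrow> ('f ^ 4 \<Rightarrow> 'f ^ 2 ^ 2) \<Rightarrow> bool" where
  "splitting a b \<phi> \<longleftrightarrow>
     algebra_iso (*s) (quat_mult a b) quat_one matrix_scale (**) (mat 1) \<phi>"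

definition matrix_entries :: "'f ^ 2 ^ 2 \<Rightarrow> 'f list" where
  "matrix_entries M = [M$1$1, M$1$2, M$2$1, M$2$2]"

definition map_entries :: "('f::field ^ 4 \<Rightarrow> 'f ^ 2 ^ 2) \<Rightarrow> 'f list" where
  "map_entries \<phi> = concat (map (\<lambda>k. matrix_entries (\<phi> (axis k 1))) [1, 2, 3, 4])"

definition algebra_instances :: "'f::field presentation \<Rightarrow> bits list set" where
  "algebra_instances K = {ws. \<exists>a b. codes K ws [a, b] \<and> standard_pair a b}"

definition IsMatrixRing :: "'f::field presentation \<Rightarrow> decision_problem" where
  "IsMatrixRing K = (algebra_instances K,
     {ws. \<exists>a b. codes K ws [a, b] \<and> standard_pair a b \<and> (\<exists>\<phi>. splitting a b \<phi>)})"

definition ExhibitMatrixRing :: "'f::field presentation \<Rightarrow> search_problem" where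
  "ExhibitMatrixRing K = (algebra_instances K, \<lambda>ws.
     {[True] # zs | zs. \<exists>a b \<phi>. codes K ws [a, b] \<and> splitting a b \<phi> \<and> codes K zs (map_entries \<phi>)} \<union>
     {[[False]] | a b. codes K ws [a, b] \<and> (\<nexists>\<phi>. splitting a b \<phi>)})"

definition conic_instances :: "'f::field presentation \<Rightarrow> bits list set" where
  "conic_instances K = {ws. \<exists>a b c d e f. codes K ws [a, b, c, d, e, f] \<and> (a, b, c, d, e, f) \<in> conics}"

definition rational_point :: "'f::field qform \<Rightarrow> 'f ^ 3 \<Rightarrow> bool" where
  "rational_point Q v \<longleftrightarrow> v \<noteq> 0 \<and> qeval Q v = 0"

definition HasPoint :: "'f::field presentation \<Rightarrow> decision_problem" where
  "HasPoint K = (conic_instances K,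
     {ws. \<exists>a b c d e f. codes K ws [a, b, c, d, e, f] \<and> (a, b, c, d, e, f) \<in> conics \<and>
        (\<exists>v. rational_point (a, b, c, d, e, f) v)})"

definition ExhibitPoint :: "'f::field presentation \<Rightarrow> search_problem" where
  "ExhibitPoint K = (conic_instances K, \<lambda>ws.
     {[True] # zs | zs. \<exists>a b c d e f v. codes K ws [a, b, c, d, e, f] \<and>
        rational_point (a, b, c, d, e, f) v \<and> codes K zs [v$1, v$2, v$3]} \<union>
     {[[False]] | a b c d e f. codes K ws [a, b, c, d, e, f] \<and>
        (\<nexists>v. rational_point (a, b, c, d, e, f) v)})"

end

theory Submission
  imports Defs
begin

text \<open>
  A central simple algebra of dimension 4 has no two independent commuting elements besides the
  scalars, so every element is quadratic, and a primeness argument produces standard generators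
  \<open>i, j\<close>.  The classification then only concerns the algebras \<open>(a, b | F)\<close> and the forms
  \<open>quat_form a b\<close>.  A similarity of two such forms carries the products of pairs of pure quaternions
  (the even Clifford algebra) to standard generators, which gives injectivity.  Conversely, in a
  nonsingular ternary form one finds, in an explicit finite list, two vectors spanning a
  nondegenerate plane on which the form is not zero; completing them by the normal vector of the plane
  puts the form in the shape \<open>quat_form a b\<close> up to a scalar.

  For the computational part, a zero of the form is a nilpotent element \<open>e\<close>, which has a partner \<open>f\<close> with
  \<open>f\<^sup>2 = 0\<close> and \<open>e f + f e = 1\<close>, hence a system of matrix units; a splitting gives back a zero as the
  pure quaternion whose matrix has vanishing first column.  All these maps are given by field
  operations and zero tests.
\<close>

unbundle no m_inv_syntax

section \<open>Standard generators of quaternion algebras\<close>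

text \<open>Three obstacles shape the proof. Characteristic 2 has to run alongside the other case:
  \<open>quat_t\<close> is the trace of the generator \<open>i\<close>, and \<open>qdisc\<close> is
  half the Gram determinant, which still detects singular forms when that determinant is 0. Singular
  points that are not rational matter only for diagonal forms in characteristic 2. A similarity of
  norm forms has a factor \<open>c\<close> that need not be a square, so the linear map of pure
  quaternions cannot in general be rescaled to an isometry. Products of two pure quaternions are
  multiplied by \<open>c\<close> itself, which can be divided out; hence the detour through such
  products. In the reductions every choice must cost a bounded number of field operations and zero
  tests, over an arbitrary field. This is why planes are taken from a finite list and inverse maps
  are written through the trace form and cross products instead of solving equations. A bounded
  number of operations also serves both cost models at once: if one operation has polynomial time
  and output size, so does a fixed composition.\<close>

lemma two_eq_0_iff: "(2::'f::field) = 0 \<longleftrightarrow> CHAR('f) = 2"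
proof
  assume "(2::'f) = 0"
  then have "CHAR('f) dvd 2" using of_nat_eq_0_iff_char_dvd[of 2, where 'a='f] by simp
  moreover have "CHAR('f) \<noteq> 1" by (metis of_nat_1 of_nat_CHAR one_neq_zero)
  ultimately show "CHAR('f) = 2" using prime_nat_iff two_is_prime_nat by blast
next
  assume "CHAR('f) = 2"
  then show "(2::'f) = 0" by (metis of_nat_CHAR of_nat_numeral)
qed

context unital_algebra
begin

lemma mult_add_left: "mult (x + y) z = mult x z + mult y z"
  using linear_left[of z] by (simp add: Vector_Spaces.linear_iff)

lemma mult_add_right: "mult z (x + y) = mult z x + mult z y"
  using linear_right[of z] by (simp add: Vector_Spaces.linear_iff)

lemma mult_scale_left: "mult (scale c x) z = scale c (mult x z)"
  using linear_left[of z] by (simp add: Vector_Spaces.linear_iff)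

lemma mult_scale_right: "mult z (scale c x) = scale c (mult z x)"
  using linear_right[of z] by (simp add: Vector_Spaces.linear_iff)

lemma mult_zero_left [simp]: "mult 0 x = 0"
  using mult_add_left[of 0 0 x] by simp

lemma mult_zero_right [simp]: "mult x 0 = 0"
  using mult_add_right[of x 0 0] by simp

lemma mult_minus_left: "mult (- x) y = - mult x y"
  using mult_add_left[of x "- x" y] by (simp add: eq_neg_iff_add_eq_0 add.commute)

lemma mult_minus_right: "mult x (- y) = - mult x y"
  using mult_add_right[of x y "- y"] by (simp add: eq_neg_iff_add_eq_0 add.commute)

lemma mult_diff_left: "mult (x - y) z = mult x z - mult y z"
  using mult_add_left[of x "- y" z] by (simp add: mult_minus_left)

lemma mult_diff_right: "mult z (x - y) = mult z x - mult z y"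
  using mult_add_right[of z x "- y"] by (simp add: mult_minus_right)

lemmas mult_distribs = mult_add_left mult_add_right mult_scale_left mult_scale_right
  mult_minus_left mult_minus_right mult_diff_left mult_diff_right

lemmas scale_distribs = scale_right_distrib scale_left_distrib scale_right_diff_distrib
  scale_left_diff_distrib scale_minus_left scale_minus_right

lemmas mult_simps = mult_distribs scale_distribs mult_assoc one_left one_right

end

definition quat_t :: "'f::field" where
  "quat_t = (if CHAR('f) = 2 then 1 else 0)"

definition (in unital_algebra) standard_generators :: "'f \<Rightarrow> 'f \<Rightarrow> 'b \<Rightarrow> 'b \<Rightarrow> bool" where
  "standard_generators a b i j \<longleftrightarrow>
     mult i i = scale quat_t i + scale a one \<and> mult j j = scale b one \<and>
     mult j i = scale quat_t j - mult i j"

section \<open>Consequences of simplicity and dimension 4\<close>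

context quaternion_algebra
begin

lemma finite_dimensional: "\<exists>Basis. finite_dimensional_vector_space scale Basis"
proof -
  obtain Bs where Bs: "independent Bs" "UNIV \<subseteq> span Bs" "card Bs = dim UNIV"
    using basis_exists[of UNIV] by auto
  have "finite Bs"
    using Bs(3) dimension card.infinite by fastforce
  then have "finite_dimensional_vector_space scale Bs"
    using Bs by unfold_locales auto
  then show ?thesis ..
qed

lemma one_nonzero: "one \<noteq> 0"
proof
  assume "one = 0"
  then have "mult 0 x = x" for x using one_left by simp
  then have "UNIV \<subseteq> span {}" by auto
  then have "dim UNIV = card ({} :: 'b set)" by (intro dim_eq_card) (auto simp: independent_empty)
  then show False using dimension by simp
qed

text \<open>The left annihilator of the left ideal \<open>B y\<close> is two-sided, so by simplicity
  it is zero or contains \<open>one\<close>.\<close>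

lemma prime_algebra:
  assumes "\<And>b. mult x (mult b y) = 0"
  shows "x = 0 \<or> y = 0"
proof -
  let ?I = "{z. \<forall>b. mult z (mult b y) = 0}"
  have "two_sided_ideal ?I"
    unfolding two_sided_ideal_def
    by (auto simp: mult_distribs mult_assoc) (metis mult_assoc)
  then have "?I = {0} \<or> ?I = UNIV" by (rule simple)
  then show ?thesis
  proof
    assume "?I = {0}" then show ?thesis using assms by blast
  next
    assume "?I = UNIV"
    then have "mult one (mult one y) = 0" by blast
    then show ?thesis by (simp add: one_left)
  qed
qed

lemma central_iff: "(\<forall>z. mult x z = mult z x) \<longleftrightarrow> (\<exists>c. x = scale c one)"
  using central by (auto simp: set_eq_iff)

text \<open>
  If \<open>1, x, y\<close> were independent, they would span the centralizer \<open>C\<close> of \<open>x, y\<close>, of codimension 1.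
  Subtracting a scalar from \<open>x\<close> we get \<open>x B \<subseteq> C\<close>, so that \<open>x\<close> annihilates every \<open>[b, y]\<close>, and then so
  does \<open>x B\<close>.
\<close>

lemma commuting_elements:
  assumes comm: "mult x y = mult y x" and x: "x \<notin> range (\<lambda>c. scale c one)"
  shows "\<exists>p q. y = scale p one + scale q x"
proof (rule ccontr)
  assume no: "\<not> ?thesis"
  obtain Bs where "finite_dimensional_vector_space scale Bs" using finite_dimensional ..
  then interpret fd: finite_dimensional_vector_space scale Bs .
  obtain z where z: "mult x z \<noteq> mult z x" using x central_iff by blast
  have sp1: "v \<in> span {one, x} \<longleftrightarrow> (\<exists>p q. v = scale p one + scale q x)" for v
    by (auto simp: span_breakdown_eq diff_eq_eq add.commute)
  have sp2: "v \<in> span {one, x, y} \<longleftrightarrow> (\<exists>p q r. v = scale p one + scale q x + scale r y)" for v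
  proof -
    have "v \<in> span {one, x, y} \<longleftrightarrow> v \<in> span {y, x, one}" by (simp add: insert_commute)
    also have "\<dots> \<longleftrightarrow> (\<exists>r q p. v - scale r y - scale q x - scale p one = 0)"
      by (simp add: span_breakdown_eq)
    also have "\<dots> \<longleftrightarrow> (\<exists>p q r. v = scale p one + scale q x + scale r y)"
      by (metis (no_types, lifting) add.commute diff_eq_eq eq_iff_diff_eq_0)
    finally show ?thesis .
  qed
  have "x \<notin> span {one}" using x by (auto simp: span_singleton)
  moreover have "y \<notin> span {one, x}" using no sp1 by auto
  moreover have Cspan: "mult x v = mult v x \<and> mult y v = mult v y" if "v \<in> span {one, x, y}" for v
    using that comm unfolding sp2 by (auto simp: mult_simps)
  then have "z \<notin> span {one, x, y}" using z by blast
  moreover have "one \<notin> span {}" using one_nonzero by simp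
  moreover have "one \<in> span {one}" "one \<in> span {one, x}" "x \<in> span {one, x}"
    "one \<in> span {one, x, y}" "x \<in> span {one, x, y}" "y \<in> span {one, x, y}"
    by (simp_all add: span_base)
  ultimately have ne: "z \<notin> {y, x, one}" "y \<notin> {x, one}" "x \<notin> {one}"
    and nsp: "z \<notin> span {y, x, one}" "y \<notin> span {x, one}" "x \<notin> span {one}"
    by (auto simp: insert_commute)
  have ind: "independent {z, y, x, one}"
    using nsp ne one_nonzero by (simp add: independent_insert)
  have card: "card {z, y, x, one} = 4" using ne by simp
  have "UNIV \<subseteq> span {z, y, x, one}"
    by (rule fd.card_ge_dim_independent[OF _ ind]) (use card dimension in simp_all)
  then have full: "\<exists>k. v - scale k z \<in> span {one, x, y}" for v
    using span_breakdown_eq[of v z "{y, x, one}"] by (auto simp: insert_commute)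
  obtain l where l: "mult x z - scale l z \<in> span {one, x, y}" using full by blast
  define x' where "x' = x - scale l one"
  have C_mult: "mult y (mult x' v) = mult (mult x' v) y" if "mult y v = mult v y" for v
    using that comm by (simp add: x'_def mult_simps) (metis mult_assoc)
  have C: "mult (mult x' b) y = mult x' (mult y b)" for b
  proof -
    obtain k where k: "b - scale k z \<in> span {one, x, y}" using full by blast
    have "mult x' (scale k z) = scale k (mult x z - scale l z)"
      by (simp add: x'_def mult_simps)
    then have "mult x' b = mult x' (b - scale k z) + scale k (mult x z - scale l z)"
      by (simp add: mult_diff_right)
    then have "mult (mult x' b) y = mult y (mult x' b)"
      using C_mult[of "b - scale k z"] Cspan[OF k] Cspan[OF l] by (simp add: mult_add_left mult_add_right mult_scale_left mult_scale_right)
    then show ?thesis using comm by (simp add: x'_def mult_simps) (metis mult_assoc)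
  qed
  have x'_nonzero: "x' \<noteq> 0" using x by (auto simp: x'_def)
  have "mult x' (mult b' (mult b y - mult y b)) = 0" for b b'
  proof -
    have "mult x' (mult b' (mult y b)) = mult (mult (mult x' b') y) b" by (simp only: mult_assoc)
    also have "\<dots> = mult x' (mult y (mult b' b))" by (simp only: C) (simp only: mult_assoc)
    also have "\<dots> = mult (mult x' (mult b' b)) y" by (simp add: C)
    finally show ?thesis by (simp add: mult_diff_right mult_assoc)
  qed
  then have "mult b y - mult y b = 0" for b
    using prime_algebra x'_nonzero by blast
  then have "\<exists>c. y = scale c one" by (simp flip: central_iff)
  then show False using no by (metis add.right_neutral scale_zero_left)
qed

text \<open>An element commutes with its square.\<close>

lemma quadratic: "\<exists>t n. mult x x = scale t x + scale n one"
proof (cases "x \<in> range (\<lambda>c. scale c one)")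
  case True
  then obtain c where "x = scale c one" by blast
  then have "mult x x = scale c x + scale 0 one" by (simp add: mult_simps)
  then show ?thesis by blast
next
  case False
  then show ?thesis
    using commuting_elements[of x "mult x x"] by (metis mult_assoc add.commute)
qed

lemma noncentral: "\<exists>x. x \<notin> range (\<lambda>c. scale c one)"
proof (rule ccontr)
  assume "\<not> ?thesis"
  then have "UNIV \<subseteq> span {one}" by (auto simp: span_singleton)
  then have "dim UNIV = card {one}"
    using one_nonzero by (intro dim_eq_card) (auto simp: independent_insert independent_empty)
  then show False using dimension by simp
qed

section \<open>Construction of standard generators\<close>

lemma semiprime: "x \<noteq> 0 \<Longrightarrow> \<exists>y. mult x (mult y x) \<noteq> 0"
  using prime_algebra by blast

lemma standard_generators_char_2:
  assumes two: "(2::'a) = 0"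
  shows "\<exists>a b i j. b \<noteq> 0 \<and> standard_generators a b i j"
proof -
  have dbl: "x + x = 0" for x :: 'b
    using scale_left_distrib[of 1 1 x] two by simp
  have neg: "- x = x" for x :: 'b using dbl[of x] by (simp add: neg_eq_iff_add_eq_0)
  have dbl': "x + (x + y) = y" for x y :: 'b by (simp add: dbl flip: add.assoc)
  have t: "quat_t = (1::'a)" using two two_eq_0_iff[where 'f='a] by (simp add: quat_t_def)
  \<comment> \<open>A noncentral element of nonzero trace, scaled to trace 1, will do. Without one,
    all squares are scalar, and so are all \<open>x y + y x\<close>. Choose \<open>x, y\<close> that
    do not commute, so that \<open>g = x y + y x\<close> is nonzero; polarizing at \<open>x\<close>
    and \<open>x y\<close> gives the scalar \<open>x (x y + y x) = g x\<close>, which makes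
    \<open>x\<close> central.\<close>
  have "\<exists>i a. i \<notin> range (\<lambda>c. scale c one) \<and> mult i i = i + scale a one"
  proof (cases "\<exists>x t n. x \<notin> range (\<lambda>c. scale c one) \<and> t \<noteq> 0 \<and> mult x x = scale t x + scale n one")
    case True
    then obtain x t n where x: "x \<notin> range (\<lambda>c. scale c one)" "t \<noteq> 0"
      "mult x x = scale t x + scale n one" by blast
    let ?i = "scale (inverse t) x"
    have "mult ?i ?i = ?i + scale (inverse t * inverse t * n) one"
      using x by (simp add: mult_simps)
    moreover have "?i \<notin> range (\<lambda>c. scale c one)"
    proof
      assume "?i \<in> range (\<lambda>c. scale c one)"
      then obtain c where "?i = scale c one" by blast
      then have "x = scale (t * c) one" using x(2) by (metis scale_scale scale_one right_inverse)
      then show False using x(1) by blast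
    qed
    ultimately show ?thesis by blast
  next
    case False
    then have sq: "\<exists>n. mult x x = scale n one" for x
    proof (cases "x \<in> range (\<lambda>c. scale c one)")
      case True then show ?thesis by (auto simp: mult_simps)
    next
      case F: False
      then show ?thesis using False quadratic[of x] by (metis add_0 scale_zero_left)
    qed
    have polar: "\<exists>n. mult x y + mult y x = scale n one" for x y
    proof -
      obtain p q r where "mult (x + y) (x + y) = scale p one" "mult x x = scale q one"
        "mult y y = scale r one" using sq by metis
      then have "mult x y + mult y x = scale (p - q - r) one"
        by (simp add: mult_simps algebra_simps)
      then show ?thesis ..
    qed
    obtain x where x: "x \<notin> range (\<lambda>c. scale c one)" using noncentral ..
    then obtain y where xy: "mult x y \<noteq> mult y x" using central_iff[of x] by blast
    obtain g where g: "mult x y + mult y x = scale g one" using polar by blast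
    obtain h where h: "mult x (mult x y) + mult (mult x y) x = scale h one" using polar by blast
    have "g \<noteq> 0" using g xy neg[of "mult y x"] by (auto simp: eq_neg_iff_add_eq_0[symmetric])
    have "scale h one = mult x (mult x y + mult y x)" using h by (simp add: mult_simps)
    then have "scale h one = scale g x" by (simp add: g mult_simps)
    then have "x = scale (inverse g * h) one" using \<open>g \<noteq> 0\<close>
      by (metis scale_scale scale_one left_inverse)
    then show ?thesis using x by blast
  qed
  then obtain i a where i: "i \<notin> range (\<lambda>c. scale c one)" and ii: "mult i i = i + scale a one" by blast
  have ii': "mult i (mult i v) = mult i v + scale a v" for v
    using ii by (simp add: mult_simps flip: mult_assoc)
  \<comment> \<open>\<open>D\<close> is the projection onto the elements with
    \<open>z i = (1 + i) z\<close>, along the centralizer of \<open>i\<close>. Any value of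
    \<open>D\<close> with nonzero square can serve as \<open>j\<close>.\<close>
  define D where "D y = mult i y + mult y i" for y
  have D: "mult (D y) i = D y - mult i (D y)" for y
    unfolding D_def by (simp add: mult_simps ii ii' neg dbl dbl' add_ac)
  \<comment> \<open>Moving \<open>i\<close> past \<open>D y\<close> twice shows that the square
    commutes with \<open>i\<close>; hence so does its linear part \<open>s (D y)\<close>, and the
    twisted commutation rule forces that part to vanish.\<close>
  have Dsq: "\<exists>n. mult (D y) (D y) = scale n one" for y
  proof -
    obtain s n where sn: "mult (D y) (D y) = scale s (D y) + scale n one" using quadratic by blast
    have "mult (mult (D y) (D y)) i = mult i (mult (D y) (D y))"
      by (simp only: mult_assoc D mult_diff_right) (simp add: D mult_diff_left mult_assoc flip: mult_assoc[of "D y" i])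
    then have "scale s (mult (D y) i) = scale s (mult i (D y))"
      unfolding sn by (simp add: mult_simps)
    then have "scale s (D y) = scale s (mult i (D y)) + scale s (mult i (D y))"
      unfolding D by (simp add: scale_distribs diff_eq_eq)
    then have "scale s (D y) = 0" by (simp only: dbl)
    then show ?thesis using sn by auto
  qed
  \<comment> \<open>If all these squares vanish, then \<open>D x\<close> annihilates itself across
    every \<open>y\<close>: write \<open>y\<close> as \<open>D y\<close> plus some
    \<open>p + q i\<close> and move one factor \<open>D x\<close> to the other. Semiprimeness then
    gives \<open>D = 0\<close>, so that \<open>i\<close> is central.\<close>
  have "\<exists>y. mult (D y) (D y) \<noteq> 0"
  proof (rule ccontr)
    assume "\<not> ?thesis"
    then have sq0: "mult (D y) (D y) = 0" for y by blast
    then have sq0': "mult (D y) (mult (D y) v) = 0" for y v by (simp flip: mult_assoc)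
    have Dadd: "D (x + y) = D x + D y" for x y by (simp add: D_def mult_simps add_ac)
    have anti: "mult (D x) (D y) = mult (D y) (D x)" for x y
    proof -
      have "mult (D x) (D y) + mult (D y) (D x) = 0"
        using sq0[of "x + y"] sq0[of x] sq0[of y] by (simp add: Dadd mult_simps add.commute)
      then show ?thesis by (simp add: eq_neg_iff_add_eq_0[symmetric] neg)
    qed
    have zero: "mult (D x) (mult y (D x)) = 0" for x y
    proof -
      have "mult i (y + D y) = mult (y + D y) i"
        by (simp add: D_def mult_simps ii ii' add_ac dbl dbl')
      then obtain p q where pq: "y + D y = scale p one + scale q i"
        using commuting_elements i by blast
      then have y: "scale p one + scale q i + D y = y"
        by (metis add.assoc add.right_neutral dbl)
      have "mult (D x) (mult (scale p one + scale q i + D y) (D x)) =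
          scale p (mult (D x) (D x)) + scale q (mult (mult (D x) i) (D x)) + mult (D x) (mult (D y) (D x))"
        by (simp only: mult_assoc mult_add_left mult_add_right mult_scale_left mult_scale_right one_left)
      then have "mult (D x) (mult y (D x)) =
          scale p (mult (D x) (D x)) + scale q (mult (mult (D x) i) (D x)) + mult (D x) (mult (D y) (D x))"
        by (simp only: y)
      also have "\<dots> = 0"
        by (simp add: D mult_diff_left sq0 mult_assoc anti[of y x] sq0')
      finally show ?thesis .
    qed
    then have "D x = 0" for x using semiprime by blast
    then have "mult i x = mult x i" for x
      by (metis D_def eq_neg_iff_add_eq_0 neg)
    then show False using i central_iff by blast
  qed
  then obtain y where y: "mult (D y) (D y) \<noteq> 0" ..
  obtain b where b: "mult (D y) (D y) = scale b one" using Dsq by blast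
  then have "b \<noteq> 0" using y by auto
  moreover have "standard_generators a b i (D y)"
    using D b ii by (simp add: standard_generators_def t)
  ultimately show ?thesis by blast
qed

lemma standard_generators_not_char_2:
  assumes two: "(2::'a) \<noteq> 0"
  shows "\<exists>a b i j. a \<noteq> 0 \<and> b \<noteq> 0 \<and> standard_generators a b i j"
proof -
  have t: "quat_t = (0::'a)" using two two_eq_0_iff[where 'f='a] by (simp add: quat_t_def)
  have half: "scale (1/2) x + scale (1/2) x = x" for x
    using two by (simp flip: scale_left_distrib)
  have dbl: "x + x = 0 \<longleftrightarrow> x = 0" for x :: 'b
  proof -
    have "x + x = scale 2 x" using scale_left_distrib[of 1 1 x] by simp
    then show ?thesis using two by simp
  qed
  have complete: "\<exists>s n. mult (x - scale s one) (x - scale s one) = scale n one" for x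
  proof -
    obtain s n where "mult x x = scale s x + scale n one" using quadratic by blast
    then have "mult (x - scale (s/2) one) (x - scale (s/2) one) = scale (n + s/2 * (s/2)) one"
      using half[of "scale s x"] by (simp add: mult_simps algebra_simps)
    then show ?thesis by blast
  qed
  have shift: "x - scale s one \<notin> range (\<lambda>c. scale c one)" if "x \<notin> range (\<lambda>c. scale c one)" for x s
  proof
    assume "x - scale s one \<in> range (\<lambda>c. scale c one)"
    then obtain c where "x - scale s one = scale c one" by blast
    then have "x = scale (c + s) one" by (simp add: scale_distribs diff_eq_eq)
    then show False using that by blast
  qed
  \<comment> \<open>Otherwise every noncentral element has square 0 after subtraction of a scalar.
    Take such \<open>i\<close> and \<open>y\<close> with \<open>i y i\<close> nonzero. The equation
    for \<open>i + y - s\<close> expresses \<open>i y + y i\<close>; multiplying it by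
    \<open>i\<close> from either side and comparing gives \<open>2 s (i y - y i) = 0\<close>, hence
    \<open>s = 0\<close> and \<open>i y i = 0\<close>.\<close>
  have "\<exists>i a. i \<notin> range (\<lambda>c. scale c one) \<and> a \<noteq> 0 \<and> mult i i = scale a one"
  proof (rule ccontr)
    assume no: "\<not> ?thesis"
    have nil: "\<exists>s. mult (x - scale s one) (x - scale s one) = 0" if x: "x \<notin> range (\<lambda>c. scale c one)" for x
      using complete[of x] shift[OF x] no by (metis scale_zero_left)
    obtain i where i: "i \<notin> range (\<lambda>c. scale c one)" "mult i i = 0"
      using noncentral nil shift by metis
    have ii': "mult i (mult i v) = 0" for v using i by (simp flip: mult_assoc)
    have "i \<noteq> 0" using i(1) by (metis range_eqI scale_zero_left)
    then obtain y0 where y0: "mult i (mult y0 i) \<noteq> 0" using semiprime by blast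
    have "y0 \<notin> range (\<lambda>c. scale c one)" using y0 i by (auto simp: mult_simps)
    then obtain r where r: "mult (y0 - scale r one) (y0 - scale r one) = 0" using nil by blast
    define y where "y = y0 - scale r one"
    have y: "mult y y = 0" "mult i (mult y i) \<noteq> 0"
      using r y0 i by (simp_all add: y_def mult_simps)
    have nc: "mult i y \<noteq> mult y i" using y ii' by metis
    have "i + y \<notin> range (\<lambda>c. scale c one)"
    proof
      assume "i + y \<in> range (\<lambda>c. scale c one)"
      then obtain c where "y = scale c one - i" by (metis add_diff_cancel_left' imageE)
      then show False using nc by (simp add: mult_simps)
    qed
    then obtain s where s: "mult (i + y - scale s one) (i + y - scale s one) = 0" using nil by blast
    then have e: "mult i y + mult y i = scale s (i + y) + scale s (i + y) - scale (s * s) one"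
      using i y by (simp add: mult_simps algebra_simps)
    have "mult i (mult y i) = mult i (mult i y + mult y i)" by (simp add: mult_add_right ii')
    then have e1: "mult i (mult y i) = scale s (mult i y) + scale s (mult i y) - scale (s * s) i"
      unfolding e using i by (simp add: mult_simps)
    have "mult i (mult y i) = mult (mult i y + mult y i) i" using i by (simp add: mult_simps)
    then have e2: "mult i (mult y i) = scale s (mult y i) + scale s (mult y i) - scale (s * s) i"
      unfolding e using i by (simp add: mult_simps)
    have "scale s (mult i y - mult y i) + scale s (mult i y - mult y i) = 0"
      using e1 e2 by (simp add: scale_distribs algebra_simps)
    then have "s = 0" using dbl nc by simp
    then show False using e1 y by simp
  qed
  then obtain i a where i: "i \<notin> range (\<lambda>c. scale c one)" and a: "a \<noteq> 0"
    and ii: "mult i i = scale a one" by blast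
  have ii': "mult i (mult i v) = scale a v" for v
    using ii by (simp add: mult_simps flip: mult_assoc)
  \<comment> \<open>This is \<open>2 a\<close> times the projection onto the elements that
    anticommute with \<open>i\<close>, the (-1)-eigenspace of conjugation by \<open>i\<close>. From
    here on the argument runs as in characteristic 2.\<close>
  define D where "D y = scale a y - mult i (mult y i)" for y
  have D: "mult (D y) i = - mult i (D y)" for y
    unfolding D_def by (simp add: mult_simps ii ii')
  have Dsq: "\<exists>n. mult (D y) (D y) = scale n one" for y
  proof -
    obtain s n where sn: "mult (D y) (D y) = scale s (D y) + scale n one" using quadratic by blast
    have "mult (mult (D y) (D y)) i = mult i (mult (D y) (D y))"
      by (simp add: mult_assoc D mult_minus_right) (simp add: D mult_minus_left flip: mult_assoc)
    then have "scale s (mult (D y) i) = scale s (mult i (D y))"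
      unfolding sn by (simp add: mult_simps)
    then have "scale s (mult i (D y)) + scale s (mult i (D y)) = 0" unfolding D
      by (simp add: scale_distribs eq_neg_iff_add_eq_0 neg_eq_iff_add_eq_0)
    then have "mult i (scale s (D y)) = 0" by (simp add: dbl mult_scale_right)
    then have "scale a (scale s (D y)) = 0" by (metis ii' mult_zero_right)
    then show ?thesis using sn a by auto
  qed
  have "\<exists>y. mult (D y) (D y) \<noteq> 0"
  proof (rule ccontr)
    assume "\<not> ?thesis"
    then have sq0: "mult (D y) (D y) = 0" for y by blast
    then have sq0': "mult (D y) (mult (D y) v) = 0" for y v by (simp flip: mult_assoc)
    have Dadd: "D (x + y) = D x + D y" for x y by (simp add: D_def mult_simps)
    have anti: "mult (D x) (D y) = - mult (D y) (D x)" for x y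
      using sq0[of "x + y"] sq0[of x] sq0[of y]
      by (simp add: Dadd mult_simps eq_neg_iff_add_eq_0 add.commute)
    have zero: "mult (D x) (mult y (D x)) = 0" for x y
    proof -
      let ?c = "scale a y + mult i (mult y i)"
      have "mult i ?c = mult ?c i"
        by (simp add: mult_simps ii ii' add_ac)
      then obtain p q where pq: "?c = scale p one + scale q i"
        using commuting_elements i by blast
      have "scale a (mult (D x) (mult y (D x))) + scale a (mult (D x) (mult y (D x)))
          = mult (D x) (mult (?c + D y) (D x))"
        by (simp add: D_def[of y] mult_simps)
      also have "\<dots> = scale p (mult (D x) (D x)) + scale q (mult (mult (D x) i) (D x)) + mult (D x) (mult (D y) (D x))"
        unfolding pq by (simp add: mult_simps)
      also have "\<dots> = 0"
        by (simp add: D mult_minus_left mult_minus_right sq0 mult_assoc anti[of y x] sq0')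
      finally show ?thesis using a dbl by simp
    qed
    then have D0: "D x = 0" for x using semiprime by blast
    have "mult i x = mult x i" for x
    proof -
      have "scale a (mult i x) = mult i (mult i (mult x i))"
        using D0[of x] by (simp add: D_def mult_scale_right[symmetric])
      then show ?thesis using a by (simp add: ii')
    qed
    then show False using i central_iff by blast
  qed
  then obtain y where y: "mult (D y) (D y) \<noteq> 0" ..
  obtain b where b: "mult (D y) (D y) = scale b one" using Dsq by blast
  then have "b \<noteq> 0" using y by auto
  moreover have "standard_generators a b i (D y)"
    using D b ii by (simp add: standard_generators_def t)
  ultimately show ?thesis using a by blast
qed

lemma ex_standard_generators: "\<exists>a b i j. standard_pair a b \<and> standard_generators a b i j"
proof (cases "(2::'a) = 0")
  case True
  then show ?thesis
    using standard_generators_char_2 two_eq_0_iff[where 'f='a] by (auto simp: standard_pair_def)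
next
  case False
  then show ?thesis
    using standard_generators_not_char_2 by (auto simp: standard_pair_def)
qed

end

section \<open>Algebras in standard form\<close>

lemma quat_t_cases: "quat_t = (0::'f::field) \<and> (2::'f) \<noteq> 0 \<or> quat_t = (1::'f) \<and> (2::'f) = 0"
  by (simp add: quat_t_def two_eq_0_iff)

lemma vec4_nth [simp]:
  "vec4 w x y z $ 1 = w" "vec4 w x y z $ 2 = x" "vec4 w x y z $ 3 = y" "vec4 w x y z $ 4 = z"
  by (simp_all add: vec4_def)

lemma vec4_eq_iff: "v = w \<longleftrightarrow> v $ 1 = w $ 1 \<and> v $ 2 = w $ 2 \<and> v $ 3 = w $ 3 \<and> v $ 4 = w $ (4::4)"
  by (simp add: vec_eq_iff forall_4)

lemma quat_mult_nth:
  "quat_mult a b x y $ 1 = x$1 * y$1 + a * x$2 * y$2 + b * (x$3 * (y$3 + quat_t * y$4) - a * x$4 * y$4)"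
  "quat_mult a b x y $ 2 = x$1 * y$2 + x$2 * y$1 + quat_t * x$2 * y$2 + b * (x$4 * y$3 - x$3 * y$4)"
  "quat_mult a b x y $ 3 = x$1 * y$3 + a * x$2 * y$4 + x$3 * (y$1 + quat_t * y$2) - a * x$4 * y$2"
  "quat_mult a b x y $ 4 = x$1 * y$4 + x$2 * y$3 + quat_t * x$2 * y$4 + x$4 * y$1 - x$3 * y$2"
  by (simp_all add: quat_mult_def quat_t_def Let_def)

lemma quat_one_nth [simp]:
  "quat_one $ 1 = 1" "quat_one $ 2 = 0" "quat_one $ 3 = 0" "quat_one $ 4 = 0"
  by (simp_all add: quat_one_def axis_def)

interpretation quat: unital_algebra "(*s)" "quat_mult a b" quat_one for a b :: "'f::field"
  by (rule unital_algebra_quat_mult)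

section \<open>Reduced trace and norm in coordinates, and simplicity of the standard
  algebras\<close>

definition quat_conj :: "'f::field ^ 4 \<Rightarrow> 'f ^ 4" where
  "quat_conj x = vec4 (x$1 + quat_t * x$2) (- x$2) (- x$3) (- x$4)"

definition quat_trd :: "'f::field ^ 4 \<Rightarrow> 'f" where
  "quat_trd x = 2 * x$1 + quat_t * x$2"

definition quat_nrd :: "'f::field \<Rightarrow> 'f \<Rightarrow> 'f ^ 4 \<Rightarrow> 'f" where
  "quat_nrd a b x = (x$1)\<^sup>2 + quat_t * x$1 * x$2 - a * (x$2)\<^sup>2
     - b * ((x$3)\<^sup>2 + quat_t * x$3 * x$4 - a * (x$4)\<^sup>2)"

lemma quat_add_conj: "x + quat_conj x = quat_trd x *s quat_one"
  by (simp add: vec4_eq_iff quat_conj_def quat_trd_def)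

lemma quat_mult_conj: "quat_mult a b x (quat_conj x) = quat_nrd a b x *s quat_one"
  by (simp add: vec4_eq_iff quat_mult_nth quat_conj_def quat_nrd_def algebra_simps power2_eq_square)

lemma quat_standard_involution: "quat.standard_involution a b quat_conj"
  unfolding quat.standard_involution_def quat_mult_conj
  by (auto simp: Vector_Spaces.linear_iff vec.vector_space_axioms vec4_eq_iff quat_mult_nth quat_conj_def algebra_simps)

lemma quat_square: "quat_mult a b x x = quat_trd x *s x - quat_nrd a b x *s quat_one"
  by (simp add: vec4_eq_iff quat_mult_nth quat_trd_def quat_nrd_def algebra_simps power2_eq_square)

lemma quat_trd_linear:
  "quat_trd (x + y) = quat_trd x + quat_trd y" "quat_trd (x - y) = quat_trd x - quat_trd y"
  "quat_trd (c *s x) = c * quat_trd x" "quat_trd (- x) = - quat_trd x"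
  by (simp_all add: quat_trd_def algebra_simps)

lemma quat_trd_mult_commute: "quat_trd (quat_mult a b x y) = quat_trd (quat_mult a b y x)"
  by (simp add: quat_trd_def quat_mult_nth algebra_simps)

lemma quat_nrd_mult: "quat_nrd a b (quat_mult a b x y) = quat_nrd a b x * quat_nrd a b y"
  by (simp add: quat_nrd_def quat_mult_nth algebra_simps power2_eq_square)

lemma standard_pair_iff: "standard_pair a b \<longleftrightarrow> b \<noteq> 0 \<and> ((2::'f::field) \<noteq> 0 \<longrightarrow> (a::'f) \<noteq> 0)"
  by (auto simp: standard_pair_def two_eq_0_iff)

lemma double_eq_0: "(2::'f::field) = 0 \<Longrightarrow> x + x = (0::'f)"
  by (metis mult_2 mult_zero_left)

text \<open>Nondegeneracy of the trace form, tested on the basis. The vector 1 is kept apart because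
  an element of trace zero then has to pair nontrivially with one of
  \<open>i, j, ij\<close>.\<close>

lemma quat_trd_nondegenerate:
  assumes "standard_pair a b" and "x \<noteq> 0"
  shows "quat_trd x \<noteq> 0 \<or> (\<exists>k\<in>{2,3,4}. quat_trd (quat_mult a b x (axis k 1)) \<noteq> 0)"
proof (rule ccontr)
  assume "\<not> ?thesis"
  then have eqs: "quat_trd x = 0" "quat_trd (quat_mult a b x (axis 2 1)) = 0"
    "quat_trd (quat_mult a b x (axis 3 1)) = 0" "quat_trd (quat_mult a b x (axis 4 1)) = 0"
    by simp_all
  have "x = 0" using quat_t_cases[where 'f='a]
  proof
    assume "quat_t = (0::'a) \<and> (2::'a) \<noteq> 0"
    then show ?thesis
      using assms(1) eqs by (simp add: vec4_eq_iff quat_trd_def quat_mult_nth axis_def standard_pair_iff)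
  next
    assume "quat_t = (1::'a) \<and> (2::'a) = 0"
    then show ?thesis
      using assms(1) eqs by (simp add: vec4_eq_iff quat_trd_def quat_mult_nth axis_def standard_pair_iff)
  qed
  then show False using assms(2) by blast
qed

text \<open>The pairs \<open>(u, w)\<close> run over the basis and its dual basis for the trace
  form; the sum of \<open>u x w\<close> is then the reduced trace, as for the matrix units
  \<open>E_kl, E_lk\<close>. The identity produces a scalar inside the two-sided ideal generated by
  \<open>x\<close>, which is how simplicity is proved.\<close>

lemma quat_casimir:
  fixes a b :: "'f::field"
  assumes "standard_pair a b"
  shows "\<exists>us. \<forall>x. quat_trd x *s quat_one = (\<Sum>(u, w)\<leftarrow>us. quat_mult a b u (quat_mult a b x w))"
  using quat_t_cases[where 'f='f]
proof
  assume t: "quat_t = (0::'f) \<and> (2::'f) \<noteq> 0"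
  define h ai bi :: 'f where "h = 1/2" and "ai = 1/a" and "bi = 1/b"
  have inv: "a * ai = 1" "b * bi = 1" "2 * h = 1"
    using t assms unfolding h_def ai_def bi_def by (simp_all add: standard_pair_iff)
  have t0: "quat_t = (0::'f)" using t by simp
  have cancel: "a * (u * (h * ai)) = u * h" "a * u * (h * ai) = u * h" "b * (u * (h * bi)) = u * h"
    "b * (a * u * (h * ai * bi)) = u * h" "b * (a * (u * (h * ai * bi))) = u * h"
    "a * (b * (u * (h * ai * bi))) = u * h" for u
  proof -
    have "a * (u * (h * ai)) = u * h * (a * ai)" "a * u * (h * ai) = u * h * (a * ai)"
      "b * (u * (h * bi)) = u * h * (b * bi)" "b * (a * u * (h * ai * bi)) = u * h * (a * ai) * (b * bi)"
      "b * (a * (u * (h * ai * bi))) = u * h * (a * ai) * (b * bi)"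
      "a * (b * (u * (h * ai * bi))) = u * h * (a * ai) * (b * bi)"
      by (simp_all only: ac_simps)
    then show "a * (u * (h * ai)) = u * h" "a * u * (h * ai) = u * h" "b * (u * (h * bi)) = u * h"
      "b * (a * u * (h * ai * bi)) = u * h" "b * (a * (u * (h * ai * bi))) = u * h"
      "a * (b * (u * (h * ai * bi))) = u * h"
      by (simp_all only: inv mult_1_right)
  qed
  have "(4::'f) * h = 2 * (2 * h)" by (simp flip: mult.assoc)
  then have four: "(4::'f) * h = 2" by (simp only: inv mult_1_right)
  have "quat_trd x *s quat_one = quat_mult a b quat_one (quat_mult a b x (vec4 h 0 0 0))
    + (quat_mult a b (axis 2 1) (quat_mult a b x (vec4 0 (h * ai) 0 0))
    + (quat_mult a b (axis 3 1) (quat_mult a b x (vec4 0 0 (h * bi) 0))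
    + quat_mult a b (axis 4 1) (quat_mult a b x (vec4 0 0 0 (- (h * ai * bi))))))" for x
    by (simp add: t0 vec4_eq_iff quat_mult_nth quat_trd_def axis_def cancel four)
  then show ?thesis
    by (intro exI[of _ "[(quat_one, vec4 h 0 0 0), (axis 2 1, vec4 0 (h * ai) 0 0),
        (axis 3 1, vec4 0 0 (h * bi) 0), (axis 4 1, vec4 0 0 0 (- (h * ai * bi)))]"]) simp
next
  assume t: "quat_t = (1::'f) \<and> (2::'f) = 0"
  define bi :: 'f where "bi = 1/b"
  have inv: "b * bi = 1" "(2::'f) = 0"
    using t assms unfolding bi_def by (simp_all add: standard_pair_iff)
  have t1: "quat_t = (1::'f)" using t by simp
  have "b * (u * bi) = u * (b * bi)" for u by (simp only: ac_simps)
  then have cancel: "b * (u * bi) = u" "b * (a * (u * bi)) = a * u" for u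
    by (simp_all add: inv mult.left_commute[of b])
  have "(3::'f) = 2 + 1" by simp
  then have three: "(3::'f) = 1" by (simp only: inv add_0)
  have neg: "- u = u" for u :: 'f
    using double_eq_0[OF inv(2), of u] by (simp add: neg_eq_iff_add_eq_0)
  have "quat_trd x *s quat_one = quat_mult a b quat_one (quat_mult a b x (vec4 1 1 0 0))
    + (quat_mult a b (axis 2 1) (quat_mult a b x quat_one)
    + (quat_mult a b (axis 3 1) (quat_mult a b x (vec4 0 0 0 bi))
    + quat_mult a b (axis 4 1) (quat_mult a b x (vec4 0 0 bi 0))))" (is "?l = ?r") for x
  proof -
    note defs = t1 quat_mult_nth quat_trd_def axis_def right_diff_distrib distrib_left cancel inv three
    have 1: "?l $ 1 = ?r $ 1" by (simp add: defs)
    have 2: "?l $ 2 = ?r $ 2" by (simp add: defs)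
    have 3: "?l $ 3 = ?r $ 3" by (simp add: defs)
    have 4: "?l $ 4 = ?r $ 4" by (simp add: defs)
    show ?thesis unfolding vec4_eq_iff using 1 2 3 4 by blast
  qed
  then show ?thesis
    by (intro exI[of _ "[(quat_one, vec4 1 1 0 0), (axis 2 1, quat_one),
        (axis 3 1, vec4 0 0 0 bi), (axis 4 1, vec4 0 0 bi 0)]"]) simp
qed

lemma (in unital_algebra) two_sided_ideal_add:
  assumes "two_sided_ideal I" "x \<in> I" "y \<in> I" shows "x + y \<in> I"
proof -
  have "0 - y \<in> I" using assms unfolding two_sided_ideal_def by blast
  then have "x - (0 - y) \<in> I" using assms unfolding two_sided_ideal_def by blast
  then show ?thesis by simp
qed

lemma quaternion_algebra_quat:
  fixes a b :: "'f::field"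
  assumes "standard_pair a b"
  shows "quaternion_algebra (*s) (quat_mult a b) quat_one"
proof unfold_locales
  show "vec.dim (UNIV :: ('f ^ 4) set) = 4" by (simp only: vec_dim_card) simp
next
  show "{z. \<forall>x. quat_mult a b z x = quat_mult a b x z} = range (\<lambda>c. c *s quat_one)"
  proof (intro equalityI subsetI)
    fix z assume "z \<in> {z. \<forall>x. quat_mult a b z x = quat_mult a b x z}"
    then have "quat_mult a b z (axis k 1) = quat_mult a b (axis k 1) z" for k by blast
    from this[of 2] this[of 3] have "z = z $ 1 *s quat_one"
      using assms quat_t_cases[where 'f='f]
      by (auto simp: vec4_eq_iff quat_mult_nth axis_def standard_pair_def two_eq_0_iff)
    then show "z \<in> range (\<lambda>c. c *s quat_one)" by blast
  qed (auto simp: quat.mult_simps)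
next
  fix I :: "('f ^ 4) set"
  assume I: "quat.two_sided_ideal a b I"
  show "I = {0} \<or> I = UNIV"
  proof (rule disjCI)
    assume "I \<noteq> UNIV"
    have "x = 0" if x: "x \<in> I" for x
    proof (rule ccontr)
      assume "x \<noteq> 0"
      then obtain y where y: "quat_trd (quat_mult a b x y) \<noteq> 0"
        using quat_trd_nondegenerate[OF assms] by (metis quat.one_right)
      obtain us where us: "\<And>x. quat_trd x *s quat_one = (\<Sum>(u, w)\<leftarrow>us. quat_mult a b u (quat_mult a b x w))"
        using quat_casimir[OF assms] by blast
      \<comment> \<open>The sum is the nonzero scalar trd(xy), which is invertible, so the ideal is
        everything.\<close>
      have "(\<Sum>(u, w)\<leftarrow>us. quat_mult a b u (quat_mult a b (quat_mult a b x y) w)) \<in> I"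
      proof (induction us)
        case Nil
        then show ?case using I by (simp add: quat.two_sided_ideal_def)
      next
        case (Cons p us)
        obtain u w where "p = (u, w)" by fastforce
        moreover have "quat_mult a b u (quat_mult a b (quat_mult a b x y) w) \<in> I"
          using I x unfolding quat.two_sided_ideal_def by blast
        ultimately show ?case using Cons I by (simp add: quat.two_sided_ideal_add)
      qed
      then have "quat_trd (quat_mult a b x y) *s quat_one \<in> I" by (simp add: us)
      then have "quat_mult a b (quat_trd (quat_mult a b x y) *s quat_one)
          (inverse (quat_trd (quat_mult a b x y)) *s z) \<in> I" for z
        using I unfolding quat.two_sided_ideal_def by blast
      then have "z \<in> I" for z using y by (simp add: quat.mult_simps)
      then show False using \<open>I \<noteq> UNIV\<close> by blast
    qed
    then show "I = {0}" using I by (auto simp: quat.two_sided_ideal_def)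
  qed
qed

section \<open>Uniqueness of the standard involution\<close>

context unital_algebra
begin

text \<open>Comparing the norms of \<open>x\<close> and \<open>x + one\<close> shows that
  \<open>x + \<rho> x\<close> is a scalar \<open>t\<close>, which is then a trace in a quadratic
  equation for \<open>x\<close>. Two different traces would make \<open>x\<close> itself a scalar,
  and scalars are fixed by every standard involution.\<close>

lemma standard_involution_unique:
  assumes "one \<noteq> 0" "standard_involution \<sigma>" "standard_involution \<tau>"
  shows "\<sigma> = \<tau>"
proof
  fix x
  have trace: "\<exists>t n. x + \<rho> x = scale t one \<and> mult x x = scale t x - scale n one"
    if \<rho>: "standard_involution \<rho>" for \<rho>
  proof -
    have add: "\<rho> (x + y) = \<rho> x + \<rho> y" and one: "\<rho> one = one" for x y
      using \<rho> by (auto simp: standard_involution_def Vector_Spaces.linear_iff)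
    have "\<exists>n. mult y (\<rho> y) = scale n one" for y
      using \<rho> by (auto simp: standard_involution_def image_iff)
    then obtain n m where n: "mult x (\<rho> x) = scale n one"
      and m: "mult (x + one) (\<rho> (x + one)) = scale m one" by blast
    have "mult (x + one) (\<rho> (x + one)) = mult x (\<rho> x) + (x + \<rho> x) + one"
      by (simp only: add one mult_add_left mult_add_right one_left one_right) (simp only: add_ac)
    also have "\<dots> = (mult x (\<rho> x) + one) + (x + \<rho> x)" by (simp only: add_ac)
    finally have "x + \<rho> x = scale m one - (scale n one + one)"
      unfolding n m by (metis add_diff_cancel_left')
    then have "x + \<rho> x = scale m one - scale n one - one" by (simp only: diff_diff_eq)
    then have t: "x + \<rho> x = scale (m - n - 1) one" "mult x (\<rho> x) = scale n one"
      using n by (simp_all add: scale_left_diff_distrib)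
    then have "mult x (x + \<rho> x) = scale (m - n - 1) x" by (simp add: mult_simps)
    then have "mult x x = scale (m - n - 1) x - scale n one" using t(2)
      by (simp add: mult_add_right eq_diff_eq)
    then show ?thesis using t by blast
  qed
  obtain t n where 1: "x + \<sigma> x = scale t one" "mult x x = scale t x - scale n one"
    using trace[OF assms(2)] by blast
  obtain t' n' where 2: "x + \<tau> x = scale t' one" "mult x x = scale t' x - scale n' one"
    using trace[OF assms(3)] by blast
  show "\<sigma> x = \<tau> x"
  proof (cases "t = t'")
    case True
    then show ?thesis using 1 2 by (metis add_left_imp_eq)
  next
    case False
    have "scale (t - t') x = scale (n - n') one"
      using 1 2 by (simp add: scale_distribs algebra_simps)
    then have "x = scale (inverse (t - t') * (n - n')) one"
      using False by (metis scale_scale scale_one left_inverse right_minus_eq)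
    then obtain c where "x = scale c one" by blast
    then show ?thesis
      using assms(2,3) by (simp add: standard_involution_def Vector_Spaces.linear_iff)
  qed
qed

lemma conjugate_eq:
  assumes "one \<noteq> 0" "standard_involution \<sigma>" shows "conjugate = \<sigma>"
  unfolding conjugate_def using standard_involution_unique[OF assms(1)] assms(2) by blast

lemma the_scalar: "one \<noteq> 0 \<Longrightarrow> (THE c. scale c one = scale d one) = d"
  by (rule the_equality) auto

end

section \<open>Homomorphisms from a standard algebra given by generators\<close>

context unital_algebra begin
definition generated_hom :: "'b \<Rightarrow> 'b \<Rightarrow> 'f ^ 4 \<Rightarrow> 'b" where
  "generated_hom i j x =
     scale (x $ 1) one + scale (x $ 2) i + scale (x $ 3) j + scale (x $ 4) (mult i j)"

lemma generated_hom_linear: "Vector_Spaces.linear (*s) scale (generated_hom i j)"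
  unfolding Vector_Spaces.linear_iff
  by (simp add: generated_hom_def vec.vector_space_axioms vector_space_axioms scale_distribs algebra_simps)

lemma generated_hom_one: "generated_hom i j quat_one = one"
  by (simp add: generated_hom_def)

text \<open>It suffices to know left multiplication by \<open>i\<close> and by \<open>j\<close> on
  the span of \<open>1, i, j, ij\<close>, since a product with a general left factor is assembled
  from these two maps.\<close>

lemma generated_hom_mult:
  assumes "standard_generators a b i j"
  shows "generated_hom i j (quat_mult a b x y) = mult (generated_hom i j x) (generated_hom i j y)"
proof -
  have ii: "mult i i = scale quat_t i + scale a one" and jj: "mult j j = scale b one"
    and ji: "mult j i = scale quat_t j - mult i j"
    using assms by (auto simp: standard_generators_def)
  have iij: "mult i (mult i j) = scale quat_t (mult i j) + scale a j"
    by (simp flip: mult_assoc add: ii) (simp add: mult_simps)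
  have jij: "mult j (mult i j) = scale (quat_t * b) one - scale b i"
    by (simp flip: mult_assoc add: ji) (simp add: mult_simps jj)
  define c where "c p q r s = scale p one + scale q i + scale r j + scale s (mult i j)" for p q r s
  have hom: "generated_hom i j v = c (v $ 1) (v $ 2) (v $ 3) (v $ 4)" for v
    by (simp add: c_def generated_hom_def)
  have add: "c p q r s + c p' q' r' s' = c (p + p') (q + q') (r + r') (s + s')" for p q r s p' q' r' s'
    by (simp add: c_def scale_left_distrib)
  have scl: "scale d (c p q r s) = c (d * p) (d * q) (d * r) (d * s)" for d p q r s
    by (simp add: c_def scale_right_distrib)
  have ic: "mult i (c p q r s) = c (a * q) (p + quat_t * q) (a * s) (r + quat_t * s)" for p q r s
    by (simp add: c_def mult_add_right mult_scale_right one_right ii iij scale_distribs ac_simps)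
  have jc: "mult j (c p q r s) = c (b * r + quat_t * b * s) (- b * s) (p + quat_t * q) (- q)" for p q r s
    by (simp add: c_def mult_add_right mult_scale_right one_right jj ji jij scale_distribs algebra_simps)
  have "mult (c p q r s) v = scale p v + scale q (mult i v) + scale r (mult j v) + scale s (mult i (mult j v))" for p q r s v
    by (simp add: c_def mult_add_left mult_scale_left one_left mult_assoc)
  then show ?thesis
    unfolding hom by (simp add: ic jc scl add quat_mult_nth algebra_simps)
qed

end

section \<open>Standard generators from a scaled system of pure quaternions\<close>

context unital_algebra
begin

text \<open>The model is \<open>x, y, z = i, j, ij\<close> with \<open>c = 1\<close>, where
  \<open>i = - j (ij) / b\<close> and \<open>j = - (ij) i / a\<close>. For general \<open>c\<close>
  the products of two of the elements are multiplied by \<open>c\<close>, which is why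
  \<open>c\<close> appears in both denominators and no square root of it is required.\<close>

lemma standard_generators_of_orthogonal:
  assumes two: "(2::'f) \<noteq> 0" and nz: "a \<noteq> 0" "b \<noteq> 0" "c \<noteq> 0"
    and sq: "mult x x = scale (c * a) one" "mult y y = scale (c * b) one" "mult z z = scale (- (c * a * b)) one"
    and anti: "mult y x = - mult x y" "mult z x = - mult x z" "mult z y = - mult y z"
  shows "\<exists>i j. standard_generators a b i j"
proof -
  have t: "quat_t = (0::'f)" using two quat_t_cases[where 'f='f] by auto
  have r: "mult x (mult x v) = scale (c * a) v" "mult y (mult y v) = scale (c * b) v"
    "mult z (mult z v) = scale (- (c * a * b)) v"
    "mult y (mult x v) = - mult x (mult y v)" "mult z (mult x v) = - mult x (mult z v)"
    "mult z (mult y v) = - mult y (mult z v)" for v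
    by (simp_all flip: mult_assoc add: sq anti mult_minus_left mult_scale_left one_left)
  let ?i = "scale (- 1 / (b * c)) (mult y z)" and ?j = "scale (- 1 / (a * c)) (mult z x)"
  have "standard_generators a b ?i ?j"
    unfolding standard_generators_def t using nz
    by (simp add: mult_distribs mult_assoc sq r anti one_right scale_minus_left scale_minus_right)
  then show ?thesis by blast
qed

text \<open>The model is \<open>x, y, z = 1, j, ij\<close>, a basis of the trace zero space in
  characteristic 2, with \<open>i = (ij) j / b\<close> and \<open>j = 1 j\<close>; again products of
  two elements carry the factor \<open>c\<close>.\<close>

lemma standard_generators_of_char_2:
  assumes two: "(2::'f) = 0" and nz: "b \<noteq> 0" "c \<noteq> 0"
    and sq: "mult x x = scale c one" "mult y y = scale (c * b) one" "mult z z = scale (c * a * b) one"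
    and comm: "mult y x = mult x y" "mult z x = mult x z" "mult z y + mult y z = scale (c * b) one"
  shows "\<exists>i j. standard_generators a b i j"
proof -
  have t: "quat_t = (1::'f)" using two quat_t_cases[where 'f='f] by auto
  have zy: "mult z y = scale (c * b) one - mult y z" using comm(3) by (simp add: eq_diff_eq)
  have r: "mult x (mult x v) = scale c v" "mult y (mult y v) = scale (c * b) v"
    "mult z (mult z v) = scale (c * a * b) v"
    "mult y (mult x v) = mult x (mult y v)" "mult z (mult x v) = mult x (mult z v)"
    "mult z (mult y v) = scale (c * b) v - mult y (mult z v)" for v
    by (simp_all flip: mult_assoc add: sq comm(1,2) zy mult_diff_left mult_scale_left one_left)
  have neg: "- v = v" for v :: 'b
    using scale_left_distrib[of 1 1 v] two by (simp add: neg_eq_iff_add_eq_0)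
  have sub: "v - w = v + w" for v w :: 'b using neg[of w] diff_conv_add_uminus[of v w] by simp
  have sneg: "- u = u" for u :: 'f
    using double_eq_0[OF two, of u] by (simp add: neg_eq_iff_add_eq_0)
  let ?i = "scale (1 / (c * b)) (mult z y)" and ?j = "scale (1 / c) (mult x y)"
  have "standard_generators a b ?i ?j"
    unfolding standard_generators_def t using nz
    by (simp add: mult_distribs mult_assoc sq r zy comm(1,2) one_left one_right scale_distribs sneg)
      (simp add: neg sub add.commute)
  then show ?thesis by blast
qed

end

text \<open>The kernel of the homomorphism is a two-sided ideal that does not contain the unit, so
  it is zero by simplicity; equality of dimensions gives surjectivity.\<close>

lemma algebra_iso_of_generators:
  fixes m :: "'f::field ^ 4 \<Rightarrow> 'f ^ 4 \<Rightarrow> 'f ^ 4"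
  assumes ab: "standard_pair a b" and alg: "unital_algebra (*s) m e" and e: "e \<noteq> 0"
    and gen: "unital_algebra.standard_generators (*s) m e a b i j"
  shows "\<exists>\<phi>. algebra_iso (*s) (quat_mult a b) quat_one (*s) m e \<phi>"
proof -
  interpret unital_algebra "(*s)" m e by (rule alg)
  interpret Q: quaternion_algebra "(*s)" "quat_mult a b" quat_one
    using ab by (rule quaternion_algebra_quat)
  let ?\<phi> = "generated_hom i j"
  note hom = generated_hom_mult[OF gen]
  have lin: "Vector_Spaces.linear (*s) (*s) ?\<phi>" by (rule generated_hom_linear)
  then have add: "?\<phi> (x - y) = ?\<phi> x - ?\<phi> y" "?\<phi> 0 = 0" for x y
    by (simp_all add: vec.linear_diff vec.linear_0)
  have "quat.two_sided_ideal a b {x. ?\<phi> x = 0}"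
    by (simp add: quat.two_sided_ideal_def add hom)
  then have "{x. ?\<phi> x = 0} = {0} \<or> {x. ?\<phi> x = 0} = UNIV" by (rule Q.simple)
  moreover have "quat_one \<notin> {x. ?\<phi> x = 0}" using e by (simp add: generated_hom_one)
  ultimately have "{x. ?\<phi> x = 0} = {0}" by blast
  then have "inj ?\<phi>" by (auto simp: vec.linear_inj_iff_eq_0[OF lin])
  then have "bij ?\<phi>" using lin by (simp add: bij_def vec.linear_inj_imp_surj)
  then show ?thesis using lin hom generated_hom_one unfolding algebra_iso_def by blast
qed

section \<open>Isomorphism classes of quaternion algebras\<close>

lemma algebra_iso_refl: "vector_space s \<Longrightarrow> algebra_iso s m e s m e id"
  by (simp add: algebra_iso_def Vector_Spaces.linear_iff)

lemma algebra_iso_trans: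
  assumes "algebra_iso s m e s' m' e' \<phi>" "algebra_iso s' m' e' s'' m'' e'' \<psi>"
  shows "algebra_iso s m e s'' m'' e'' (\<psi> \<circ> \<phi>)"
  using assms by (auto simp: algebra_iso_def Vector_Spaces.linear_iff intro: bij_comp)

lemma algebra_iso_inv:
  assumes "algebra_iso s m e s' m' e' \<phi>"
  shows "algebra_iso s' m' e' s m e (inv \<phi>)"
proof -
  have bij: "bij \<phi>" and lin: "Vector_Spaces.linear s s' \<phi>" and one: "\<phi> e = e'"
    and hom: "\<And>x y. \<phi> (m x y) = m' (\<phi> x) (\<phi> y)"
    using assms by (auto simp: algebra_iso_def)
  have eq: "inv \<phi> y = x \<longleftrightarrow> \<phi> x = y" for x y
    using bij by (metis bij_inv_eq_iff)
  have r: "\<phi> (inv \<phi> y) = y" for y using bij by (simp add: bij_is_surj surj_f_inv_f)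
  show ?thesis
    using lin bij one unfolding algebra_iso_def Vector_Spaces.linear_iff
    by (auto simp: eq r hom bij_imp_bij_inv)
qed

lemma equiv_quaternion_iso: "equiv quaternion_algebras (quaternion_iso :: ('f::field algebra4 \<times> 'f algebra4) set)"
proof (rule equivI)
  show "refl_on quaternion_algebras (quaternion_iso :: ('f algebra4 \<times> 'f algebra4) set)"
    using algebra_iso_refl[OF vec.vector_space_axioms]
    by (fastforce simp: refl_on_def quaternion_iso_def)
  show "sym (quaternion_iso :: ('f algebra4 \<times> 'f algebra4) set)"
    by (auto simp: sym_def quaternion_iso_def dest: algebra_iso_inv)
  show "trans (quaternion_iso :: ('f algebra4 \<times> 'f algebra4) set)"
    by (auto simp: trans_def quaternion_iso_def dest: algebra_iso_trans)
  show "(quaternion_iso :: ('f algebra4 \<times> 'f algebra4) set) \<subseteq> quaternion_algebras \<times> quaternion_algebras"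
    by (auto simp: quaternion_iso_def)
qed

lemma quaternion_algebra_iso_quat:
  fixes m :: "'f::field ^ 4 \<Rightarrow> 'f ^ 4 \<Rightarrow> 'f ^ 4"
  assumes "quaternion_algebra (*s) m e"
  shows "\<exists>a b \<phi>. standard_pair a b \<and> algebra_iso (*s) (quat_mult a b) quat_one (*s) m e \<phi>"
proof -
  interpret quaternion_algebra "(*s)" m e by fact
  obtain a b i j where "standard_pair a b" "standard_generators a b i j"
    using ex_standard_generators by blast
  then show ?thesis
    using algebra_iso_of_generators unital_algebra_axioms one_nonzero by blast
qed

lemma quat_one_nonzero: "(quat_one :: 'f::field ^ 4) \<noteq> 0"
  by (simp add: vec4_eq_iff)

text \<open>The involution moved along \<open>\<phi>\<close> is a standard involution, hence by
  uniqueness the one that \<open>conjugate\<close> denotes.\<close>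

lemma quat_trd_nrd_transport:
  assumes alg: "unital_algebra s m e" and iso: "algebra_iso (*s) (quat_mult a b) quat_one s m e \<phi>"
  shows "unital_algebra.trd s m e (\<phi> x) = quat_trd x" (is ?trd)
    and "unital_algebra.nrd s m e (\<phi> x) = quat_nrd a b x" (is ?nrd)
proof -
  interpret unital_algebra s m e by (rule alg)
  have bij: "bij \<phi>" and lin: "Vector_Spaces.linear (*s) s \<phi>" and one: "\<phi> quat_one = e"
    and hom: "\<And>x y. \<phi> (quat_mult a b x y) = m (\<phi> x) (\<phi> y)"
    using iso by (auto simp: algebra_iso_def)
  have add: "\<phi> (x + y) = \<phi> x + \<phi> y" and scl: "\<phi> (c *s x) = s c (\<phi> x)" for x y c
    using lin by (auto simp: Vector_Spaces.linear_iff)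
  have l: "inv \<phi> (\<phi> x) = x" for x using bij by (simp add: bij_is_inj)
  have e: "e \<noteq> 0"
    using one quat_one_nonzero bij scl[of 0 0] by (metis bij_pointE scale_zero_left vector_smult_lzero)
  define \<sigma> where "\<sigma> y = \<phi> (quat_conj (inv \<phi> y))" for y
  have \<sigma>: "\<sigma> (\<phi> x) = \<phi> (quat_conj x)" for x by (simp add: \<sigma>_def l)
  note Q = quat_standard_involution[of a b, unfolded quat.standard_involution_def Vector_Spaces.linear_iff]
  have all: "(\<forall>y. P y) \<longleftrightarrow> (\<forall>x. P (\<phi> x))" for P using bij by (metis bij_pointE)
  have "standard_involution \<sigma>"
    unfolding standard_involution_def Vector_Spaces.linear_iff
    using Q by (auto simp: all \<sigma> vector_space_axioms \<sigma>[of quat_one, unfolded one] one image_iff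
        simp flip: add scl hom) (metis one scl)
  then have conj: "conjugate = \<sigma>" using conjugate_eq e by blast
  show ?trd
    unfolding trd_def conj \<sigma> add[symmetric] quat_add_conj scl one by (rule the_scalar[OF e])
  show ?nrd
    unfolding nrd_def conj \<sigma> hom[symmetric] quat_mult_conj scl one by (rule the_scalar[OF e])
qed

section \<open>Conics\<close>

lemma vec3_eq_iff: "v = w \<longleftrightarrow> v $ 1 = w $ 1 \<and> v $ 2 = w $ 2 \<and> v $ 3 = w $ (3::3)"
  by (simp add: vec_eq_iff forall_3)

definition vec3 :: "'f \<Rightarrow> 'f \<Rightarrow> 'f \<Rightarrow> 'f ^ 3" where
  "vec3 x y z = (\<chi> k. if k = 1 then x else if k = 2 then y else z)"

lemma vec3_nth [simp]: "vec3 x y z $ 1 = x" "vec3 x y z $ 2 = y" "vec3 x y z $ 3 = z"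
  by (simp_all add: vec3_def)

fun qpolar :: "'a::comm_ring_1 qform \<Rightarrow> 'a ^ 3 \<Rightarrow> 'a ^ 3 \<Rightarrow> 'a" where
  "qpolar (a, b, c, d, e, f) u v =
     (2 * a * u$1 + d * u$2 + e * u$3) * v$1 + (d * u$1 + 2 * b * u$2 + f * u$3) * v$2 +
     (e * u$1 + f * u$2 + 2 * c * u$3) * v$3"

lemma qeval_add: "qeval Q (u + v) = qeval Q u + qeval Q v + qpolar Q u v"
  by (cases Q) (simp add: algebra_simps power2_eq_square)

lemma qeval_scale: "qeval Q (c *s v) = c\<^sup>2 * qeval Q v"
  by (cases Q) (simp add: algebra_simps power2_eq_square)

lemma qpolar_linear:
  "qpolar Q u (v + w) = qpolar Q u v + qpolar Q u w" "qpolar Q (u + v) w = qpolar Q u w + qpolar Q v w"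
  "qpolar Q u (c *s v) = c * qpolar Q u v" "qpolar Q (c *s u) v = c * qpolar Q u v"
  by (cases Q; simp add: algebra_simps)+

lemma qpolar_commute: "qpolar Q u v = qpolar Q v u"
  by (cases Q) (simp add: algebra_simps)

lemma qpolar_self: "qpolar Q u u = 2 * qeval Q u"
  by (cases Q) (simp add: algebra_simps power2_eq_square)

text \<open>A description without coordinates: \<open>v\<close> has value 0 and lies in the radical
  of the polar form. It is what makes singular points follow linear substitutions.\<close>

lemma singular_at_iff: "singular_at Q v \<longleftrightarrow> qeval Q v = 0 \<and> (\<forall>u. qpolar Q v u = 0)"
proof (cases Q)
  case (fields a b c d e f)
  show ?thesis unfolding fields
  proof
    assume "singular_at (a, b, c, d, e, f) v"
    then show "qeval (a, b, c, d, e, f) v = 0 \<and> (\<forall>u. qpolar (a, b, c, d, e, f) v u = 0)" by simp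
  next
    assume "qeval (a, b, c, d, e, f) v = 0 \<and> (\<forall>u. qpolar (a, b, c, d, e, f) v u = 0)"
    then have "qeval (a, b, c, d, e, f) v = 0" "qpolar (a, b, c, d, e, f) v (axis 1 1) = 0"
      "qpolar (a, b, c, d, e, f) v (axis 2 1) = 0" "qpolar (a, b, c, d, e, f) v (axis 3 1) = 0" by blast+
    then show "singular_at (a, b, c, d, e, f) v" by (simp add: axis_def)
  qed
qed

definition qsubst :: "'a::comm_ring_1 qform \<Rightarrow> 'a ^ 3 ^ 3 \<Rightarrow> 'a qform" where
  "qsubst Q g = (let x = column 1 g; y = column 2 g; z = column 3 g in
     (qeval Q x, qeval Q y, qeval Q z, qpolar Q x y, qpolar Q x z, qpolar Q y z))"

lemma matrix_vector_mult_3: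
  fixes g :: "'a::comm_ring_1 ^ 3 ^ 3"
  shows "g *v v = v$1 *s column 1 g + v$2 *s column 2 g + v$3 *s column 3 g"
  by (simp add: vec3_eq_iff matrix_vector_mult_def sum_3 column_def algebra_simps)

lemma qeval_qsubst: "qeval (qsubst Q g) v = qeval Q (g *v v)"
  by (simp add: qsubst_def Let_def matrix_vector_mult_3 qeval_add qeval_scale qpolar_linear algebra_simps)

lemma qform_eqI:
  assumes "\<And>v. qeval Q v = qeval Q' v" shows "Q = Q'"
proof -
  obtain a b c d e f a' b' c' d' e' f' where Q: "Q = (a, b, c, d, e, f)" "Q' = (a', b', c', d', e', f')"
    by (metis prod_cases6)
  have "qeval Q (vec3 x y z) = qeval Q' (vec3 x y z)" for x y z using assms by blast
  from this[of 1 0 0] this[of 0 1 0] this[of 0 0 1] this[of 1 1 0] this[of 1 0 1] this[of 0 1 1]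
  show ?thesis unfolding Q by simp
qed

lemma singular_at_qsubst:
  assumes "singular_at (qsubst Q g) v" and "g ** h = mat 1"
  shows "singular_at Q (g *v v)"
proof -
  have q: "qpolar (qsubst Q g) v u = qpolar Q (g *v v) (g *v u)" for u
    using qeval_add[of "qsubst Q g" v u] qeval_add[of Q "g *v v" "g *v u"]
    by (simp add: qeval_qsubst matrix_vector_mult_add_rdistrib matrix_vector_right_distrib)
  have "qpolar Q (g *v v) u = 0" for u
    using q[of "h *v u"] assms by (simp add: singular_at_iff matrix_vector_mul_assoc)
  then show ?thesis using assms(1) by (simp add: singular_at_iff qeval_qsubst)
qed

definition map_matrix3 :: "('a \<Rightarrow> 'b) \<Rightarrow> 'a ^ 3 ^ 3 \<Rightarrow> 'b ^ 3 ^ 3" where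
  "map_matrix3 h g = (\<chi> i j. h (g $ i $ j))"

lemma qmap_to_ac_qsubst: "qmap to_ac (qsubst Q g) = qsubst (qmap to_ac Q) (map_matrix3 to_ac g)"
  by (cases Q) (simp add: qsubst_def Let_def map_matrix3_def column_def)

text \<open>Nonsingularity refers to the algebraic closure, so the matrix and its inverse are
  extended there; a singular point of the substituted form is then carried to one of
  \<open>Q\<close>.\<close>

lemma conics_qsubst:
  fixes Q :: "'f::field qform"
  assumes Q: "Q \<in> conics" and g: "invertible g"
  shows "qsubst Q g \<in> conics"
  unfolding conics_def
proof (intro CollectI allI impI notI)
  fix v :: "'f alg_closure ^ 3"
  let ?g = "map_matrix3 to_ac g"
  assume v: "v \<noteq> 0" and sing: "singular_at (qmap to_ac (qsubst Q g)) v"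
  obtain h where h: "g ** h = mat 1" "h ** g = mat 1" using g by (auto simp: invertible_def)
  have lift: "map_matrix3 to_ac x ** map_matrix3 to_ac y = map_matrix3 to_ac (x ** y)" for x y :: "'f ^ 3 ^ 3"
    by (simp add: map_matrix3_def matrix_matrix_mult_def vec_eq_iff to_ac_sum)
  have one: "map_matrix3 to_ac (mat 1) = (mat 1 :: 'f alg_closure ^ 3 ^ 3)"
    by (simp add: map_matrix3_def mat_def vec_eq_iff)
  have "singular_at (qmap to_ac Q) (?g *v v)"
    using sing h(1) unfolding qmap_to_ac_qsubst
    by (intro singular_at_qsubst[where h = "map_matrix3 to_ac h"]) (simp_all add: lift one)
  moreover have "?g *v v \<noteq> 0"
  proof
    assume "?g *v v = 0"
    then have "map_matrix3 to_ac h *v (?g *v v) = 0" by simp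
    then show False using v h(2) by (simp add: matrix_vector_mul_assoc lift one)
  qed
  ultimately show False using Q by (auto simp: conics_def)
qed

lemma conic_isoI:
  assumes "Q \<in> conics" "Q' \<in> conics" "invertible g" "c \<noteq> 0" "\<And>v. qeval Q' (g *v v) = c * qeval Q v"
  shows "(Q, Q') \<in> conic_iso"
  using assms unfolding conic_iso_def by blast

lemma equiv_conic_iso: "equiv conics (conic_iso :: ('f::field qform \<times> 'f qform) set)"
proof (rule equivI)
  show "(conic_iso :: ('f qform \<times> 'f qform) set) \<subseteq> conics \<times> conics"
    by (auto simp: conic_iso_def)
  show "refl_on conics (conic_iso :: ('f qform \<times> 'f qform) set)"
  proof (unfold refl_on_def, intro ballI)
    fix Q :: "'f qform" assume "Q \<in> conics"
    moreover have "invertible (mat 1 :: 'f ^ 3 ^ 3)" by (simp add: invertible_def)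
    ultimately show "(Q, Q) \<in> conic_iso" by (intro conic_isoI[where c = 1 and g = "mat 1"]) simp_all
  qed
  show "sym (conic_iso :: ('f qform \<times> 'f qform) set)"
  proof (rule symI)
    fix Q Q' :: "'f qform" assume "(Q, Q') \<in> conic_iso"
    then obtain g c where g: "Q \<in> conics" "Q' \<in> conics" "invertible g" "c \<noteq> 0"
      "\<And>v. qeval Q' (g *v v) = c * qeval Q v" by (auto simp: conic_iso_def)
    obtain h where h: "g ** h = mat 1" "h ** g = mat 1" using g by (auto simp: invertible_def)
    have "qeval Q (h *v v) = inverse c * qeval Q' v" for v
      using g(5)[of "h *v v"] g(4) by (simp add: matrix_vector_mul_assoc h field_simps)
    moreover have "invertible h" using h by (auto simp: invertible_def)
    moreover have "inverse c \<noteq> 0" using g by simp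
    ultimately show "(Q', Q) \<in> conic_iso" using g(1,2) by (intro conic_isoI)
  qed
  show "trans (conic_iso :: ('f qform \<times> 'f qform) set)"
  proof (rule transI)
    fix Q Q' Q'' :: "'f qform" assume "(Q, Q') \<in> conic_iso" "(Q', Q'') \<in> conic_iso"
    then obtain g c h d where g: "Q \<in> conics" "Q'' \<in> conics" "invertible g" "c \<noteq> 0"
      "\<And>v. qeval Q' (g *v v) = c * qeval Q v" "invertible h" "d \<noteq> 0"
      "\<And>v. qeval Q'' (h *v v) = d * qeval Q' v" by (auto simp: conic_iso_def)
    then have "qeval Q'' ((h ** g) *v v) = (d * c) * qeval Q v" for v
      by (simp add: matrix_vector_mul_assoc[symmetric] mult.assoc)
    moreover have "invertible (h ** g)" using g by (simp add: invertible_mult)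
    moreover have "d * c \<noteq> 0" using g by simp
    ultimately show "(Q, Q'') \<in> conic_iso" using g(1,2) by (intro conic_isoI)
  qed
qed

section \<open>Norm forms on pure quaternions\<close>

definition quat_form :: "'f::field \<Rightarrow> 'f \<Rightarrow> 'f qform" where
  "quat_form a b = (if (2::'f) = 0 then (1, - b, a * b, 0, 0, - b) else (- a, - b, a * b, 0, 0, 0))"

text \<open>In characteristic 2 the element 1 has trace 0 and \<open>i\<close> has trace 1, so the
  trace zero space is spanned by \<open>1, j, ij\<close>; otherwise it is spanned by
  \<open>i, j, ij\<close>.\<close>

definition quat_pure :: "'f::field ^ 3 \<Rightarrow> 'f ^ 4" where
  "quat_pure v = (if (2::'f) = 0 then vec4 (v $ 1) 0 (v $ 2) (v $ 3) else vec4 0 (v $ 1) (v $ 2) (v $ 3))"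

definition quat_coords :: "'f::field ^ 4 \<Rightarrow> 'f ^ 3" where
  "quat_coords x = (if (2::'f) = 0 then vec3 (x $ 1) (x $ 3) (x $ 4) else vec3 (x $ 2) (x $ 3) (x $ 4))"

lemma quat_coords_pure [simp]: "quat_coords (quat_pure v) = v"
  by (simp add: quat_coords_def quat_pure_def vec3_eq_iff)

lemma quat_trd_pure [simp]: "quat_trd (quat_pure v) = 0"
  using quat_t_cases[where 'f='a] by (auto simp: quat_trd_def quat_pure_def)

lemma quat_pure_coords: "quat_trd x = 0 \<Longrightarrow> quat_pure (quat_coords x) = x"
  using quat_t_cases[where 'f='a] by (auto simp: quat_coords_def quat_trd_def quat_pure_def vec4_eq_iff)

lemma quat_pure_linear:
  "quat_pure (u + v) = quat_pure u + quat_pure v" "quat_pure (c *s v) = c *s quat_pure v"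
  by (simp_all add: quat_pure_def vec4_eq_iff)

lemma quat_coords_linear:
  "quat_coords (x + y) = quat_coords x + quat_coords y" "quat_coords (c *s x) = c *s quat_coords x"
  by (simp_all add: quat_coords_def vec3_eq_iff)

lemma qeval_quat_form: "qeval (quat_form a b) v = quat_nrd a b (quat_pure v)"
  using quat_t_cases[where 'f='a] by (auto simp: quat_form_def quat_nrd_def quat_pure_def algebra_simps)

lemma quat_form_conic:
  fixes a b :: "'f::field"
  assumes "standard_pair a b" shows "quat_form a b \<in> conics"
  unfolding conics_def
proof (intro CollectI allI impI notI)
  fix v :: "'f alg_closure ^ 3"
  assume v: "v \<noteq> 0" and sing: "singular_at (qmap to_ac (quat_form a b)) v"
  have two: "(2 :: 'f alg_closure) = 0 \<longleftrightarrow> (2::'f) = 0" using to_ac_eq_0_iff[of "2::'f"] by simp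
  show False
  proof (cases "(2::'f) = 0")
    case True
    then show False using assms v sing two
      by (auto simp: quat_form_def standard_pair_iff vec3_eq_iff)
  next
    case False
    then show False using assms v sing two
      by (auto simp: quat_form_def standard_pair_iff vec3_eq_iff)
  qed
qed

lemma associated_conic_quat:
  "associated_conic (quat_mult a b, quat_one) (quat_form a b)"
proof -
  have [simp]: "quat.trd a b x = quat_trd x" "quat.nrd a b x = quat_nrd a b x" for x
    using quat_trd_nrd_transport[OF unital_algebra_quat_mult algebra_iso_refl[OF vec.vector_space_axioms], of a b x]
    by simp_all
  have "Vector_Spaces.linear (*s) (*s) (quat_pure :: 'a ^ 3 \<Rightarrow> _)"
    by (simp add: Vector_Spaces.linear_iff vec.vector_space_axioms quat_pure_linear)
  moreover have "inj (quat_pure :: 'a ^ 3 \<Rightarrow> _)" by (metis injI quat_coords_pure)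
  moreover have "range quat_pure = quat.trace_zero a b"
    by (auto simp: quat.trace_zero_def image_iff) (metis quat_pure_coords)
  ultimately show ?thesis unfolding associated_conic_def by (auto simp: qeval_quat_form)
qed

text \<open>Both forms are the reduced norm on the same trace zero space in two coordinate systems,
  so they are even isometric. \<open>associated_conic\<close> does not ask for a nonsingular form;
  nonsingularity of \<open>Q\<close> is inherited from \<open>quat_form a b\<close>.\<close>

lemma associated_conic_of_iso:
  fixes a b :: "'f::field"
  assumes ab: "standard_pair a b" and alg: "unital_algebra (*s) m e"
    and iso: "algebra_iso (*s) (quat_mult a b) quat_one (*s) m e \<phi>" and Q: "associated_conic (m, e) Q"
  shows "(Q, quat_form a b) \<in> conic_iso"
proof -
  interpret unital_algebra "(*s)" m e by (rule alg)
  obtain \<psi> :: "'f ^ 3 \<Rightarrow> 'f ^ 4" where \<psi>: "Vector_Spaces.linear (*s) (*s) \<psi>" "inj \<psi>"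
    "range \<psi> = trace_zero" "\<And>v. qeval Q v = nrd (\<psi> v)"
    using Q by (auto simp: associated_conic_def)
  have inv: "algebra_iso (*s) m e (*s) (quat_mult a b) quat_one (inv \<phi>)"
    using iso by (rule algebra_iso_inv)
  have r: "\<phi> (inv \<phi> y) = y" for y
    using iso by (simp add: algebra_iso_def bij_is_surj surj_f_inv_f)
  have "quat_trd (inv \<phi> (\<psi> v)) = trd (\<psi> v)" for v
    using quat_trd_nrd_transport(1)[OF alg iso, of "inv \<phi> (\<psi> v)"] by (simp add: r)
  moreover have "trd (\<psi> v) = 0" for v using \<psi>(3) by (auto simp: trace_zero_def)
  ultimately have pure: "quat_pure (quat_coords (inv \<phi> (\<psi> v))) = inv \<phi> (\<psi> v)" for v
    by (simp add: quat_pure_coords)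
  let ?f = "\<lambda>v. quat_coords (inv \<phi> (\<psi> v))"
  have lin: "Vector_Spaces.linear (*s) (*s) ?f"
    using \<psi>(1) inv by (simp add: algebra_iso_def Vector_Spaces.linear_iff quat_coords_linear)
  have "inj ?f"
    using \<psi>(2) pure r by (metis (no_types, lifting) injD injI)
  then have "invertible (matrix ?f)"
    using lin by (simp add: invertible_left_inverse matrix_left_invertible_injective matrix_works)
  moreover have e: "qeval (quat_form a b) (matrix ?f *v v) = qeval Q v" for v
    using quat_trd_nrd_transport(2)[OF alg iso, of "inv \<phi> (\<psi> v)"]
    by (simp add: matrix_works[OF lin] qeval_quat_form pure r \<psi>(4))
  moreover have "Q = qsubst (quat_form a b) (matrix ?f)"
    by (rule qform_eqI) (simp add: qeval_qsubst e)
  ultimately have "Q \<in> conics" "quat_form a b \<in> conics"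
    using conics_qsubst[OF quat_form_conic[OF ab], of "matrix ?f"] quat_form_conic[OF ab] by simp_all
  moreover have "qeval (quat_form a b) (matrix ?f *v v) = 1 * qeval Q v" for v by (simp add: e)
  ultimately show ?thesis
    using \<open>invertible (matrix ?f)\<close> by (intro conic_isoI[where c = 1]) simp_all
qed

text \<open>The similarity embeds the coordinate space of the first form into the pure quaternions
  of the second algebra, where the square of a vector is minus its norm. Polarization turns this
  into anticommutators, so the images of the basis vectors satisfy the relations from which standard
  generators for \<open>a, b\<close> were extracted.\<close>

lemma quat_iso_of_conic_iso:
  fixes a b :: "'f::field"
  assumes ab: "standard_pair a b" "standard_pair a' b'"
    and iso: "(quat_form a b, quat_form a' b') \<in> conic_iso"
  shows "\<exists>\<phi>. algebra_iso (*s) (quat_mult a b) quat_one (*s) (quat_mult a' b') quat_one \<phi>"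
proof -
  obtain g c where c: "c \<noteq> 0" and g: "\<And>v. qeval (quat_form a' b') (g *v v) = c * qeval (quat_form a b) v"
    using iso by (auto simp: conic_iso_def)
  define G where "G v = quat_pure (g *v v)" for v :: "'f ^ 3"
  let ?m = "quat_mult a' b'"
  have sq: "?m (G v) (G v) = (- c * qeval (quat_form a b) v) *s quat_one" for v
    by (simp add: quat_square G_def flip: qeval_quat_form) (simp add: g)
  have Gadd: "G (u + v) = G u + G v" for u v
    by (simp add: G_def matrix_vector_right_distrib quat_pure_linear)
  have polar: "?m (G u) (G v) + ?m (G v) (G u) = (- c * qpolar (quat_form a b) u v) *s quat_one" for u v
    using sq[of "u + v"] sq[of u] sq[of v]
    by (simp add: Gadd quat.mult_add_left quat.mult_add_right qeval_add algebra_simps)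
      (simp add: eq_neg_iff_add_eq_0 add.assoc)
  let ?x = "G (axis 1 1)" and ?y = "G (axis 2 1)" and ?z = "G (axis 3 1)"
  have "\<exists>i j. quat.standard_generators a' b' a b i j"
  proof (cases "(2::'f) = 0")
    case False
    have F: "quat_form a b = (- a, - b, a * b, 0, 0, 0)" using False by (simp add: quat_form_def)
    show ?thesis
    proof (rule quat.standard_generators_of_orthogonal[OF False _ _ c])
      show "a \<noteq> 0" "b \<noteq> 0" using ab False by (auto simp: standard_pair_iff)
      show "?m ?x ?x = (c * a) *s quat_one" "?m ?y ?y = (c * b) *s quat_one" "?m ?z ?z = (- (c * a * b)) *s quat_one"
        unfolding sq F by (simp_all add: axis_def)
      show "?m ?y ?x = - ?m ?x ?y" "?m ?z ?x = - ?m ?x ?z" "?m ?z ?y = - ?m ?y ?z"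
        using polar[of "axis 1 1" "axis 2 1"] polar[of "axis 1 1" "axis 3 1"] polar[of "axis 2 1" "axis 3 1"]
        unfolding F by (simp_all add: axis_def eq_neg_iff_add_eq_0 add.commute)
    qed
  next
    case True
    have neg: "- u = u" for u :: 'f
      using double_eq_0[OF True, of u] by (simp add: neg_eq_iff_add_eq_0)
    have vneg: "- u = u" for u :: "'f ^ 4" by (simp add: vec4_eq_iff neg)
    have F: "quat_form a b = (1, b, a * b, 0, 0, b)" using True by (simp add: quat_form_def neg)
    show ?thesis
    proof (rule quat.standard_generators_of_char_2[OF True _ c])
      show "b \<noteq> 0" using ab by (auto simp: standard_pair_iff)
      show "?m ?x ?x = c *s quat_one" "?m ?y ?y = (c * b) *s quat_one" "?m ?z ?z = (c * a * b) *s quat_one"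
        unfolding sq F by (simp_all add: axis_def neg mult.assoc)
      have "?m ?y ?x = - ?m ?x ?y" "?m ?z ?x = - ?m ?x ?z"
        using polar[of "axis 1 1" "axis 2 1"] polar[of "axis 1 1" "axis 3 1"]
        unfolding F by (simp_all add: axis_def eq_neg_iff_add_eq_0 add.commute)
      then show "?m ?y ?x = ?m ?x ?y" "?m ?z ?x = ?m ?x ?z" by (simp_all add: vneg)
      show "?m ?z ?y + ?m ?y ?z = (c * b) *s quat_one"
        using polar[of "axis 3 1" "axis 2 1"] unfolding F by (simp add: axis_def neg)
    qed
  qed
  then show ?thesis
    using algebra_iso_of_generators[OF ab(1) unital_algebra_quat_mult quat_one_nonzero] by blast
qed

section \<open>Discriminants and reduction of a conic to a norm form\<close>

fun qdisc :: "'a::comm_ring_1 qform \<Rightarrow> 'a" where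
  "qdisc (a, b, c, d, e, f) = 4 * a * b * c + d * e * f - a * f\<^sup>2 - b * e\<^sup>2 - c * d\<^sup>2"

lemma singular_at_lift:
  assumes "singular_at Q v" and "v \<noteq> 0" shows "Q \<notin> conics"
proof -
  have "singular_at (qmap to_ac Q) (\<chi> k. to_ac (v $ k))"
    using assms(1)
    by (cases Q) (simp del: to_ac_add to_ac_mult to_ac_power to_ac_numeral add: to_ac_add[symmetric] to_ac_mult[symmetric]
        to_ac_power[symmetric] to_ac_numeral[symmetric])
  moreover have "(\<chi> k. to_ac (v $ k)) \<noteq> 0" using assms(2) by (simp add: vec_eq_iff)
  ultimately show ?thesis by (auto simp: conics_def)
qed

text \<open>Outside characteristic 2 a kernel vector of the Gram matrix is a singular point, since
  its value is half its polar value with itself. In characteristic 2 that determinant is always 0,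
  and \<open>qdisc\<close>, half of it as an integral polynomial, takes its place.\<close>

lemma qdisc_conic:
  fixes Q :: "'f::field qform"
  assumes "Q \<in> conics" shows "qdisc Q \<noteq> 0"
proof
  assume disc: "qdisc Q = 0"
  obtain a b c d e f where Q: "Q = (a, b, c, d, e, f)" by (metis prod_cases6)
  have "\<exists>v. v \<noteq> 0 \<and> singular_at (qmap to_ac Q) v"
  proof (cases "(2::'f) = 0")
    case False
    let ?M = "vector [vector [2 * a, d, e], vector [d, 2 * b, f], vector [e, f, 2 * c]] :: 'f ^ 3 ^ 3"
    have "det ?M = 2 * qdisc Q"
      unfolding det_3 Q by (simp add: algebra_simps power2_eq_square)
    then have "\<not> invertible ?M" using disc by (simp add: invertible_det_nz)
    then obtain v where v: "?M *v v = 0" "v \<noteq> 0"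
      by (auto simp: invertible_left_inverse matrix_left_invertible_ker)
    then have grad: "2 * a * v$1 + d * v$2 + e * v$3 = 0" "d * v$1 + 2 * b * v$2 + f * v$3 = 0"
      "e * v$1 + f * v$2 + 2 * c * v$3 = 0"
      by (simp_all add: vec3_eq_iff matrix_vector_mult_def sum_3)
    then have "qpolar Q v u = 0" for u by (simp add: Q)
    moreover have "2 * qeval Q v = qpolar Q v v" by (simp only: qpolar_self)
    ultimately have "singular_at Q v" using False by (simp add: singular_at_iff)
    then show ?thesis using singular_at_lift v(2) assms by blast
  next
    case True
    have neg: "- u = u" for u :: 'f
      using double_eq_0[OF True, of u] by (simp add: neg_eq_iff_add_eq_0)
    have sub: "u - v = u + v" for u v :: 'f using neg[of v] diff_conv_add_uminus[of u v] by simp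
    have four: "(4::'f) = 0" using True by (metis mult_2 mult_zero_left numeral_Bit0)
    have "(2::'f alg_closure) = to_ac (2::'f)" by simp
    then have two: "(2::'f alg_closure) = 0" by (simp only: True to_ac_0)
    show ?thesis
    proof (cases "d = 0 \<and> e = 0 \<and> f = 0")
      case False
      \<comment> \<open>In characteristic 2 the polar form is alternating, its radical is spanned by
        this vector, and the value of the form there is \<open>qdisc Q\<close>.\<close>
      let ?v = "vec3 f e d"
      have "f * a * f + e * b * e + d * c * d + d * e * f = 0"
        using disc four by (simp add: Q sub power2_eq_square algebra_simps)
      then have "singular_at Q ?v"
        using True double_eq_0[OF True] by (simp add: Q power2_eq_square algebra_simps)
      moreover have "?v \<noteq> 0" using False by (auto simp: vec3_eq_iff)
      ultimately show ?thesis using singular_at_lift assms by blast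
    next
      case zero: True
      \<comment> \<open>Over the closure a diagonal form in characteristic 2 is the square of a
        linear form and is singular at each of its zeros. One zero has the square roots of
        \<open>c\<close> and \<open>a\<close> as outer coordinates, unless both vanish.\<close>
      obtain p q where pq: "p\<^sup>2 = to_ac a" "q\<^sup>2 = to_ac c"
        using nth_root_exists[of 2] by (metis pos2)
      have dbl: "x + x = 0" for x :: "'f alg_closure" using double_eq_0[OF two] .
      show ?thesis
      proof (cases "a = 0 \<and> c = 0")
        case True
        then have "singular_at (qmap to_ac Q) (vec3 1 0 0)" using zero two by (simp add: Q)
        then show ?thesis by (intro exI[of _ "vec3 1 0 0"]) (simp add: vec3_eq_iff)
      next
        case False
        have "singular_at (qmap to_ac Q) (vec3 q 0 p)"
          using zero two pq dbl by (simp add: Q mult.commute)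
        moreover have "vec3 q 0 p \<noteq> 0" using False pq by (auto simp: vec3_eq_iff)
        ultimately show ?thesis by blast
      qed
    qed
  qed
  then show False using assms by (auto simp: conics_def)
qed

text \<open>The Gram determinant of the polar form on the plane spanned by \<open>u\<close> and
  \<open>v\<close>; it is nonzero exactly when this plane is nondegenerate and \<open>u, v\<close>
  are independent.\<close>

definition binary_disc :: "'a::comm_ring_1 qform \<Rightarrow> 'a ^ 3 \<Rightarrow> 'a ^ 3 \<Rightarrow> 'a" where
  "binary_disc Q u v = 4 * qeval Q u * qeval Q v - (qpolar Q u v)\<^sup>2"

text \<open>For each basis vector with nonzero value, its pairs with the other two and with their
  sum decide whether all planes through it are degenerate. The last three pairs serve forms in which
  a mixed term is nonzero while both basis vectors involved have value 0.\<close>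

definition frame_pairs :: "(('a::comm_ring_1 ^ 3) \<times> ('a ^ 3)) list" where
  "frame_pairs =
    [(vec3 1 0 0, vec3 0 1 0), (vec3 1 0 0, vec3 0 0 1), (vec3 1 0 0, vec3 0 1 1),
     (vec3 0 1 0, vec3 1 0 0), (vec3 0 1 0, vec3 0 0 1), (vec3 0 1 0, vec3 1 0 1),
     (vec3 0 0 1, vec3 1 0 0), (vec3 0 0 1, vec3 0 1 0), (vec3 0 0 1, vec3 1 1 0),
     (vec3 1 1 0, vec3 0 1 0), (vec3 1 0 1, vec3 0 0 1), (vec3 0 1 1, vec3 0 0 1)]"

lemma ex_frame_pair:
  fixes Q :: "'f::field qform"
  assumes "qdisc Q \<noteq> 0"
  shows "\<exists>(u, v)\<in>set frame_pairs. qeval Q u * binary_disc Q u v \<noteq> 0"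
proof (rule ccontr)
  assume no: "\<not> ?thesis"
  obtain a b c d e f where Q: "Q = (a, b, c, d, e, f)" by (metis prod_cases6)
  have z: "a * (4 * a * b - d\<^sup>2) = 0" "a * (4 * a * c - e\<^sup>2) = 0" "a * (4 * a * (b + c + f) - (d + e)\<^sup>2) = 0"
    "b * (4 * b * a - d\<^sup>2) = 0" "b * (4 * b * c - f\<^sup>2) = 0" "b * (4 * b * (a + c + e) - (d + f)\<^sup>2) = 0"
    "c * (4 * c * a - e\<^sup>2) = 0" "c * (4 * c * b - f\<^sup>2) = 0" "c * (4 * c * (a + b + d) - (e + f)\<^sup>2) = 0"
    "(a + b + d) * (4 * (a + b + d) * b - (d + 2 * b)\<^sup>2) = 0"
    "(a + c + e) * (4 * (a + c + e) * c - (e + 2 * c)\<^sup>2) = 0"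
    "(b + c + f) * (4 * (b + c + f) * c - (f + 2 * c)\<^sup>2) = 0"
    using no unfolding frame_pairs_def Q by (simp_all add: binary_disc_def del: mult_eq_0_iff)
  have "qdisc Q = 0"
  proof (cases "(2::'f) = 0")
    case True
    have four: "(4::'f) = 0" using True by (metis mult_2 mult_zero_left numeral_Bit0)
    have d: "d = 0"
    proof (rule ccontr)
      assume "d \<noteq> 0" then show False using z(1,4,10) True four by simp
    qed
    have e: "e = 0"
    proof (rule ccontr)
      assume "e \<noteq> 0" then show False using z(2,7,11) True four by simp
    qed
    have f: "f = 0"
    proof (rule ccontr)
      assume "f \<noteq> 0" then show False using z(5,8,12) True four by simp
    qed
    show ?thesis using d e f four by (simp add: Q)
  next
    case False
    have four: "(4::'f) \<noteq> 0" using False mult_eq_0_iff[of "2::'f" 2] by simp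
    \<comment> \<open>The form \<open>4 Q(e1) Q(y) - B(e1, y)^2\<close> lives on the quotient by
      \<open>e1\<close>. The three equations say that it vanishes at \<open>e2\<close>,
      \<open>e3\<close> and \<open>e2 + e3\<close>, so all its coefficients are 0, and its
      discriminant is \<open>4 a\<close> times the discriminant of \<open>Q\<close>.\<close>
    have disc0: "4 * a * b * c + d * e * f - a * f\<^sup>2 - b * e\<^sup>2 - c * d\<^sup>2 = 0"
      if "a \<noteq> 0" "a * (4 * a * b - d\<^sup>2) = 0" "a * (4 * a * c - e\<^sup>2) = 0" "a * (4 * a * (b + c + f) - (d + e)\<^sup>2) = 0"
      for a b c d e f :: 'f
    proof -
      have 1: "4 * a * b - d\<^sup>2 = 0" "4 * a * c - e\<^sup>2 = 0" "4 * a * (b + c + f) - (d + e)\<^sup>2 = 0"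
        using that by simp_all
      have "2 * (2 * a * f - d * e) = (4 * a * (b + c + f) - (d + e)\<^sup>2) - (4 * a * b - d\<^sup>2) - (4 * a * c - e\<^sup>2)"
        by (simp add: algebra_simps power2_eq_square)
      then have "2 * (2 * a * f - d * e) = 0" by (simp only: 1 diff_zero)
      then have 2: "2 * a * f - d * e = 0" using False by (metis mult_eq_0_iff)
      have "4 * a * (4 * a * b * c + d * e * f - a * f\<^sup>2 - b * e\<^sup>2 - c * d\<^sup>2)
          = (4 * a * b - d\<^sup>2) * (4 * a * c - e\<^sup>2) - (2 * a * f - d * e)\<^sup>2"
        by (simp add: algebra_simps power2_eq_square)
      then show ?thesis using 1 2 four that(1) by simp
    qed
    show ?thesis
    proof (cases "a = 0 \<and> b = 0 \<and> c = 0")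
      case True
      then have "d = 0" using z(10) by simp
      then show ?thesis using True by (simp add: Q)
    next
      case nz: False
      then consider "a \<noteq> 0" | "b \<noteq> 0" | "c \<noteq> 0" by blast
      then show ?thesis
      proof cases
        case 1 then show ?thesis using disc0[of a b d c e f] z(1-3) by (simp add: Q)
      next
        case 2 then show ?thesis using disc0[of b a d c f e] z(4-6) by (simp add: Q algebra_simps)
      next
        case 3 show ?thesis using disc0[OF 3 z(7-9)] by (simp add: Q algebra_simps)
      qed
    qed
  qed
  then show False using assms by blast
qed

text \<open>A chain of zero tests, so that the choice of a plane can be made by a program. On
  \<open>frame_pairs\<close> the default \<open>(0, 0)\<close> is not reached when
  \<open>qdisc\<close> is nonzero.\<close>

fun pick_pair :: "'a::comm_ring_1 qform \<Rightarrow> (('a ^ 3) \<times> ('a ^ 3)) list \<Rightarrow> ('a ^ 3) \<times> ('a ^ 3)" where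
  "pick_pair Q [] = (0, 0)"
| "pick_pair Q ((u, v) # ps) = (if qeval Q u * binary_disc Q u v = 0 then pick_pair Q ps else (u, v))"

lemma pick_pair:
  assumes "\<exists>(u, v)\<in>set ps. qeval Q u * binary_disc Q u v \<noteq> 0" and "pick_pair Q ps = (u, v)"
  shows "qeval Q u * binary_disc Q u v \<noteq> 0"
  using assms by (induction Q ps rule: pick_pair.induct) (auto split: if_splits)

definition cross :: "'a::comm_ring_1 ^ 3 \<Rightarrow> 'a ^ 3 \<Rightarrow> 'a ^ 3" where
  "cross u v = vec3 (u$2 * v$3 - u$3 * v$2) (u$3 * v$1 - u$1 * v$3) (u$1 * v$2 - u$2 * v$1)"

text \<open>The adjugate of the matrix of the polar form, applied to \<open>p\<close>.\<close>

fun qadj :: "'a::comm_ring_1 qform \<Rightarrow> 'a ^ 3 \<Rightarrow> 'a ^ 3" where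
  "qadj (a, b, c, d, e, f) p = vec3
     ((4 * b * c - f\<^sup>2) * p$1 + (e * f - 2 * c * d) * p$2 + (d * f - 2 * b * e) * p$3)
     ((e * f - 2 * c * d) * p$1 + (4 * a * c - e\<^sup>2) * p$2 + (d * e - 2 * a * f) * p$3)
     ((d * f - 2 * b * e) * p$1 + (d * e - 2 * a * f) * p$2 + (4 * a * b - d\<^sup>2) * p$3)"

text \<open>The polar form pairs \<open>qadj Q p\<close> with \<open>u\<close> to a multiple of the
  dot product of \<open>u\<close> and \<open>p\<close>, and the cross product is dot-orthogonal to
  both vectors. In characteristic 2 the result lies in the radical of the polar form.\<close>

definition qnormal :: "'a::comm_ring_1 qform \<Rightarrow> 'a ^ 3 \<Rightarrow> 'a ^ 3 \<Rightarrow> 'a ^ 3" where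
  "qnormal Q u v = qadj Q (cross u v)"

lemma qpolar_qadj: "qpolar Q u (qadj Q p) = 2 * qdisc Q * (u$1 * p$1 + u$2 * p$2 + u$3 * p$3)"
  by (cases Q) (simp add: algebra_simps power2_eq_square)

lemma qpolar_qnormal: "qpolar Q u (qnormal Q u v) = 0" "qpolar Q v (qnormal Q u v) = 0"
  by (simp_all add: qnormal_def qpolar_qadj cross_def algebra_simps)

lemma qeval_qadj: "qeval (a, b, c, d, e, f) (qadj (a, b, c, d, e, f) p) = qdisc (a, b, c, d, e, f) *
   ((4 * b * c - f\<^sup>2) * (p$1)\<^sup>2 + (4 * a * c - e\<^sup>2) * (p$2)\<^sup>2 + (4 * a * b - d\<^sup>2) * (p$3)\<^sup>2
     + 2 * (e * f - 2 * c * d) * p$1 * p$2 + 2 * (d * f - 2 * b * e) * p$1 * p$3 + 2 * (d * e - 2 * a * f) * p$2 * p$3)"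
  by (simp add: algebra_simps power2_eq_square)

text \<open>The second factor in \<open>qeval_qadj\<close> is the quadratic form of the adjugate
  matrix, and by the Cauchy-Binet identity its value at a cross product is the Gram determinant of
  the two vectors.\<close>

lemma qeval_qnormal: "qeval Q (qnormal Q u v) = qdisc Q * binary_disc Q u v"
proof (cases Q)
  case (fields a b c d e f)
  show ?thesis unfolding fields qnormal_def qeval_qadj
    by (rule arg_cong[where f = "(*) _"])
      (simp add: cross_def binary_disc_def algebra_simps power2_eq_square)
qed

text \<open>
  Put \<open>w = qnormal Q u v\<close>, \<open>n = Q u\<close>, \<open>m = Q v\<close>, \<open>\<Delta> = qdisc Q\<close>, and let \<open>B\<close> and \<open>D = 4 n m - B\<^sup>2\<close> be the
  polar form and the binary discriminant of \<open>u, v\<close>.  Then the form is \<open>(n x\<^sup>2 + B x y + m y\<^sup>2) + \<Delta> D z\<^sup>2\<close> on \<open>x u + y v + z w\<close>.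
  In characteristic different from 2 the vector \<open>v\<close> is replaced by \<open>2 n v - B u\<close>, which is orthogonal to \<open>u\<close>
  and has value \<open>n D\<close>.
\<close>

definition conic_pair :: "'f::field qform \<Rightarrow> 'f \<times> 'f" where
  "conic_pair Q = (let (u, v) = pick_pair Q frame_pairs;
       n = qeval Q u; m = qeval Q v; B = qpolar Q u v; D = binary_disc Q u v
     in if (2::'f) = 0 then (m * n / B\<^sup>2, n / (qdisc Q * B\<^sup>2)) else (- D, - (qdisc Q * D / n)))"

definition conic_point :: "'f::field qform \<Rightarrow> 'f ^ 3 \<Rightarrow> 'f ^ 3" where
  "conic_point Q p = (let (u, v) = pick_pair Q frame_pairs; (a, b) = conic_pair Q;
       n = qeval Q u; B = qpolar Q u v; w = qnormal Q u v
     in if (2::'f) = 0 then p$1 *s w + p$2 *s u + (p$3 * n / B) *s v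
        else (a * b * p$3) *s u + (b * p$2) *s ((2 * n) *s v + (- B) *s u) + (a * p$1) *s w)"

lemma conic_point_linear: "Vector_Spaces.linear (*s) (*s) (conic_point Q)"
  unfolding Vector_Spaces.linear_iff
  by (auto simp: vec.vector_space_axioms conic_point_def Let_def vec3_eq_iff algebra_simps add_divide_distrib
    split: prod.split)

lemma conic_pair_similar:
  fixes Q :: "'f::field qform"
  assumes Q: "qdisc Q \<noteq> 0" and ab: "conic_pair Q = (a, b)"
  shows "standard_pair a b"
    and "\<exists>c. c \<noteq> 0 \<and> (\<forall>p. qeval Q (conic_point Q p) = c * qeval (quat_form a b) p)"
proof -
  obtain u v where uv: "pick_pair Q frame_pairs = (u, v)" by fastforce
  define n m B D w \<Delta> where "n = qeval Q u" and "m = qeval Q v" and "B = qpolar Q u v"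
    and "D = binary_disc Q u v" and "w = qnormal Q u v" and "\<Delta> = qdisc Q"
  have nz: "n \<noteq> 0" "D \<noteq> 0" "\<Delta> \<noteq> 0"
    using pick_pair[OF ex_frame_pair[OF Q] uv] Q by (simp_all add: n_def D_def \<Delta>_def)
  have D: "D = 4 * n * m - B\<^sup>2" by (simp add: D_def n_def m_def B_def binary_disc_def)
  have vals: "qeval Q u = n" "qeval Q v = m" "qeval Q w = \<Delta> * D" "qpolar Q u v = B" "qpolar Q v u = B"
    "qpolar Q u w = 0" "qpolar Q v w = 0" "qpolar Q w u = 0" "qpolar Q w v = 0"
    "qpolar Q u u = 2 * n"
    unfolding n_def m_def B_def w_def D_def \<Delta>_def
    by (simp_all only: qeval_qnormal qpolar_qnormal qpolar_self qpolar_commute[of Q v u]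
        qpolar_commute[of Q "qnormal Q u v" u] qpolar_commute[of Q "qnormal Q u v" v])
  have "standard_pair a b \<and> (\<exists>c. c \<noteq> 0 \<and> (\<forall>p. qeval Q (conic_point Q p) = c * qeval (quat_form a b) p))"
  proof (cases "(2::'f) = 0")
    case True
    have four: "(4::'f) = 0" using True by (metis mult_2 mult_zero_left numeral_Bit0)
    have neg: "- x = x" for x :: 'f
      using double_eq_0[OF True, of x] by (simp add: neg_eq_iff_add_eq_0)
    have B: "D = B\<^sup>2" "B \<noteq> 0" using nz D four neg by auto
    have ab': "a = m * n / B\<^sup>2" "b = n / (\<Delta> * B\<^sup>2)"
      using ab by (simp_all add: conic_pair_def Let_def uv True \<Delta>_def n_def m_def B_def)
    \<comment> \<open>On \<open>w, u, (n / B) v\<close> the form has diagonal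
      \<open>\<Delta> B^2, n, n^2 m / B^2\<close> and a single polar value \<open>n\<close>, between
      the last two vectors. Dividing by the first entry gives \<open>1, b, a b\<close> and
      \<open>b\<close> for the chosen pair.\<close>
    have "qeval Q (conic_point Q p) = \<Delta> * B\<^sup>2 * qeval (quat_form a b) p" for p
    proof -
      have "conic_point Q p = p$1 *s w + p$2 *s u + (p$3 * n / B) *s v"
        by (simp add: conic_point_def Let_def uv True n_def B_def w_def split: prod.split)
      then have "qeval Q (conic_point Q p) = (p$1)\<^sup>2 * (\<Delta> * B\<^sup>2) + (p$2)\<^sup>2 * n
          + (p$3)\<^sup>2 * ((n / B)\<^sup>2 * m) + p$2 * p$3 * (n / B * B)"
        using B(1) by (simp add: qeval_add qeval_scale qpolar_linear vals power_mult_distrib power_divide)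
      also have "(n / B)\<^sup>2 * m = \<Delta> * B\<^sup>2 * (a * b)"
        using nz B(2) by (simp add: ab' power2_eq_square)
      also have "n / B * B = \<Delta> * B\<^sup>2 * b" using nz B(2) by (simp add: ab')
      also have "(p$2)\<^sup>2 * n = (p$2)\<^sup>2 * (\<Delta> * B\<^sup>2 * b)" using nz B(2) by (simp add: ab')
      finally show ?thesis
        by (simp add: quat_form_def True neg algebra_simps)
    qed
    moreover have "standard_pair a b" using nz B by (simp add: standard_pair_iff True ab')
    moreover have "\<Delta> * B\<^sup>2 \<noteq> 0" using nz B by simp
    ultimately show ?thesis by blast
  next
    case False
    have ab': "a = - D" "b = - (\<Delta> * D / n)"
      using ab by (simp_all add: conic_pair_def Let_def uv False \<Delta>_def n_def D_def)
    \<comment> \<open>On \<open>u, v', w\<close> the form is diagonal with entries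
      \<open>n, n D, \<Delta> D\<close>, that is \<open>n\<close> times \<open>1, - a, - b\<close>.
      Scaling the vectors by \<open>a b\<close>, \<open>b\<close>, \<open>a\<close> turns this into
      \<open>n a b\<close> times \<open>a b, - b, - a\<close>, so the order of the coordinates is
      reversed.\<close>
    have "qeval Q (conic_point Q p) = n * a * b * qeval (quat_form a b) p" for p
    proof -
      define v' where "v' = (2 * n) *s v + (- B) *s u"
      have v': "qeval Q v' = n * D" "qpolar Q u v' = 0" "qpolar Q v' w = 0"
        unfolding v'_def D
        by (simp_all only: qeval_add qeval_scale qpolar_linear vals) (simp_all add: algebra_simps power2_eq_square)
      have "conic_point Q p = (a * b * p$3) *s u + (b * p$2) *s v' + (a * p$1) *s w"
        by (simp add: conic_point_def Let_def uv False n_def B_def w_def v'_def ab split: prod.split)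
      then have "qeval Q (conic_point Q p) = (a * b * p$3)\<^sup>2 * n + (b * p$2)\<^sup>2 * (n * D) + (a * p$1)\<^sup>2 * (\<Delta> * D)"
        by (simp add: qeval_add qeval_scale qpolar_linear vals v')
      also have "\<Delta> * D = - (b * n)" using nz by (simp add: ab')
      also have "D = - a" by (simp add: ab')
      finally show ?thesis
        by (simp add: quat_form_def False algebra_simps power2_eq_square)
    qed
    moreover have "standard_pair a b" using nz by (simp add: standard_pair_iff ab')
    moreover have "n * a * b \<noteq> 0" using nz by (simp add: ab')
    ultimately show ?thesis by blast
  qed
  then show "standard_pair a b"
    and "\<exists>c. c \<noteq> 0 \<and> (\<forall>p. qeval Q (conic_point Q p) = c * qeval (quat_form a b) p)" by blast+
qed

text \<open>A kernel vector of the similarity would have value 0 and lie in the radical of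
  \<open>quat_form a b\<close>, so it would be a singular point. No determinant of the map has to be
  computed.\<close>

lemma conic_point_eq_0:
  fixes Q :: "'f::field qform"
  assumes Q: "qdisc Q \<noteq> 0" and p: "conic_point Q p = 0"
  shows "p = 0"
proof (rule ccontr)
  assume "p \<noteq> 0"
  obtain a b where ab: "conic_pair Q = (a, b)" by fastforce
  obtain c where c: "c \<noteq> 0" "\<And>p. qeval Q (conic_point Q p) = c * qeval (quat_form a b) p"
    using conic_pair_similar(2)[OF Q ab] by blast
  have add: "conic_point Q (u + v) = conic_point Q u + conic_point Q v" for u v
    using conic_point_linear[of Q] by (simp add: Vector_Spaces.linear_iff)
  have "qeval Q 0 = 0" by (cases Q) simp
  then have p0: "qeval (quat_form a b) p = 0" using c(2)[of p] c(1) p by simp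
  then have "c * qpolar (quat_form a b) p u = 0" for u
    using c(2)[of "p + u"] c(2)[of u] p by (simp add: add qeval_add algebra_simps)
  then have "singular_at (quat_form a b) p" using c(1) p0 by (simp add: singular_at_iff)
  then have "quat_form a b \<notin> conics" using \<open>p \<noteq> 0\<close> by (rule singular_at_lift)
  then show False using quat_form_conic conic_pair_similar(1)[OF Q ab] by blast
qed

lemma conic_iso_quat_form:
  fixes Q :: "'f::field qform"
  assumes Q: "Q \<in> conics"
  shows "\<exists>a b. standard_pair a b \<and> (quat_form a b, Q) \<in> conic_iso"
proof -
  note disc = qdisc_conic[OF Q]
  obtain a b where ab: "conic_pair Q = (a, b)" by fastforce
  obtain c where c: "c \<noteq> 0" "\<And>p. qeval Q (conic_point Q p) = c * qeval (quat_form a b) p"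
    using conic_pair_similar(2)[OF disc ab] by blast
  have std: "standard_pair a b" using conic_pair_similar(1)[OF disc ab] .
  note lin = conic_point_linear[of Q]
  have "invertible (matrix (conic_point Q))"
    using conic_point_eq_0[OF disc]
    by (auto simp: invertible_left_inverse matrix_left_invertible_ker matrix_works[OF lin])
  then have "(quat_form a b, Q) \<in> conic_iso"
    using quat_form_conic[OF std] Q c by (intro conic_isoI) (auto simp: matrix_works[OF lin])
  then show ?thesis using std by blast
qed

section \<open>The bijection between isomorphism classes\<close>

lemma quat_in_quaternion_algebras:
  "standard_pair a b \<Longrightarrow> (quat_mult a b, quat_one) \<in> quaternion_algebras"
  by (simp add: quaternion_algebras_def quaternion_algebra_quat)

theorem conic_bijection:
  "bij_betw (\<lambda>\<B>. conic_iso `` {Q. \<exists>B\<in>\<B>. associated_conic B Q})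
     (quaternion_algebras // (quaternion_iso :: ('f::field algebra4 \<times> 'f algebra4) set))
     (conics // conic_iso)"
proof -
  let ?F = "\<lambda>\<B> :: 'f algebra4 set. conic_iso `` {Q. \<exists>B\<in>\<B>. associated_conic B Q}"
  let ?quat = "\<lambda>a b :: 'f. (quat_mult a b, quat_one :: 'f ^ 4)"
  note eqQ = equiv_quaternion_iso[where 'f='f] and eqC = equiv_conic_iso[where 'f='f]
  have rep: "\<exists>a b. standard_pair a b \<and> A = quaternion_iso `` {?quat a b}"
    if A: "A \<in> quaternion_algebras // quaternion_iso" for A :: "'f algebra4 set"
  proof -
    obtain B where B: "B \<in> quaternion_algebras" "A = quaternion_iso `` {B}"
      using A by (rule quotientE)
    obtain m e where "B = (m, e)" by fastforce
    with B have me: "(m, e) \<in> quaternion_algebras" "A = quaternion_iso `` {(m, e)}" by simp_all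
    obtain a b \<phi> where ab: "standard_pair a b" "algebra_iso (*s) (quat_mult a b) quat_one (*s) m e \<phi>"
      using quaternion_algebra_iso_quat[of m e] me by (auto simp: quaternion_algebras_def)
    then have "(?quat a b, (m, e)) \<in> quaternion_iso"
      using me quat_in_quaternion_algebras by (auto simp: quaternion_iso_def)
    then have "quaternion_iso `` {?quat a b} = quaternion_iso `` {(m, e)}"
      by (rule equiv_class_eq[OF eqQ])
    then show ?thesis using ab me by blast
  qed
  \<comment> \<open>All forms associated with algebras of the class are isometric to
    \<open>quat_form a b\<close>, and this form is among them; closing under
    \<open>conic_iso\<close> therefore gives exactly its class.\<close>
  have F: "?F (quaternion_iso `` {?quat a b}) = conic_iso `` {quat_form a b}" if ab: "standard_pair a b" for a b
  proof -
    have 1: "(Q, quat_form a b) \<in> conic_iso"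
      if B': "B \<in> quaternion_iso `` {?quat a b}" "associated_conic B Q" for B Q
    proof -
      obtain m e where B: "B = (m, e)" by fastforce
      then obtain \<phi> where "algebra_iso (*s) (quat_mult a b) quat_one (*s) m e \<phi>"
        and "quaternion_algebra (*s) m e"
        using B' by (auto simp: quaternion_iso_def quaternion_algebras_def)
      then show ?thesis
        using B'(2) associated_conic_of_iso[OF ab] unfolding B
        by (blast intro: quaternion_algebra.axioms(1))
    qed
    have "?quat a b \<in> quaternion_iso `` {?quat a b}"
      by (rule equiv_class_self[OF eqQ quat_in_quaternion_algebras[OF ab]])
    then have 2: "quat_form a b \<in> {Q. \<exists>B\<in>quaternion_iso `` {?quat a b}. associated_conic B Q}"
      using associated_conic_quat by blast
    show ?thesis
    proof (intro equalityI subsetI)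
      fix Q assume "Q \<in> ?F (quaternion_iso `` {?quat a b})"
      then obtain Q' B where "(Q', Q) \<in> conic_iso" "B \<in> quaternion_iso `` {?quat a b}" "associated_conic B Q'"
        by blast
      then show "Q \<in> conic_iso `` {quat_form a b}"
        using 1 eqC by (meson ImageI equivE singletonI symE transE)
    qed (use 2 in blast)
  qed
  show ?thesis
  proof (rule bij_betwI')
    fix A Y assume AY: "A \<in> quaternion_algebras // (quaternion_iso :: ('f algebra4 \<times> 'f algebra4) set)"
      "Y \<in> quaternion_algebras // (quaternion_iso :: ('f algebra4 \<times> 'f algebra4) set)"
    obtain a b a' b' where ab: "standard_pair a b" "A = quaternion_iso `` {?quat a b}"
      "standard_pair a' b'" "Y = quaternion_iso `` {?quat a' b'}" using rep AY by metis
    show "?F A = ?F Y \<longleftrightarrow> A = Y"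
    proof
      assume "?F A = ?F Y"
      then have "conic_iso `` {quat_form a b} = conic_iso `` {quat_form a' b'}" using F ab by simp
      then have "(quat_form a b, quat_form a' b') \<in> conic_iso"
        using eq_equiv_class[OF _ eqC] quat_form_conic ab by blast
      then have "(?quat a b, ?quat a' b') \<in> quaternion_iso"
        using quat_iso_of_conic_iso quat_in_quaternion_algebras ab by (auto simp: quaternion_iso_def)
      then show "A = Y" unfolding ab by (rule equiv_class_eq[OF eqQ])
    qed simp
  next
    fix A assume "A \<in> quaternion_algebras // (quaternion_iso :: ('f algebra4 \<times> 'f algebra4) set)"
    then obtain a b where ab: "standard_pair a b" "A = quaternion_iso `` {?quat a b}" using rep by metis
    then show "?F A \<in> conics // conic_iso"
      using F[OF ab(1)] quotientI[OF quat_form_conic[OF ab(1)], of conic_iso] by simp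
  next
    fix Y :: "'f qform set" assume "Y \<in> conics // conic_iso"
    then obtain Q where Q: "Q \<in> conics" "Y = conic_iso `` {Q}" by (auto elim: quotientE)
    obtain a b where ab: "standard_pair a b" "(quat_form a b, Q) \<in> conic_iso"
      using conic_iso_quat_form[OF Q(1)] by blast
    then have "Y = ?F (quaternion_iso `` {?quat a b})"
      using F equiv_class_eq[OF eqC] Q by blast
    moreover have "quaternion_iso `` {?quat a b} \<in> quaternion_algebras // quaternion_iso"
      using quat_in_quaternion_algebras[OF ab(1)] by (rule quotientI)
    ultimately show "\<exists>A\<in>quaternion_algebras // quaternion_iso. Y = ?F A" by blast
  qed
qed

section \<open>Programs for field operations and zero tests\<close>

lemma exec_deterministic:
  assumes "exec U p s n s'" and "exec U p s m t" shows "n = m \<and> s' = t"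
  using assms
proof (induction arbitrary: m t rule: exec.induct)
  case Skip then show ?case by cases auto
next
  case Push then show ?case by cases auto
next
  case Pop then show ?case by cases auto
next
  case Seq
  from Seq.prems show ?case by cases (use Seq.IH in blast)
next
  case Branch_True
  from Branch_True.prems show ?case by cases (auto simp: Branch_True.hyps dest: Branch_True.IH)
next
  case Branch_False
  from Branch_False.prems show ?case by cases (auto simp: Branch_False.hyps dest: Branch_False.IH)
next
  case Branch_Empty
  from Branch_Empty.prems show ?case by cases (auto simp: Branch_Empty.hyps dest: Branch_Empty.IH)
next
  case While_Stop
  from While_Stop.prems show ?case by cases (use While_Stop.hyps in auto)
next
  case While_Step
  from While_Step.prems show ?case by cases (use While_Step.IH While_Step.hyps in blast)+
next
  case Call
  from Call.prems show ?case by cases (use Call.IH in blast)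
qed

text \<open>The cost model enters only the time, so field algorithms specified in the bit model have
  the same effect in the arithmetic one.\<close>

lemma exec_cost_model:
  assumes "exec V p s n s'" shows "\<exists>m. exec U p s m s'"
  using assms by (induction rule: exec.induct) (blast intro: exec.intros)+

text \<open>In the bit model every call pays for the result that it copies. A call charged as a
  single step could return an arbitrarily long word.\<close>

lemma exec_length:
  assumes "exec U p s n s'" "U = {}" shows "length (s' r) \<le> length (s r) + n"
  using assms
  by (induction arbitrary: r rule: exec.induct) (fastforce intro: le_trans)+

fun pushes :: "bits \<Rightarrow> prog" where
  "pushes [] = Skip"
| "pushes (b # w) = Seq (pushes w) (Push b 0)"

lemma exec_pushes: "exec U (pushes w) s (1 + length w) (s(0 := w @ s 0))"
proof (induction w arbitrary: s)
  case (Cons b w)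
  have "exec U (Push b 0) (s(0 := w @ s 0)) 1 (s(0 := (b # w) @ s 0))"
    using exec.Push[of U b 0 "s(0 := w @ s 0)"] by simp
  from exec.Seq[OF Cons this] show ?case by (simp only: list.size(4) add.assoc pushes.simps One_nat_def)
next
  case Nil
  show ?case using exec.Skip[of U s] by simp
qed

lemma load_single: "(load [])(0 := w @ load [] 0) = load [w]"
  by (auto simp: load_def)

text \<open>Calling on fresh registers overwrites the target with a constant, so its old contents
  need not be emptied, at a cost independent of them.\<close>

lemma exec_set_register:
  "\<exists>n \<le> 2 + 2 * length w. exec U (Call (pushes w) [] d) s n (s(d := w))"
proof -
  have "exec U (pushes w) (load (map s [])) (1 + length w) ((load [])(0 := w @ load [] 0))"
    using exec_pushes by simp
  then have "exec U (pushes w) (load (map s [])) (1 + length w) (load [w])"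
    by (simp only: load_single list.map)
  from exec.Call[OF this, of d] have "exec U (Call (pushes w) [] d) s
      (if pushes w \<in> U then 1 else 1 + (1 + length w) + bit_size (map s []) + length (load [w] 0)) (s(d := load [w] 0))" .
  moreover have "(if pushes w \<in> U then 1 else 1 + (1 + length w) + bit_size (map s []) + length (load [w] 0)) \<le> 2 + 2 * length w"
    by (simp add: load_def bit_size_def)
  moreover have "load [w] 0 = w" by (simp add: load_def)
  ultimately show ?thesis by metis
qed

section \<open>Evaluation of arithmetic expressions with polynomial bounds\<close>

lemma poly_mono_nat: "x \<le> y \<Longrightarrow> poly P x \<le> poly P (y::nat)"
  by (induction P) (auto intro!: add_mono mult_mono)

text \<open>The size of the result is bounded along with the time, since it is the input size of the
  next operation; this is what makes such operations compose.\<close>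

definition bounded_operation ::
  "prog set \<Rightarrow> (bits \<Rightarrow> nat) \<Rightarrow> 'f presentation \<Rightarrow> prog \<Rightarrow> 'f set \<Rightarrow> ('f \<Rightarrow> 'f \<Rightarrow> 'f) \<Rightarrow> bool" where
  "bounded_operation U \<mu> K p D f \<longleftrightarrow>
     (\<exists>P::nat poly. \<forall>s r r' d x y. decode K (s r) = Some x \<longrightarrow> decode K (s r') = Some y \<longrightarrow> y \<in> D \<longrightarrow>
       (\<exists>n w. exec U (Call p [r, r'] d) s n (s(d := w)) \<and> decode K w = Some (f x y) \<and>
          n \<le> poly P (\<mu> (s r) + \<mu> (s r')) \<and> \<mu> w \<le> poly P (\<mu> (s r) + \<mu> (s r'))))"

text \<open>
  Both cost models at once: \<open>\<mu>\<close> is the size of a register, so the length of an input is the sum of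
  the \<open>\<mu>\<close> of its registers.
\<close>

locale cost_model =
  fixes U :: "prog set" and \<mu> :: "bits \<Rightarrow> nat" and K :: "'f::field presentation"
  assumes codes_exist: "\<exists>w. decode K w = Some x"
    and add_bounded: "bounded_operation U \<mu> K (add_alg K) UNIV (+)"
    and sub_bounded: "bounded_operation U \<mu> K (sub_alg K) UNIV (-)"
    and mul_bounded: "bounded_operation U \<mu> K (mul_alg K) UNIV (*)"
    and div_bounded: "bounded_operation U \<mu> K (div_alg K) (- {0}) (/)"
    and zero_bounded: "\<exists>P::nat poly. \<forall>s r d x. decode K (s r) = Some x \<longrightarrow>
      (\<exists>n. exec U (Call (zero_alg K) [r] d) s n (s(d := [x = 0])) \<and> n \<le> poly P (\<mu> (s r)))"
begin

definition represents :: "nat list \<Rightarrow> state \<Rightarrow> 'f list \<Rightarrow> bool" where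
  "represents rs s xs \<longleftrightarrow> map (\<lambda>r. decode K (s r)) rs = map Some xs"

definition regsize :: "nat list \<Rightarrow> state \<Rightarrow> nat" where
  "regsize rs s = (\<Sum>r\<leftarrow>rs. \<mu> (s r))"

text \<open>Registers below \<open>d\<close> are protected and those above \<open>d\<close> are
  scratch, so subexpressions can be evaluated in stack order at \<open>d\<close>,
  \<open>d + 1\<close> and so on. The domain \<open>D\<close> records the outcomes of preceding zero
  tests, on which divisions rely.\<close>

definition realizes :: "nat list \<Rightarrow> nat \<Rightarrow> 'f list set \<Rightarrow> prog \<Rightarrow> nat poly \<Rightarrow> ('f list \<Rightarrow> 'f) \<Rightarrow> bool" where
  "realizes rs d D c P F \<longleftrightarrow> (\<forall>s xs. represents rs s xs \<longrightarrow> xs \<in> D \<longrightarrow>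
     (\<exists>n s'. exec U c s n s' \<and> (\<forall>r<d. s' r = s r) \<and> decode K (s' d) = Some (F xs) \<and>
        n \<le> poly P (regsize rs s) \<and> \<mu> (s' d) \<le> poly P (regsize rs s)))"

definition realizes_list :: "nat list \<Rightarrow> nat \<Rightarrow> prog \<Rightarrow> nat poly \<Rightarrow> ('f list \<Rightarrow> 'f) list \<Rightarrow> bool" where
  "realizes_list rs d c P Fs \<longleftrightarrow> (\<forall>s xs. represents rs s xs \<longrightarrow>
    (\<exists>n s'. exec U c s n s' \<and> (\<forall>r<d. s' r = s r) \<and>
       (\<forall>j<length Fs. decode K (s' (d + j)) = Some ((Fs ! j) xs) \<and> \<mu> (s' (d + j)) \<le> poly P (regsize rs s)) \<and>
       n \<le> poly P (regsize rs s)))"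

definition copies :: "nat \<Rightarrow> nat \<Rightarrow> nat \<Rightarrow> prog \<Rightarrow> nat poly \<Rightarrow> bool" where
  "copies m d l c P \<longleftrightarrow> (\<forall>s xs M. length xs = m \<longrightarrow>
     (\<forall>j<m. decode K (s (d + j)) = Some (xs ! j) \<and> \<mu> (s (d + j)) \<le> M) \<longrightarrow> l + m \<le> d \<longrightarrow>
     (\<exists>n s'. exec U c s n s' \<and> (\<forall>j<m. decode K (s' (l + j)) = Some (xs ! j)) \<and>
        (\<forall>r. r < l \<or> l + m \<le> r \<longrightarrow> s' r = s r) \<and> n \<le> poly P M))"

definition emits :: "nat list \<Rightarrow> nat \<Rightarrow> prog \<Rightarrow> nat poly \<Rightarrow> ('f list \<Rightarrow> 'f) list \<Rightarrow> bool" where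
  "emits rs l c P Fs \<longleftrightarrow> (\<forall>s xs. represents rs s xs \<longrightarrow>
    (\<exists>n s'. exec U c s n s' \<and> (\<forall>j<length Fs. decode K (s' (l + j)) = Some ((Fs ! j) xs)) \<and>
       n \<le> poly P (regsize rs s)))"

definition arith_on :: "nat \<Rightarrow> 'f list set \<Rightarrow> ('f list \<Rightarrow> 'f) \<Rightarrow> bool" where
  "arith_on k D F \<longleftrightarrow> (\<forall>rs d. length rs = k \<longrightarrow> (\<forall>r\<in>set rs. r < d) \<longrightarrow> (\<exists>c P. realizes rs d D c P F))"

definition arith :: "nat \<Rightarrow> ('f list \<Rightarrow> 'f) \<Rightarrow> bool" where
  "arith k F \<longleftrightarrow> arith_on k UNIV F"

lemma realizesD:
  assumes "realizes rs d D c P F" "represents rs s xs" "xs \<in> D"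
  shows "\<exists>n s'. exec U c s n s' \<and> (\<forall>r<d. s' r = s r) \<and> decode K (s' d) = Some (F xs) \<and>
        n \<le> poly P (regsize rs s) \<and> \<mu> (s' d) \<le> poly P (regsize rs s)"
  using assms unfolding realizes_def by blast

lemma arith_onE:
  assumes "arith_on k D F" "length rs = k" "\<forall>r\<in>set rs. r < d"
  obtains c P where "realizes rs d D c P F"
  using assms unfolding arith_on_def by blast

lemma represents_cong:
  assumes "\<forall>r<d. s' r = s r" "\<forall>r\<in>set rs. r < d"
  shows "represents rs s' xs = represents rs s xs" "regsize rs s' = regsize rs s"
proof -
  have "map (\<lambda>r. decode K (s' r)) rs = map (\<lambda>r. decode K (s r)) rs" "map (\<lambda>r. \<mu> (s' r)) rs = map (\<lambda>r. \<mu> (s r)) rs"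
    using assms by auto
  then show "represents rs s' xs = represents rs s xs" "regsize rs s' = regsize rs s"
    unfolding represents_def regsize_def by (simp_all only:)
qed

lemma arith_on_const: "arith_on k D (\<lambda>_. c)"
  unfolding arith_on_def
proof (intro allI impI)
  fix rs :: "nat list" and d
  obtain w where w: "decode K w = Some c" using codes_exist by blast
  have "realizes rs d D (Call (pushes w) [] d) [:2 + 2 * length w + \<mu> w:] (\<lambda>_. c)"
    unfolding realizes_def
  proof (intro allI impI)
    fix s xs
    obtain n where "n \<le> 2 + 2 * length w" "exec U (Call (pushes w) [] d) s n (s(d := w))"
      using exec_set_register by blast
    then show "\<exists>n s'. exec U (Call (pushes w) [] d) s n s' \<and> (\<forall>r<d. s' r = s r) \<and> decode K (s' d) = Some c \<and>
        n \<le> poly [:2 + 2 * length w + \<mu> w:] (regsize rs s) \<and> \<mu> (s' d) \<le> poly [:2 + 2 * length w + \<mu> w:] (regsize rs s)"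
      using w by (intro exI[of _ n] exI[of _ "s(d := w)"]) auto
  qed
  then show "\<exists>c' P. realizes rs d D c' P (\<lambda>_. c)" by blast
qed

lemma arith_on_binop:
  assumes F: "arith_on k D F" and G: "arith_on k D G" and p: "bounded_operation U \<mu> K p E f"
    and E: "\<And>xs. xs \<in> D \<Longrightarrow> length xs = k \<Longrightarrow> G xs \<in> E"
  shows "arith_on k D (\<lambda>xs. f (F xs) (G xs))"
  unfolding arith_on_def
proof (intro allI impI)
  fix rs :: "nat list" and d
  assume rs: "length rs = k" "\<forall>r\<in>set rs. r < d"
  then have rs': "\<forall>r\<in>set rs. r < d + 1" by auto
  obtain c1 P1 where "realizes rs d D c1 P1 F" by (rule arith_onE[OF F rs])
  note c1 = realizesD[OF this]
  obtain c2 P2 where "realizes rs (d + 1) D c2 P2 G" by (rule arith_onE[OF G rs(1) rs'])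
  note c2 = realizesD[OF this]
  obtain Q where Q: "\<And>s r r' d x y. decode K (s r) = Some x \<Longrightarrow> decode K (s r') = Some y \<Longrightarrow> y \<in> E \<Longrightarrow>
       \<exists>n w. exec U (Call p [r, r'] d) s n (s(d := w)) \<and> decode K w = Some (f x y) \<and>
          n \<le> poly Q (\<mu> (s r) + \<mu> (s r')) \<and> \<mu> w \<le> poly Q (\<mu> (s r) + \<mu> (s r'))"
    using p unfolding bounded_operation_def by blast
  \<comment> \<open>The first operand waits in register \<open>d\<close>, which the evaluation at
    \<open>d + 1\<close> leaves alone.\<close>
  let ?c = "Seq c1 (Seq c2 (Call p [d, d + 1] d))" and ?P = "P1 + P2 + pcompose Q (P1 + P2)"
  have "realizes rs d D ?c ?P (\<lambda>xs. f (F xs) (G xs))"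
    unfolding realizes_def
  proof (intro allI impI)
    fix s xs assume s: "represents rs s xs" and xs: "xs \<in> D"
    let ?N = "regsize rs s"
    obtain n1 s1 where 1: "exec U c1 s n1 s1" "\<forall>r<d. s1 r = s r" "decode K (s1 d) = Some (F xs)"
      "n1 \<le> poly P1 ?N" "\<mu> (s1 d) \<le> poly P1 ?N" using c1[OF s xs] by blast
    note same = represents_cong[OF 1(2) rs(2)]
    obtain n2 s2 where 2: "exec U c2 s1 n2 s2" "\<forall>r<d + 1. s2 r = s1 r" "decode K (s2 (d + 1)) = Some (G xs)"
      "n2 \<le> poly P2 ?N" "\<mu> (s2 (d + 1)) \<le> poly P2 ?N" using c2[of s1 xs] s xs same by metis
    have s2d: "s2 d = s1 d" using 2(2) by simp
    have "length xs = k" using s rs(1) unfolding represents_def by (metis length_map)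
    then obtain n3 w where 3: "exec U (Call p [d, d + 1] d) s2 n3 (s2(d := w))" "decode K w = Some (f (F xs) (G xs))"
      "n3 \<le> poly Q (\<mu> (s2 d) + \<mu> (s2 (d + 1)))" "\<mu> w \<le> poly Q (\<mu> (s2 d) + \<mu> (s2 (d + 1)))"
      using Q[of s2 d "F xs" "d + 1" "G xs" d] 1(3) 2(3) s2d E[OF xs] by auto
    have "poly Q (\<mu> (s2 d) + \<mu> (s2 (d + 1))) \<le> poly (pcompose Q (P1 + P2)) ?N"
      using 1(5) 2(5) s2d by (auto simp: poly_pcompose intro!: poly_mono_nat)
    then have "n1 + (n2 + n3) \<le> poly ?P ?N" "\<mu> w \<le> poly ?P ?N"
      using 1(4) 2(4) 3(3,4) by auto
    moreover have "exec U ?c s (n1 + (n2 + n3)) (s2(d := w))"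
      using 1(1) 2(1) 3(1) by (intro exec.Seq)
    ultimately show "\<exists>n s'. exec U ?c s n s' \<and> (\<forall>r<d. s' r = s r) \<and> decode K (s' d) = Some (f (F xs) (G xs)) \<and>
        n \<le> poly ?P ?N \<and> \<mu> (s' d) \<le> poly ?P ?N"
      using 1(2) 2(2) 3(2) by (intro exI[of _ "n1 + (n2 + n3)"] exI[of _ "s2(d := w)"]) auto
  qed
  then show "\<exists>c P. realizes rs d D c P (\<lambda>xs. f (F xs) (G xs))" by blast
qed

lemma arith_on_if_zero:
  assumes H: "arith_on k D H" and F: "arith_on k (D \<inter> {xs. H xs = 0}) F" and G: "arith_on k (D \<inter> {xs. H xs \<noteq> 0}) G"
  shows "arith_on k D (\<lambda>xs. if H xs = 0 then F xs else G xs)"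
  unfolding arith_on_def
proof (intro allI impI)
  fix rs :: "nat list" and d
  assume rs: "length rs = k" "\<forall>r\<in>set rs. r < d"
  obtain c0 P0 where "realizes rs d D c0 P0 H" by (rule arith_onE[OF H rs])
  note c0 = realizesD[OF this]
  obtain c1 P1 where "realizes rs d (D \<inter> {xs. H xs = 0}) c1 P1 F" by (rule arith_onE[OF F rs])
  note c1 = realizesD[OF this]
  obtain c2 P2 where "realizes rs d (D \<inter> {xs. H xs \<noteq> 0}) c2 P2 G" by (rule arith_onE[OF G rs])
  note c2 = realizesD[OF this]
  obtain Q where Q: "\<And>s r d x. decode K (s r) = Some x \<Longrightarrow>
      \<exists>n. exec U (Call (zero_alg K) [r] d) s n (s(d := [x = 0])) \<and> n \<le> poly Q (\<mu> (s r))"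
    using zero_bounded by blast
  \<comment> \<open>Register \<open>d\<close> holds the tested value and then the one-bit result of
    the test. It is never empty at the branch, so \<open>Skip\<close> is not executed.\<close>
  let ?c = "Seq c0 (Seq (Call (zero_alg K) [d] d) (Branch d c1 c2 Skip))"
    and ?P = "P0 + pcompose Q P0 + (1 + P1 + P2)"
  have "realizes rs d D ?c ?P (\<lambda>xs. if H xs = 0 then F xs else G xs)"
    unfolding realizes_def
  proof (intro allI impI)
    fix s xs assume s: "represents rs s xs" and xs: "xs \<in> D"
    let ?N = "regsize rs s"
    obtain n0 s0 where 0: "exec U c0 s n0 s0" "\<forall>r<d. s0 r = s r" "decode K (s0 d) = Some (H xs)"
      "n0 \<le> poly P0 ?N" "\<mu> (s0 d) \<le> poly P0 ?N" using c0[OF s xs] by blast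
    obtain n1 where 1: "exec U (Call (zero_alg K) [d] d) s0 n1 (s0(d := [H xs = 0]))" "n1 \<le> poly Q (\<mu> (s0 d))"
      using Q[of s0 d "H xs" d, OF 0(3)] by blast
    have "poly Q (\<mu> (s0 d)) \<le> poly (pcompose Q P0) ?N"
      using 0(5) by (simp add: poly_pcompose poly_mono_nat)
    then have n1: "n1 \<le> poly (pcompose Q P0) ?N" using 1(2) by simp
    define t where "t = s0(d := [H xs = 0])"
    have td: "t d = [H xs = 0]" and same: "\<forall>r<d. t r = s r" using 0(2) by (simp_all add: t_def)
    note cong = represents_cong[OF same rs(2)]
    have "\<exists>n s'. exec U (Branch d c1 c2 Skip) t (1 + n) s' \<and> (\<forall>r<d. s' r = s r) \<and>
        decode K (s' d) = Some (if H xs = 0 then F xs else G xs) \<and>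
        n \<le> poly (P1 + P2) ?N \<and> \<mu> (s' d) \<le> poly (P1 + P2) ?N"
    proof (cases "H xs = 0")
      case True
      then obtain n s' where e: "exec U c1 t n s'" "\<forall>r<d. s' r = t r" "decode K (s' d) = Some (F xs)"
        "n \<le> poly P1 ?N" "\<mu> (s' d) \<le> poly P1 ?N" using c1[of t xs] s xs cong by auto
      have "exec U (Branch d c1 c2 Skip) t (1 + n) s'"
        using e(1) True td by (intro exec.Branch_True[where w = "[]"]) simp_all
      then show ?thesis using e True same by (intro exI[of _ n] exI[of _ s']) auto
    next
      case False
      then obtain n s' where e: "exec U c2 t n s'" "\<forall>r<d. s' r = t r" "decode K (s' d) = Some (G xs)"
        "n \<le> poly P2 ?N" "\<mu> (s' d) \<le> poly P2 ?N" using c2[of t xs] s xs cong by auto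
      have "exec U (Branch d c1 c2 Skip) t (1 + n) s'"
        using e(1) False td by (intro exec.Branch_False[where w = "[]"]) simp_all
      then show ?thesis using e False same by (intro exI[of _ n] exI[of _ s']) auto
    qed
    then obtain n s' where 2: "exec U (Branch d c1 c2 Skip) t (1 + n) s'" "\<forall>r<d. s' r = s r"
        "decode K (s' d) = Some (if H xs = 0 then F xs else G xs)"
        "n \<le> poly (P1 + P2) ?N" "\<mu> (s' d) \<le> poly (P1 + P2) ?N" by blast
    have "exec U ?c s (n0 + (n1 + (1 + n))) s'" using 0(1) 1(1)[folded t_def] 2(1) by (intro exec.Seq)
    moreover have "n0 + (n1 + (1 + n)) \<le> poly ?P ?N" "\<mu> (s' d) \<le> poly ?P ?N"
      using 0(4) n1 2(4,5) by simp_all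
    ultimately show "\<exists>n s'. exec U ?c s n s' \<and> (\<forall>r<d. s' r = s r) \<and>
        decode K (s' d) = Some (if H xs = 0 then F xs else G xs) \<and> n \<le> poly ?P ?N \<and> \<mu> (s' d) \<le> poly ?P ?N"
      using 2(2,3) by blast
  qed
  then show "\<exists>c P. realizes rs d D c P (\<lambda>xs. if H xs = 0 then F xs else G xs)" by blast
qed

lemma arith_const: "arith k (\<lambda>_. c)"
  by (simp add: arith_def arith_on_const)

lemma arith_add: "arith k F \<Longrightarrow> arith k G \<Longrightarrow> arith k (\<lambda>xs. F xs + G xs)"
  unfolding arith_def using arith_on_binop[OF _ _ add_bounded] by blast

lemma arith_diff: "arith k F \<Longrightarrow> arith k G \<Longrightarrow> arith k (\<lambda>xs. F xs - G xs)"
  unfolding arith_def using arith_on_binop[OF _ _ sub_bounded] by blast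

lemma arith_mult: "arith k F \<Longrightarrow> arith k G \<Longrightarrow> arith k (\<lambda>xs. F xs * G xs)"
  unfolding arith_def using arith_on_binop[OF _ _ mul_bounded] by blast

lemma arith_uminus: "arith k F \<Longrightarrow> arith k (\<lambda>xs. - F xs)"
  using arith_diff[OF arith_const[of k 0]] by simp

lemma arith_power2: "arith k F \<Longrightarrow> arith k (\<lambda>xs. (F xs)\<^sup>2)"
  by (simp add: power2_eq_square arith_mult)

lemma arith_on_subset: "arith k F \<Longrightarrow> arith_on k D F"
  unfolding arith_def arith_on_def realizes_def by (simp only: UNIV_I simp_thms) blast

lemma arith_if_zero:
  "arith k H \<Longrightarrow> arith k F \<Longrightarrow> arith k G \<Longrightarrow> arith k (\<lambda>xs. if H xs = 0 then F xs else G xs)"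
  using arith_on_if_zero[of k UNIV H F G] arith_on_subset by (simp add: arith_def)

text \<open>The condition does not depend on the input. It is settled when the program is built, as
  for the distinction by characteristic.\<close>

lemma arith_if: "arith k F \<Longrightarrow> arith k G \<Longrightarrow> arith k (\<lambda>xs. if b then F xs else G xs)"
  by (cases b) simp_all

text \<open>\<open>div_alg\<close> is specified for nonzero divisors only. A preceding zero test
  extends it to the total division of HOL, in which a quotient by 0 is 0.\<close>

lemma arith_divide:
  assumes "arith k F" "arith k G" shows "arith k (\<lambda>xs. F xs / G xs)"
proof -
  have "arith_on k {xs. G xs \<noteq> 0} (\<lambda>xs. F xs / G xs)"
    using assms by (intro arith_on_binop[OF _ _ div_bounded] arith_on_subset) auto
  then have "arith k (\<lambda>xs. if G xs = 0 then 0 else F xs / G xs)"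
    using arith_on_if_zero[of k UNIV G "\<lambda>_. 0"] assms(2) arith_on_const by (simp add: arith_def)
  moreover have "(\<lambda>xs. if G xs = 0 then 0 else F xs / G xs) = (\<lambda>xs. F xs / G xs)" by auto
  ultimately show ?thesis by simp
qed

text \<open>A plain copy is charged by the number of bits, which is not bounded in arithmetic
  complexity. Adding a code of 0 is a field operation and moves the element in both cost models,
  possibly under another code.\<close>

lemma arith_var:
  assumes "i < k" shows "arith k (\<lambda>xs. xs ! i)"
  unfolding arith_def arith_on_def
proof (intro allI impI)
  fix rs :: "nat list" and d
  assume rs: "length rs = k" "\<forall>r\<in>set rs. r < d"
  define z where "z = (SOME w. decode K w = Some 0)"
  have z: "decode K z = Some 0" unfolding z_def using codes_exist by (rule someI_ex)
  obtain Q where Q: "\<And>s r r' d x y. decode K (s r) = Some x \<Longrightarrow> decode K (s r') = Some y \<Longrightarrow>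
       \<exists>n w. exec U (Call (add_alg K) [r, r'] d) s n (s(d := w)) \<and> decode K w = Some (x + y) \<and>
          n \<le> poly Q (\<mu> (s r) + \<mu> (s r')) \<and> \<mu> w \<le> poly Q (\<mu> (s r) + \<mu> (s r'))"
    using add_bounded unfolding bounded_operation_def by blast
  let ?c = "Seq (Call (pushes z) [] d) (Call (add_alg K) [rs ! i, d] d)"
    and ?P = "[:2 + 2 * length z:] + pcompose Q [:\<mu> z, 1:]"
  have i: "rs ! i < d" "i < length rs" using rs assms by auto
  have "realizes rs d UNIV ?c ?P (\<lambda>xs. xs ! i)"
    unfolding realizes_def
  proof (intro allI impI)
    fix s xs assume s: "represents rs s xs"
    let ?N = "regsize rs s"
    obtain n1 where 1: "n1 \<le> 2 + 2 * length z" "exec U (Call (pushes z) [] d) s n1 (s(d := z))"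
      using exec_set_register by blast
    have x: "decode K ((s(d := z)) (rs ! i)) = Some (xs ! i)"
      using s i unfolding represents_def by (metis (no_types, lifting) fun_upd_other length_map less_irrefl nth_map)
    obtain n2 w where 2: "exec U (Call (add_alg K) [rs ! i, d] d) (s(d := z)) n2 (s(d := z, d := w))"
      "decode K w = Some (xs ! i)" "n2 \<le> poly Q (\<mu> (s (rs ! i)) + \<mu> z)" "\<mu> w \<le> poly Q (\<mu> (s (rs ! i)) + \<mu> z)"
      using Q[of "s(d := z)" "rs ! i" "xs ! i" d 0 d] x z i by auto
    have "\<mu> (s (rs ! i)) \<le> ?N"
      unfolding regsize_def using i by (intro member_le_sum_list) auto
    then have "poly Q (\<mu> (s (rs ! i)) + \<mu> z) \<le> poly (pcompose Q [:\<mu> z, 1:]) ?N"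
      by (auto simp: poly_pcompose intro!: poly_mono_nat)
    then have "n1 + n2 \<le> poly ?P ?N" "\<mu> w \<le> poly ?P ?N" using 1 2 by auto
    moreover have "exec U ?c s (n1 + n2) (s(d := w))" using exec.Seq[OF 1(2) 2(1)] by simp
    ultimately show "\<exists>n s'. exec U ?c s n s' \<and> (\<forall>r<d. s' r = s r) \<and> decode K (s' d) = Some (xs ! i) \<and>
        n \<le> poly ?P ?N \<and> \<mu> (s' d) \<le> poly ?P ?N"
      using 2(2) by (intro exI[of _ "n1 + n2"] exI[of _ "s(d := w)"]) auto
  qed
  then show "\<exists>c P. realizes rs d UNIV c P (\<lambda>xs. xs ! i)" by blast
qed

lemma arith_list:
  assumes "\<forall>F\<in>set Fs. arith k F" "length rs = k" "\<forall>r\<in>set rs. r < d"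
  shows "\<exists>c P. realizes_list rs d c P Fs"
  using assms
proof (induction Fs arbitrary: d)
  case Nil
  have "realizes_list rs d Skip [:1:] []"
    unfolding realizes_list_def by (auto intro!: exec.Skip exI[of _ 1])
  then show ?case by blast
next
  case (Cons F Fs)
  have F: "arith_on k UNIV F" using Cons.prems(1) by (simp add: arith_def)
  obtain c1 P1 where "realizes rs d UNIV c1 P1 F" by (rule arith_onE[OF F Cons.prems(2,3)])
  note c1 = realizesD[OF this _ UNIV_I]
  have rs': "\<forall>r\<in>set rs. r < d + 1" using Cons.prems by auto
  obtain c2 P2 where c2: "realizes_list rs (d + 1) c2 P2 Fs"
    using Cons.IH[OF _ Cons.prems(2) rs'] Cons.prems(1) by auto
  show ?case
    unfolding realizes_list_def
  proof (intro exI[of _ "Seq c1 c2"] exI[of _ "P1 + P2"] allI impI)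
    fix s xs assume s: "represents rs s xs"
    let ?N = "regsize rs s"
    obtain n1 s1 where 1: "exec U c1 s n1 s1" "\<forall>r<d. s1 r = s r" "decode K (s1 d) = Some (F xs)"
      "n1 \<le> poly P1 ?N" "\<mu> (s1 d) \<le> poly P1 ?N" using c1[OF s] by blast
    note same = represents_cong[OF 1(2) Cons.prems(3)]
    obtain n2 s2 where 2: "exec U c2 s1 n2 s2" "\<forall>r<d + 1. s2 r = s1 r"
      "\<forall>j<length Fs. decode K (s2 (d + 1 + j)) = Some ((Fs ! j) xs) \<and> \<mu> (s2 (d + 1 + j)) \<le> poly P2 ?N"
      "n2 \<le> poly P2 ?N" using c2[unfolded realizes_list_def, rule_format, of s1 xs] s same by auto
    have "decode K (s2 (d + j)) = Some (((F # Fs) ! j) xs) \<and> \<mu> (s2 (d + j)) \<le> poly (P1 + P2) ?N"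
      if "j < length (F # Fs)" for j
    proof (cases j)
      case 0
      then show ?thesis using 1 2(2) by simp
    next
      case (Suc i)
      then have "i < length Fs" using that by simp
      then show ?thesis using 2(3) Suc by fastforce
    qed
    moreover have "exec U (Seq c1 c2) s (n1 + n2) s2" using 1(1) 2(1) by (rule exec.Seq)
    moreover have "\<forall>r<d. s2 r = s r" using 1(2) 2(2) by simp
    moreover have "n1 + n2 \<le> poly (P1 + P2) ?N" using 1(4) 2(4) by simp
    ultimately show "\<exists>n s'. exec U (Seq c1 c2) s n s' \<and> (\<forall>r<d. s' r = s r) \<and>
       (\<forall>j<length (F # Fs). decode K (s' (d + j)) = Some (((F # Fs) ! j) xs) \<and> \<mu> (s' (d + j)) \<le> poly (P1 + P2) ?N) \<and>
       n \<le> poly (P1 + P2) ?N" by blast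
  qed
qed

lemma exec_copy_block: "\<exists>c P. copies m d l c P"
proof (induction m)
  case 0
  have "copies 0 d l Skip [:1:]"
    unfolding copies_def by (auto intro!: exec.Skip exI[of _ 1])
  then show ?case by blast
next
  case (Suc m)
  obtain c P where c: "copies m d l c P" using Suc.IH by blast
  obtain z where z: "decode K z = Some 0" using codes_exist by blast
  obtain Q where Q: "\<And>s r r' d x y. decode K (s r) = Some x \<Longrightarrow> decode K (s r') = Some y \<Longrightarrow>
       \<exists>n w. exec U (Call (add_alg K) [r, r'] d) s n (s(d := w)) \<and> decode K w = Some (x + y) \<and>
          n \<le> poly Q (\<mu> (s r) + \<mu> (s r')) \<and> \<mu> w \<le> poly Q (\<mu> (s r) + \<mu> (s r'))"
    using add_bounded unfolding bounded_operation_def by blast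
  let ?c = "Seq c (Seq (Call (pushes z) [] (l + m)) (Call (add_alg K) [d + m, l + m] (l + m)))"
    and ?P = "P + ([:2 + 2 * length z:] + pcompose Q [:\<mu> z, 1:])"
  show ?case
    unfolding copies_def
  proof (intro exI[of _ ?c] exI[of _ ?P] allI impI)
    fix s :: state and xs M
    assume xs: "length xs = Suc m" and s: "\<forall>j<Suc m. decode K (s (d + j)) = Some (xs ! j) \<and> \<mu> (s (d + j)) \<le> M"
      and l: "l + Suc m \<le> d"
    obtain n s' where 1: "exec U c s n s'" "\<forall>j<m. decode K (s' (l + j)) = Some (xs ! j)"
        "\<forall>r. r < l \<or> l + m \<le> r \<longrightarrow> s' r = s r" "n \<le> poly P M"
      using c[unfolded copies_def, rule_format, of "butlast xs" s M] xs s l by (auto simp: nth_butlast)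
    obtain k where 2: "k \<le> 2 + 2 * length z" "exec U (Call (pushes z) [] (l + m)) s' k (s'(l + m := z))"
      using exec_set_register by blast
    have same: "(s'(l + m := z)) (d + m) = s (d + m)" using 1(3) l by auto
    obtain i w where 3: "exec U (Call (add_alg K) [d + m, l + m] (l + m)) (s'(l + m := z)) i (s'(l + m := z, l + m := w))"
      "decode K w = Some (xs ! m)" "i \<le> poly Q (\<mu> (s (d + m)) + \<mu> z)"
      using Q[of "s'(l + m := z)" "d + m" "xs ! m" "l + m" 0 "l + m"] s z same by auto
    have "poly Q (\<mu> (s (d + m)) + \<mu> z) \<le> poly (pcompose Q [:\<mu> z, 1:]) M"
      using s by (auto simp: poly_pcompose intro!: poly_mono_nat)
    then have "n + (k + i) \<le> poly ?P M" using 1(4) 2(1) 3(3) by auto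
    moreover have "exec U ?c s (n + (k + i)) (s'(l + m := w))"
      using exec.Seq[OF 1(1) exec.Seq[OF 2(2) 3(1)]] by simp
    moreover have "\<forall>j<Suc m. decode K ((s'(l + m := w)) (l + j)) = Some (xs ! j)"
      using 1(2) 3(2) by (auto simp: less_Suc_eq)
    moreover have "\<forall>r. r < l \<or> l + Suc m \<le> r \<longrightarrow> (s'(l + m := w)) r = s r" using 1(3) by auto
    ultimately show "\<exists>n s'. exec U ?c s n s' \<and> (\<forall>j<Suc m. decode K (s' (l + j)) = Some (xs ! j)) \<and>
        (\<forall>r. r < l \<or> l + Suc m \<le> r \<longrightarrow> s' r = s r) \<and> n \<le> poly ?P M" by blast
  qed
qed

text \<open>The output registers may overlap the inputs, and every expression reads all inputs. So
  the values are first computed in a block above everything and then moved down.\<close>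

lemma exec_arith_list:
  assumes "\<forall>F\<in>set Fs. arith k F" "length rs = k"
  shows "\<exists>c P. emits rs l c P Fs"
proof -
  \<comment> \<open>The sum of the input registers is a crude bound for each of them; the remaining
    summands keep the target block below the computed one.\<close>
  define d where "d = Suc (sum_list rs) + l + length Fs"
  have d: "\<forall>r\<in>set rs. r < d" using member_le_sum_list[of _ rs] by (fastforce simp: d_def)
  obtain c1 P1 where c1: "realizes_list rs d c1 P1 Fs" using arith_list[OF assms d] by blast
  obtain c2 P2 where c2: "copies (length Fs) d l c2 P2" using exec_copy_block by blast
  show ?thesis
    unfolding emits_def
  proof (intro exI[of _ "Seq c1 c2"] exI[of _ "P1 + pcompose P2 P1"] allI impI)
    fix s xs assume s: "represents rs s xs"
    let ?N = "regsize rs s"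
    obtain n1 s1 where 1: "exec U c1 s n1 s1" "\<forall>j<length Fs. decode K (s1 (d + j)) = Some ((Fs ! j) xs) \<and>
      \<mu> (s1 (d + j)) \<le> poly P1 ?N" "n1 \<le> poly P1 ?N" using c1 s unfolding realizes_list_def by blast
    obtain n2 s2 where 2: "exec U c2 s1 n2 s2" "\<forall>j<length Fs. decode K (s2 (l + j)) = Some ((Fs ! j) xs)"
      "n2 \<le> poly P2 (poly P1 ?N)"
      using c2[unfolded copies_def, rule_format, of "map (\<lambda>F. F xs) Fs" s1 "poly P1 ?N"] 1(2) by (auto simp: d_def)
    have "exec U (Seq c1 c2) s (n1 + n2) s2" using 1(1) 2(1) by (rule exec.Seq)
    moreover have "n1 + n2 \<le> poly (P1 + pcompose P2 P1) ?N" using 1(3) 2(3) by (simp add: poly_pcompose)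
    ultimately show "\<exists>n s'. exec U (Seq c1 c2) s n s' \<and> (\<forall>j<length Fs. decode K (s' (l + j)) = Some ((Fs ! j) xs)) \<and>
       n \<le> poly (P1 + pcompose P2 P1) ?N" using 2(2) by blast
  qed
qed

section \<open>Programs on coded instances and coded answers\<close>

definition len :: "bits list \<Rightarrow> nat" where
  "len ws = sum_list (map \<mu> ws)"

lemma codes_iff: "codes K ws xs \<longleftrightarrow> map (decode K) ws = map Some xs"
  by (auto simp: codes_def list_all2_conv_all_nth list_eq_iff_nth_eq)

lemma represents_load:
  assumes "codes K ws xs" "length pre = i"
  shows "represents [i..<i + length ws] (load (pre @ ws @ post)) xs"
    and "regsize [i..<i + length ws] (load (pre @ ws @ post)) = len ws"
proof -
  have loaded: "map (load (pre @ ws @ post)) [i..<i + length ws] = ws"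
    using assms(2) by (intro nth_equalityI) (auto simp: load_def nth_append)
  have m: "map (\<lambda>r. f (load (pre @ ws @ post) r)) [i..<i + length ws] = map f ws" for f :: "bits \<Rightarrow> 'z"
  proof -
    have "map (\<lambda>r. f (load (pre @ ws @ post) r)) [i..<i + length ws] =
        map f (map (load (pre @ ws @ post)) [i..<i + length ws])" by simp
    then show ?thesis by (simp only: loaded)
  qed
  show "represents [i..<i + length ws] (load (pre @ ws @ post)) xs"
    using assms(1) by (simp add: represents_def m codes_iff)
  show "regsize [i..<i + length ws] (load (pre @ ws @ post)) = len ws"
    by (simp add: regsize_def m len_def)
qed

lemma codes_of_registers:
  assumes "\<forall>j<length Fs. decode K (s (l + j)) = Some ((Fs ! j) xs)"
  shows "codes K (map s [l..<l + length Fs]) (map (\<lambda>F. F xs) Fs)"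
  using assms by (simp add: codes_def list_all2_conv_all_nth)

lemma outputs_arith:
  assumes "\<forall>F\<in>set Fs. arith k F"
  shows "\<exists>p (P::nat poly). \<forall>ws xs. codes K ws xs \<longrightarrow> length xs = k \<longrightarrow>
     (\<exists>n zs. outputs U p ws n zs \<and> codes K zs (map (\<lambda>F. F xs) Fs) \<and> n \<le> poly P (len ws))"
proof -
  obtain c P where c: "emits [0..<k] 0 c P Fs" using exec_arith_list[OF assms, of "[0..<k]" 0] by auto
  show ?thesis
  proof (intro exI[of _ c] exI[of _ P] allI impI)
    fix ws and xs assume ws: "codes K ws xs" "length xs = k"
    then have k: "length ws = k" by (simp add: codes_def list_all2_lengthD)
    note r = represents_load[OF ws(1), of "[]" 0 "[]", simplified, unfolded k]
    obtain n s' where n: "exec U c (load ws) n s'" "\<forall>j<length Fs. decode K (s' (0 + j)) = Some ((Fs ! j) xs)"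
       "n \<le> poly P (len ws)"
      using c[unfolded emits_def, rule_format, OF r(1)] r(2) by auto
    then have "outputs U c ws n (map s' [0..<0 + length Fs])" by (auto simp: outputs_def)
    then show "\<exists>n zs. outputs U c ws n zs \<and> codes K zs (map (\<lambda>F. F xs) Fs) \<and> n \<le> poly P (len ws)"
      using codes_of_registers[OF n(2)] n(3) by blast
  qed
qed

text \<open>The input consists of the instance in registers below \<open>k\<close>, the flag of the
  answer in register \<open>k\<close>, and the data of a positive answer behind it. Results are
  emitted from register 1 on, and register 0 receives the flag only afterwards, because it still
  holds an input.\<close>

lemma outputs_arith_answer:
  assumes "\<forall>F\<in>set Fs. arith (k + m) F"
  shows "\<exists>q (P::nat poly). \<forall>ws xs. codes K ws xs \<longrightarrow> length xs = k \<longrightarrow>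
     (\<forall>us ys. codes K us ys \<longrightarrow> length ys = m \<longrightarrow>
        (\<exists>n zs. outputs U q (ws @ [True] # us) n ([True] # zs) \<and> codes K zs (map (\<lambda>F. F (xs @ ys)) Fs) \<and>
           n \<le> poly P (len (ws @ [True] # us)))) \<and>
     (\<exists>n. outputs U q (ws @ [[False]]) n [[False]] \<and> n \<le> poly P (len (ws @ [[False]])))"
proof -
  let ?rs = "[0..<k] @ [k + 1..<k + 1 + m]"
  have "length ?rs = k + m" by simp
  then obtain c P where c: "emits ?rs 1 c P Fs" using exec_arith_list[OF assms] by metis
  let ?set = "\<lambda>b. Call (pushes [b]) [] 0"
  let ?q = "Branch k (Seq c (?set True)) (?set False) Skip"
  show ?thesis
  \<comment> \<open>Writing the one-bit flag takes at most 4 steps, and the branch adds one.\<close>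
  proof (intro exI[of _ ?q] exI[of _ "P + [:5:]"] allI impI conjI)
    fix ws and xs us and ys :: "'f list" assume ws: "codes K ws xs" "length xs = k"
      and us: "codes K us ys" "length ys = m"
    have k: "length ws = k" "length us = m" using ws us by (simp_all add: codes_def list_all2_lengthD)
    let ?i = "ws @ [True] # us"
    note r = represents_load[OF ws(1), of "[]" 0 "[True] # us", simplified, unfolded k]
      and r' = represents_load[OF us(1), of "ws @ [[True]]" "k + 1" "[]", simplified, unfolded k]
    have rep: "represents ?rs (load ?i) (xs @ ys)" "regsize ?rs (load ?i) = len ws + len us"
      using r r' k by (simp_all add: represents_def regsize_def)
    obtain n s' where n: "exec U c (load ?i) n s'"
        "\<forall>j<length Fs. decode K (s' (1 + j)) = Some ((Fs ! j) (xs @ ys))" "n \<le> poly P (len ws + len us)"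
      using c[unfolded emits_def, rule_format, OF rep(1)] rep(2) by auto
    obtain i where i: "i \<le> 2 + 2 * length [True]" "exec U (?set True) s' i (s'(0 := [True]))"
      using exec_set_register by blast
    have "load ?i k = True # []" using k by (simp add: load_def nth_append)
    then have "exec U ?q (load ?i) (1 + (n + i)) (s'(0 := [True]))"
      using n(1) i(2) by (intro exec.Branch_True exec.Seq)
    moreover have "([True] # map s' [1..<1 + length Fs]) ! j = (s'(0 := [True])) j"
      if "j < length ([True] # map s' [1..<1 + length Fs])" for j
      using that by (cases j) (auto simp del: upt_Suc)
    ultimately have "outputs U ?q ?i (1 + (n + i)) ([True] # map s' [1..<1 + length Fs])"
      unfolding outputs_def by metis
    moreover have "poly P (len ws + len us) \<le> poly P (len ?i)"
      by (rule poly_mono_nat) (simp add: len_def)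
    then have "1 + (n + i) \<le> poly (P + [:5:]) (len ?i)" using n(3) i(1) by simp
    ultimately show "\<exists>n zs. outputs U ?q ?i n ([True] # zs) \<and> codes K zs (map (\<lambda>F. F (xs @ ys)) Fs) \<and>
           n \<le> poly (P + [:5:]) (len ?i)"
      using codes_of_registers[OF n(2)] by blast
  next
    fix ws and xs :: "'f list" assume ws: "codes K ws xs" "length xs = k"
    have k: "length ws = k" using ws by (simp add: codes_def list_all2_lengthD)
    let ?i = "ws @ [[False]]"
    obtain i where i: "i \<le> 2 + 2 * length [False]" "exec U (?set False) (load ?i) i ((load ?i)(0 := [False]))"
      using exec_set_register by blast
    have "load ?i k = False # []" using k by (simp add: load_def nth_append)
    then have "exec U ?q (load ?i) (1 + i) ((load ?i)(0 := [False]))"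
      using i(2) by (intro exec.Branch_False)
    then have "outputs U ?q ?i (1 + i) [[False]]" by (auto simp: outputs_def)
    then show "\<exists>n. outputs U ?q ?i n [[False]] \<and> n \<le> poly (P + [:5:]) (len ?i)"
      using i(1) by (intro exI[of _ "1 + i"]) auto
  qed
qed

end

section \<open>Bit complexity and arithmetic complexity as instances\<close>

lemma cost_model_bit:
  assumes K: "computable_field K" and poly: "poly_time_field K"
  shows "cost_model {} length K"
proof -
  obtain P where P: "\<And>u v x y. decode K u = Some x \<Longrightarrow> decode K v = Some y \<Longrightarrow>
       (\<forall>p \<in> {add_alg K, sub_alg K, mul_alg K} \<union> (if y \<noteq> 0 then {div_alg K} else {}).
          \<exists>n s. exec {} p (load [u, v]) n s \<and> n \<le> poly P (bit_size [u, v])) \<and>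
       (\<exists>n s. exec {} (zero_alg K) (load [u]) n s \<and> n \<le> poly P (bit_size [u]))"
    using poly unfolding poly_time_field_def by metis
  have out: "length (s' 0) \<le> bit_size ws + n" if "exec {} p (load ws) n s'" for p ws n s'
  proof -
    have "length (load ws 0) \<le> bit_size ws"
      by (cases ws) (simp_all add: load_def bit_size_def)
    then show ?thesis using exec_length[OF that refl, of 0] by linarith
  qed
  have bound: "bounded_operation {} length K p D f" if op: "computes_op K p D f"
    and time: "\<And>u v x y. decode K u = Some x \<Longrightarrow> decode K v = Some y \<Longrightarrow> y \<in> D \<Longrightarrow>
      \<exists>n s. exec {} p (load [u, v]) n s \<and> n \<le> poly P (bit_size [u, v])" for p D f
    unfolding bounded_operation_def
  \<comment> \<open>A call costs 1, the running time \<open>n\<close>, the size of the arguments,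
    and the length of the result, which is at most that size plus \<open>n\<close>.\<close>
  proof (intro exI[of _ "[:1, 2:] + P + P"] allI impI)
    fix s :: state and r r' d x y
    assume xy: "decode K (s r) = Some x" "decode K (s r') = Some y" "y \<in> D"
    obtain n t where n: "exec {} p (load [s r, s r']) n t" "n \<le> poly P (bit_size [s r, s r'])"
      using time[OF xy] by blast
    obtain k w where w: "outputs {} p [s r, s r'] k [w]" "decode K w = Some (f x y)"
      using op xy unfolding computes_op_def by blast
    \<comment> \<open>The run with the correct result and the run with the time bound are given
      separately; determinism identifies them.\<close>
    then have t: "t 0 = w" using n(1) exec_deterministic by (fastforce simp: outputs_def)
    have "exec {} (Call p [r, r'] d) s (1 + n + bit_size [s r, s r'] + length (t 0)) (s(d := t 0))"
      using exec.Call[of "{}" p s "[r, r']" n t d] n(1) by simp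
    moreover have "length (t 0) \<le> bit_size [s r, s r'] + n" by (rule out[OF n(1)])
    ultimately show "\<exists>n w. exec {} (Call p [r, r'] d) s n (s(d := w)) \<and> decode K w = Some (f x y) \<and>
          n \<le> poly ([:1, 2:] + P + P) (length (s r) + length (s r')) \<and>
          length w \<le> poly ([:1, 2:] + P + P) (length (s r) + length (s r'))"
      using n(2) w(2) t by (intro exI[of _ "1 + n + bit_size [s r, s r'] + length (t 0)"] exI[of _ w])
        (auto simp: bit_size_def)
  qed
  show ?thesis
  proof
    show "\<exists>w. decode K w = Some x" for x using K by (simp add: computable_field_def)
    have ops: "computes_op K (add_alg K) UNIV (+)" "computes_op K (sub_alg K) UNIV (-)"
      "computes_op K (mul_alg K) UNIV (*)" "computes_op K (div_alg K) (- {0}) (/)"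
      using K by (simp_all add: computable_field_def)
    have time: "\<exists>n s. exec {} p (load [u, v]) n s \<and> n \<le> poly P (bit_size [u, v])"
      if "decode K u = Some x" "decode K v = Some y"
        "p \<in> {add_alg K, sub_alg K, mul_alg K} \<union> (if y \<noteq> 0 then {div_alg K} else {})" for p u v x y
      using P[OF that(1,2)] that(3) by blast
    show "bounded_operation {} length K (add_alg K) UNIV (+)"
      by (rule bound[OF ops(1)], rule time, assumption+, simp)
    show "bounded_operation {} length K (sub_alg K) UNIV (-)"
      by (rule bound[OF ops(2)], rule time, assumption+, simp)
    show "bounded_operation {} length K (mul_alg K) UNIV (*)"
      by (rule bound[OF ops(3)], rule time, assumption+, simp)
    show "bounded_operation {} length K (div_alg K) (- {0}) (/)"
      by (rule bound[OF ops(4)], rule time, assumption+, simp)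
    show "\<exists>P::nat poly. \<forall>s r d x. decode K (s r) = Some x \<longrightarrow>
      (\<exists>n. exec {} (Call (zero_alg K) [r] d) s n (s(d := [x = 0])) \<and> n \<le> poly P (length (s r)))"
    proof (intro exI[of _ "[:2, 1:] + P"] allI impI)
      fix s :: state and r d x assume x: "decode K (s r) = Some x"
      obtain n t where n: "exec {} (zero_alg K) (load [s r]) n t" "n \<le> poly P (bit_size [s r])"
        using P[OF x x] by blast
      obtain k where k: "outputs {} (zero_alg K) [s r] k [[x = 0]]"
        using K x unfolding computable_field_def by blast
      then have t: "t 0 = [x = 0]" using n(1) exec_deterministic by (fastforce simp: outputs_def)
      have "exec {} (Call (zero_alg K) [r] d) s (1 + n + bit_size [s r] + length (t 0)) (s(d := t 0))"
        using exec.Call[of "{}" "zero_alg K" s "[r]" n t d] n(1) by simp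
      then show "\<exists>n. exec {} (Call (zero_alg K) [r] d) s n (s(d := [x = 0])) \<and> n \<le> poly ([:2, 1:] + P) (length (s r))"
        using n(2) t by (intro exI[of _ "1 + n + bit_size [s r] + length (t 0)"]) (auto simp: bit_size_def)
    qed
  qed
qed

lemma cost_model_arithmetic:
  assumes K: "computable_field K"
  shows "cost_model (field_algorithms K) (\<lambda>_. 1) K"
proof -
  let ?U = "field_algorithms K"
  \<comment> \<open>The callee may take any time of its own; a terminating run is enough, as the
    call is charged one step.\<close>
  have call: "exec ?U (Call p rs d) s 1 (s(d := t 0))" if pU: "exec {} p (load (map s rs)) n t" "p \<in> ?U"
    for p rs d s n t
  proof -
    obtain m where "exec ?U p (load (map s rs)) m t" using exec_cost_model[OF pU(1)] by blast
    from exec.Call[OF this, of d] pU(2) show ?thesis by simp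
  qed
  have bound: "bounded_operation ?U (\<lambda>_. 1) K p D f" if op: "computes_op K p D f" "p \<in> ?U" for p D f
    unfolding bounded_operation_def
  proof (intro exI[of _ "[:1:]"] allI impI)
    fix s :: state and r r' d x y
    assume xy: "decode K (s r) = Some x" "decode K (s r') = Some y" "y \<in> D"
    obtain k w where w: "outputs {} p [s r, s r'] k [w]" "decode K w = Some (f x y)"
      using op(1) xy unfolding computes_op_def by blast
    then obtain t where "exec {} p (load (map s [r, r'])) k t" "t 0 = w" by (auto simp: outputs_def)
    then have "exec ?U (Call p [r, r'] d) s 1 (s(d := w))" using call op(2) by metis
    then show "\<exists>n w. exec ?U (Call p [r, r'] d) s n (s(d := w)) \<and> decode K w = Some (f x y) \<and>
          n \<le> poly [:1:] (1 + 1) \<and> 1 \<le> poly [:1::nat:] (1 + 1)"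
      using w(2) by (intro exI[of _ 1] exI[of _ w]) simp
  qed
  show ?thesis
  proof
    show "\<exists>w. decode K w = Some x" for x using K by (simp add: computable_field_def)
    show "bounded_operation ?U (\<lambda>_. 1) K (add_alg K) UNIV (+)" "bounded_operation ?U (\<lambda>_. 1) K (sub_alg K) UNIV (-)"
      "bounded_operation ?U (\<lambda>_. 1) K (mul_alg K) UNIV (*)" "bounded_operation ?U (\<lambda>_. 1) K (div_alg K) (- {0}) (/)"
      using K by (intro bound; simp add: computable_field_def field_algorithms_def)+
    show "\<exists>P::nat poly. \<forall>s r d x. decode K (s r) = Some x \<longrightarrow>
      (\<exists>n. exec ?U (Call (zero_alg K) [r] d) s n (s(d := [x = 0])) \<and> n \<le> poly P 1)"
    proof (intro exI[of _ "[:1:]"] allI impI)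
      fix s :: state and r d x assume x: "decode K (s r) = Some x"
      obtain k where "outputs {} (zero_alg K) [s r] k [[x = 0]]"
        using K x unfolding computable_field_def by blast
      then obtain t where "exec {} (zero_alg K) (load (map s [r])) k t" "t 0 = [x = 0]" by (auto simp: outputs_def)
      then have "exec ?U (Call (zero_alg K) [r] d) s 1 (s(d := [x = 0]))"
        using call by (metis field_algorithms_def insertCI)
      then show "\<exists>n. exec ?U (Call (zero_alg K) [r] d) s n (s(d := [x = 0])) \<and> n \<le> poly [:1:] 1" by auto
    qed
  qed
qed

section \<open>Splittings and rational points\<close>

lemma vec2_eq_iff: "M = N \<longleftrightarrow> M $ 1 $ 1 = N $ 1 $ 1 \<and> M $ 1 $ 2 = N $ 1 $ 2 \<and> M $ 2 $ 1 = N $ 2 $ 1 \<and> M $ 2 $ 2 = N $ 2 $ (2::2)"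
  for M N :: "'a ^ 2 ^ 2"
  by (simp add: vec_eq_iff forall_2)

definition mat2 :: "'f \<Rightarrow> 'f \<Rightarrow> 'f \<Rightarrow> 'f \<Rightarrow> 'f ^ 2 ^ 2" where
  "mat2 p q r s = (\<chi> i j. if i = 1 then if j = 1 then p else q else if j = 1 then r else s)"

lemma mat2_nth [simp]:
  "mat2 p q r s $ 1 $ 1 = p" "mat2 p q r s $ 1 $ 2 = q" "mat2 p q r s $ 2 $ 1 = r" "mat2 p q r s $ 2 $ 2 = s"
  by (simp_all add: mat2_def)

lemma matrix_mult_2_nth:
  fixes M N :: "'f::field ^ 2 ^ 2"
  shows "(M ** N) $ i $ j = M $ i $ 1 * N $ 1 $ j + M $ i $ 2 * N $ 2 $ j"
  by (simp add: matrix_matrix_mult_def sum_2)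

lemma matrix_scale_nth [simp]: "matrix_scale c M $ i $ j = c * M $ i $ j"
  by (simp add: matrix_scale_def)

lemma vector_space_matrix_scale: "vector_space matrix_scale"
  by unfold_locales (simp_all add: vec_eq_iff algebra_simps)

text \<open>With \<open>e\<close> and \<open>f\<close> in the roles of \<open>E_12\<close> and
  \<open>E_21\<close>, the products \<open>e f\<close> and \<open>f e\<close> are the idempotents
  \<open>E_11\<close> and \<open>E_22\<close>.\<close>

definition (in unital_algebra) matrix_units :: "'b \<Rightarrow> 'b \<Rightarrow> 'f ^ 2 ^ 2 \<Rightarrow> 'b" where
  "matrix_units e f M = scale (M $ 1 $ 1) (mult e f) + scale (M $ 1 $ 2) e + scale (M $ 2 $ 1) f +
     scale (M $ 2 $ 2) (mult f e)"

lemma (in unital_algebra) matrix_units_mult: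
  assumes ef: "mult e e = 0" "mult f f = 0" "mult e f + mult f e = one"
  shows "matrix_units e f (M ** N) = mult (matrix_units e f M) (matrix_units e f N)"
    and "mult e (mult f e) = e" and "mult f (mult e f) = f"
proof -
  have r: "mult e (mult e v) = 0" "mult f (mult f v) = 0" for v
    using ef by (simp_all flip: mult_assoc)
  have "mult e (mult e f + mult f e) = e" "mult f (mult e f + mult f e) = f"
    by (simp_all add: ef one_right)
  then show efe: "mult e (mult f e) = e" and fef: "mult f (mult e f) = f"
    by (simp_all add: mult_add_right r)
  have r': "mult e (mult f (mult e v)) = mult e v" "mult f (mult e (mult f v)) = mult f v" for v
    using efe fef by (metis mult_assoc)+
  show "matrix_units e f (M ** N) = mult (matrix_units e f M) (matrix_units e f N)"
    unfolding matrix_units_def matrix_mult_2_nth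
    by (simp add: mult_add_left mult_add_right mult_scale_left mult_scale_right mult_assoc ef r r' efe fef
        scale_distribs mult.commute add_ac)
qed

text \<open>The inverse of \<open>matrix_units\<close>: the matrix entry at position (k, l) is the
  reduced trace of \<open>x\<close> times \<open>E_lk\<close>. The trace form thus replaces the
  solution of a linear system.\<close>

definition split_map :: "'f::field \<Rightarrow> 'f \<Rightarrow> 'f ^ 4 \<Rightarrow> 'f ^ 4 \<Rightarrow> 'f ^ 4 \<Rightarrow> 'f ^ 2 ^ 2" where
  "split_map a b e f x = (let T = \<lambda>y. quat_trd (quat_mult a b x y)
     in mat2 (T (quat_mult a b e f)) (T f) (T e) (T (quat_mult a b f e)))"

lemma splitting_split_map:
  fixes a b :: "'f::field"
  defines "m \<equiv> quat_mult a b"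
  assumes ef: "m e e = 0" "m f f = 0" "m e f + m f e = quat_one"
    and tr: "quat_trd e = 0" "quat_trd f = 0" "quat_trd (m e f) = 1"
  shows "splitting a b (split_map a b e f)"
proof -
  let ?\<phi> = "split_map a b e f" and ?\<psi> = "quat.matrix_units a b e f"
  note mu = quat.matrix_units_mult[OF ef[unfolded m_def]]
  have tr': "quat_trd (m f e) = 1" using tr(3) quat_trd_mult_commute unfolding m_def by metis
  have r: "m e (m e v) = 0" "m f (m f v) = 0" for v
    using ef(1,2) unfolding m_def by (simp_all flip: quat.mult_assoc)
  have r': "m e (m f (m e v)) = m e v" "m f (m e (m f v)) = m f v" for v
    using mu(2,3) unfolding m_def by (metis quat.mult_assoc)+
  have \<phi>: "?\<phi> x = mat2 (quat_trd (m x (m e f))) (quat_trd (m x f)) (quat_trd (m x e)) (quat_trd (m x (m f e)))" for x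
    by (simp add: split_map_def Let_def m_def)
  have \<psi>: "?\<psi> M = M $ 1 $ 1 *s m e f + M $ 1 $ 2 *s e + M $ 2 $ 1 *s f + M $ 2 $ 2 *s m f e" for M
    by (simp add: quat.matrix_units_def m_def)
  have lin: "m (x + y) z = m x z + m y z" "m (c *s x) z = c *s m x z" "m (m x y) z = m x (m y z)" for x y z c
    by (simp_all add: m_def quat.mult_simps)
  have z: "m e 0 = 0" "m f 0 = 0" "quat_trd (0 :: 'f ^ 4) = 0" by (simp_all add: m_def quat_trd_def)
  have \<phi>\<psi>: "?\<phi> (?\<psi> M) = M" for M
    unfolding \<phi> \<psi>
    by (simp add: vec2_eq_iff lin quat_trd_linear r r' ef tr tr' z mu(2,3)[folded m_def])
  have add: "?\<phi> (x + y) = ?\<phi> x + ?\<phi> y" and scl: "?\<phi> (c *s x) = matrix_scale c (?\<phi> x)" for x y c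
    unfolding \<phi> m_def
    by (simp_all add: vec2_eq_iff quat.mult_add_left quat.mult_scale_left quat_trd_linear)
  have \<psi>lin: "?\<psi> (M + N) = ?\<psi> M + ?\<psi> N" "?\<psi> (matrix_scale c M) = c *s ?\<psi> M" for M N c
    by (simp_all add: quat.matrix_units_def vec4_eq_iff algebra_simps)
  \<comment> \<open>Reading a matrix as a vector of length 4 makes \<open>?\<psi>\<close> an
    endomorphism, for which injectivity implies surjectivity.\<close>
  let ?\<chi> = "\<lambda>v :: 'f ^ 4. ?\<psi> (mat2 (v $ 1) (v $ 2) (v $ 3) (v $ 4))"
  have "Vector_Spaces.linear (*s) (*s) ?\<chi>"
    by (simp add: Vector_Spaces.linear_iff vec.vector_space_axioms quat.matrix_units_def vec4_eq_iff algebra_simps)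
  moreover have "inj ?\<chi>"
  proof (rule injI)
    fix v w assume "?\<chi> v = ?\<chi> w"
    then have "?\<phi> (?\<chi> v) = ?\<phi> (?\<chi> w)" by simp
    then show "v = w" unfolding \<phi>\<psi> by (simp add: vec2_eq_iff vec4_eq_iff)
  qed
  ultimately have "surj ?\<chi>" by (rule vec.linear_inj_imp_surj)
  then have surj: "\<exists>M. x = ?\<psi> M" for x unfolding surj_def by blast
  have "?\<phi> (m x y) = ?\<phi> x ** ?\<phi> y" for x y
  proof -
    obtain M N where "x = ?\<psi> M" "y = ?\<psi> N" using surj by metis
    then show ?thesis using mu(1)[of M N] \<phi>\<psi> by (simp add: m_def flip: mu(1))
  qed
  moreover have "?\<phi> quat_one = mat 1"
  proof -
    have "?\<psi> (mat 1) = quat_one"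
      using ef(3) by (simp add: quat.matrix_units_def mat_def m_def)
    then show ?thesis using \<phi>\<psi> by metis
  qed
  moreover have "bij ?\<phi>"
    using surj \<phi>\<psi> by (intro bijI injI surjI[where f = ?\<psi>]) metis+
  ultimately show ?thesis
    unfolding splitting_def algebra_iso_def Vector_Spaces.linear_iff
    using add scl vec.vector_space_axioms vector_space_matrix_scale by (simp add: m_def)
qed

text \<open>For \<open>e\<close> of trace zero the basis vector 1 pairs to 0, so nondegeneracy of
  the trace form leaves \<open>i, j, ij\<close>; the first one that pairs nontrivially is
  normalized.\<close>

definition quat_dual :: "'f::field \<Rightarrow> 'f \<Rightarrow> 'f ^ 4 \<Rightarrow> 'f ^ 4" where
  "quat_dual a b e = (let T = \<lambda>k. quat_trd (quat_mult a b e (axis k 1))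
     in if T 2 = 0 then if T 3 = 0 then (1 / T 4) *s axis 4 1 else (1 / T 3) *s axis 3 1
        else (1 / T 2) *s axis 2 1)"

text \<open>
  If \<open>trd (e g) = 1\<close> and \<open>e\<close> has trace and norm 0, then \<open>g + nrd g e\<close> has norm 0, and the factor
  \<open>1 - trd g e\<close> removes its trace without changing \<open>trd (e g)\<close>.
\<close>

definition nilpotent_partner :: "'f::field \<Rightarrow> 'f \<Rightarrow> 'f ^ 4 \<Rightarrow> 'f ^ 4" where
  "nilpotent_partner a b e = (let g = quat_dual a b e
     in quat_mult a b (g + quat_nrd a b g *s e) (quat_one - quat_trd g *s e))"

lemma quat_dual:
  assumes "standard_pair a b" "e \<noteq> 0" "quat_trd e = 0"
  shows "quat_trd (quat_mult a b e (quat_dual a b e)) = 1"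
  using quat_trd_nondegenerate[OF assms(1,2)] assms(3)
  by (auto simp: quat_dual_def Let_def quat.mult_scale_right quat_trd_linear)

lemma quat_nrd_add: "quat_nrd a b (x + y) = quat_nrd a b x + quat_nrd a b y + quat_trd (quat_mult a b x (quat_conj y))"
  by (simp add: quat_nrd_def quat_trd_def quat_mult_nth quat_conj_def algebra_simps power2_eq_square)

lemma quat_nrd_scale: "quat_nrd a b (c *s x) = c\<^sup>2 * quat_nrd a b x"
  by (simp add: quat_nrd_def algebra_simps power2_eq_square)

lemma quat_conj_trace_zero: "quat_trd x = 0 \<Longrightarrow> quat_conj x = - x"
  using quat_add_conj[of x] by (simp add: eq_neg_iff_add_eq_0 add.commute)

lemma quat_trd_mult_one_conj:
  "quat_trd (quat_mult a b x (- y)) = - quat_trd (quat_mult a b x y)"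
  by (simp add: quat.mult_minus_right quat_trd_linear)

lemma splitting_of_point:
  fixes a b :: "'f::field"
  assumes ab: "standard_pair a b" and v: "rational_point (quat_form a b) v"
  shows "splitting a b (split_map a b (quat_pure v) (nilpotent_partner a b (quat_pure v)))"
proof -
  define m e g t n f where "m = quat_mult a b" and "e = quat_pure v" and "g = quat_dual a b e"
    and "t = quat_trd g" and "n = quat_nrd a b g" and "f = nilpotent_partner a b e"
  have e0: "e \<noteq> 0"
    using v unfolding rational_point_def e_def by (metis quat_coords_pure quat_pure_linear(2) vector_smult_lzero)
  have e: "quat_trd e = 0" "quat_nrd a b e = 0"
    using v by (simp_all add: e_def rational_point_def qeval_quat_form)
  have ee: "m e e = 0" using quat_square[of a b e] e by (simp add: m_def)
  have eg: "quat_trd (m e g) = 1" unfolding m_def g_def by (rule quat_dual[OF ab e0 e(1)])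
  then have ge: "quat_trd (m g e) = 1" using quat_trd_mult_commute unfolding m_def by metis
  have f: "f = m (g + n *s e) (quat_one - t *s e)"
    by (simp add: f_def nilpotent_partner_def Let_def m_def n_def t_def g_def)
  then have f': "f = g + n *s e - t *s m g e"
    unfolding m_def by (simp add: quat.mult_distribs quat.one_right ee[unfolded m_def])
  \<comment> \<open>The norm of the sum is \<open>n + n trd(g conj e)\<close>, where conj e = - e
    and trd(g e) = 1.\<close>
  have "quat_nrd a b (g + n *s e) = 0"
    using ge e unfolding m_def
    by (simp add: quat_nrd_add quat_nrd_scale quat_conj_trace_zero quat_trd_linear quat_trd_mult_one_conj
        quat.mult_scale_right flip: n_def)
  then have nf: "quat_nrd a b f = 0" by (simp add: f m_def quat_nrd_mult)
  have tf: "quat_trd f = 0" using e ge by (simp add: f' quat_trd_linear t_def)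
  have ff: "m f f = 0" using quat_square[of a b f] nf tf by (simp add: m_def)
  have "quat_trd (m e (m g e)) = quat_trd (m (m g e) e)" unfolding m_def by (rule quat_trd_mult_commute)
  also have "\<dots> = 0" using ee by (simp add: m_def quat.mult_assoc quat_trd_def)
  finally have tef: "quat_trd (m e f) = 1"
    using eg ee by (simp add: f' m_def quat.mult_add_right quat.mult_diff_right quat.mult_scale_right quat_trd_linear)
  \<comment> \<open>Since \<open>e\<close> and \<open>f\<close> have square 0, the square of
    \<open>e + f\<close> is \<open>e f + f e\<close>. As a trace zero element it also equals minus
    its norm, and that norm is - trd(e f) = - 1.\<close>
  have "m (e + f) (e + f) = - quat_nrd a b (e + f) *s quat_one"
    unfolding m_def quat_square by (simp add: quat_trd_linear e tf)
  moreover have "quat_nrd a b (e + f) = - 1"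
    using tef unfolding m_def by (simp add: quat_nrd_add e nf quat_conj_trace_zero[OF tf] quat_trd_mult_one_conj)
  ultimately have "m e f + m f e = quat_one"
    using ee ff by (simp add: m_def quat.mult_add_left quat.mult_add_right add.commute)
  then show ?thesis
    using splitting_split_map[of a b e f] ee ff e tf tef unfolding m_def e_def f_def by blast
qed

text \<open>The two entries of the first column are linear forms \<open>r 1\<close> and
  \<open>r 2\<close> on the pure quaternions, a space of dimension 3; their cross product is a
  common zero.\<close>

definition splitting_point :: "('f::field ^ 4 \<Rightarrow> 'f ^ 2 ^ 2) \<Rightarrow> 'f ^ 3" where
  "splitting_point \<phi> = (let r = \<lambda>i. vec3 (\<phi> (quat_pure (axis 1 1)) $ i $ 1) (\<phi> (quat_pure (axis 2 1)) $ i $ 1)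
       (\<phi> (quat_pure (axis 3 1)) $ i $ 1) in cross (r 2) (r 1))"

lemma rational_point_of_splitting:
  fixes a b :: "'f::field"
  assumes \<phi>: "splitting a b \<phi>"
  shows "rational_point (quat_form a b) (splitting_point \<phi>)"
proof -
  have bij: "bij \<phi>" and one: "\<phi> quat_one = mat 1"
    and hom: "\<And>x y. \<phi> (quat_mult a b x y) = \<phi> x ** \<phi> y"
    and add: "\<And>x y. \<phi> (x + y) = \<phi> x + \<phi> y" and scl: "\<And>c x. \<phi> (c *s x) = matrix_scale c (\<phi> x)"
    using \<phi> by (auto simp: splitting_def algebra_iso_def Vector_Spaces.linear_iff)
  define r where "r i = vec3 (\<phi> (quat_pure (axis 1 1)) $ i $ 1) (\<phi> (quat_pure (axis 2 1)) $ i $ 1)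
       (\<phi> (quat_pure (axis 3 1)) $ i $ 1)" for i
  define dot where "dot u w = u $ 1 * w $ 1 + u $ 2 * w $ 2 + u $ 3 * w $ 3" for u w :: "'f ^ 3"
  define v where "v = splitting_point \<phi>"
  have v: "v = cross (r 2) (r 1)" by (simp add: v_def splitting_point_def r_def)
  have row: "\<phi> (quat_pure w) $ i $ 1 = dot (r i) w" for w i
  proof -
    have "w = w $ 1 *s axis 1 1 + w $ 2 *s axis 2 1 + w $ 3 *s axis 3 1"
      by (simp add: vec3_eq_iff axis_def)
    then have "\<phi> (quat_pure w) = \<phi> (quat_pure (w $ 1 *s axis 1 1 + w $ 2 *s axis 2 1 + w $ 3 *s axis 3 1))" by simp
    then show ?thesis by (simp add: quat_pure_linear add scl dot_def r_def mult.commute)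
  qed
  have "quat_mult a b x x = quat_trd x *s x + (- quat_nrd a b x) *s quat_one" for x
    by (simp add: quat_square)
  then have square: "\<phi> x ** \<phi> x = matrix_scale (quat_trd x) (\<phi> x) + matrix_scale (- quat_nrd a b x) (mat 1)" for x
    using hom[of x x] by (simp only: add scl one)
  have "\<phi> (quat_pure v) $ 1 $ 1 = 0" "\<phi> (quat_pure v) $ 2 $ 1 = 0"
    by (simp_all add: row v dot_def cross_def algebra_simps)
  \<comment> \<open>For trace zero the square is minus the norm times the identity, so its upper
    left entry determines the norm.\<close>
  then have "(\<phi> (quat_pure v) ** \<phi> (quat_pure v)) $ 1 $ 1 = 0" by (simp add: matrix_mult_2_nth)
  then have "qeval (quat_form a b) v = 0"
    unfolding square by (simp add: mat_def qeval_quat_form)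
  moreover have "v \<noteq> 0"
  proof
    assume v0: "v = 0"
    \<comment> \<open>To see that the two linear forms are independent, pure quaternions with first
      columns (0, 1) and (1, 1) are needed. Nilpotent matrices are taken because the lower left
      entry of the quadratic equation then shows that the preimage has trace zero.\<close>
    have pre: "\<exists>p. \<phi> (quat_pure p) = M" if M: "M ** M = 0" "M $ 2 $ 1 = 1" for M
    proof -
      obtain x where x: "\<phi> x = M" using bij by (metis bij_pointE)
      have "(M ** M) $ 2 $ 1 = quat_trd x" using square[of x] M(2) by (simp add: x mat_def)
      then have "quat_trd x = 0" using M(1) by simp
      then show ?thesis using x quat_pure_coords by metis
    qed
    obtain p where p: "\<phi> (quat_pure p) = mat2 0 0 1 0"
      using pre[of "mat2 0 0 1 0"] by (auto simp: vec2_eq_iff matrix_mult_2_nth)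
    obtain q where q: "\<phi> (quat_pure q) = mat2 1 (- 1) 1 (- 1)"
      using pre[of "mat2 1 (- 1) 1 (- 1)"] by (auto simp: vec2_eq_iff matrix_mult_2_nth)
    have "dot (cross (r 2) (r 1)) (cross p q) = dot (r 2) p * dot (r 1) q - dot (r 2) q * dot (r 1) p"
      by (simp add: dot_def cross_def algebra_simps)
    also have "\<dots> = 1" by (simp add: row[symmetric] p q)
    finally show False using v0 v by (simp add: dot_def)
  qed
  ultimately show ?thesis by (simp add: rational_point_def v_def)
qed

lemma splitting_iff_point:
  "standard_pair a b \<Longrightarrow> (\<exists>\<phi>. splitting a b \<phi>) \<longleftrightarrow> (\<exists>v. rational_point (quat_form a b) v)"
  using splitting_of_point rational_point_of_splitting by blast

lemma rational_point_conic_point: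
  assumes "Q \<in> conics" "conic_pair Q = (a, b)" "rational_point (quat_form a b) p"
  shows "rational_point Q (conic_point Q p)"
  using conic_pair_similar(2)[OF qdisc_conic[OF assms(1)] assms(2)] conic_point_eq_0[OF qdisc_conic[OF assms(1)]] assms(3)
  by (auto simp: rational_point_def)

lemma has_point_iff:
  assumes Q: "Q \<in> conics" and ab: "conic_pair Q = (a, b)"
  shows "(\<exists>v. rational_point Q v) \<longleftrightarrow> (\<exists>\<phi>. splitting a b \<phi>)"
proof -
  note disc = qdisc_conic[OF Q]
  obtain c where c: "c \<noteq> 0" "\<And>p. qeval Q (conic_point Q p) = c * qeval (quat_form a b) p"
    using conic_pair_similar(2)[OF disc ab] by blast
  have "\<exists>p. rational_point (quat_form a b) p" if v: "rational_point Q v" for v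
  proof -
    have "inj (conic_point Q)"
      using conic_point_eq_0[OF disc] by (auto simp: vec.linear_inj_iff_eq_0[OF conic_point_linear])
    then have "surj (conic_point Q)" using conic_point_linear vec.linear_inj_imp_surj by blast
    then obtain p where p: "v = conic_point Q p" by (rule surjE)
    moreover have "conic_point Q 0 = 0" by (rule vec.linear_0[OF conic_point_linear])
    ultimately have "p \<noteq> 0" "qeval (quat_form a b) p = 0"
      using v c by (auto simp: rational_point_def)
    then show ?thesis by (auto simp: rational_point_def)
  qed
  then show ?thesis
    unfolding splitting_iff_point[OF conic_pair_similar(1)[OF disc ab]]
    using rational_point_conic_point[OF Q ab] by blast
qed

text \<open>Projections replace the matching on pairs, so that the closure rules for arithmetic
  functions apply to the shape of the term.\<close>

lemma fst_conic_pair: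
  "fst (conic_pair Q) = (let u = fst (pick_pair Q frame_pairs); v = snd (pick_pair Q frame_pairs)
     in if (2::'f::field) = 0 then qeval Q v * qeval Q u / (qpolar Q u v)\<^sup>2 else - binary_disc Q u v)"
  for Q :: "'f::field qform"
  by (simp add: conic_pair_def Let_def split: prod.split)

lemma snd_conic_pair:
  "snd (conic_pair Q) = (let u = fst (pick_pair Q frame_pairs); v = snd (pick_pair Q frame_pairs)
     in if (2::'f::field) = 0 then qeval Q u / (qdisc Q * (qpolar Q u v)\<^sup>2)
       else - (qdisc Q * binary_disc Q u v / qeval Q u))"
  for Q :: "'f::field qform"
  by (simp add: conic_pair_def Let_def split: prod.split)

lemma conic_point_alt:
  "conic_point Q p = (let u = fst (pick_pair Q frame_pairs); v = snd (pick_pair Q frame_pairs);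
       a = fst (conic_pair Q); b = snd (conic_pair Q); n = qeval Q u; B = qpolar Q u v; w = qnormal Q u v
     in if (2::'f::field) = 0 then p$1 *s w + p$2 *s u + (p$3 * n / B) *s v
        else (a * b * p$3) *s u + (b * p$2) *s ((2 * n) *s v + (- B) *s u) + (a * p$1) *s w)"
  for Q :: "'f::field qform"
  by (simp add: conic_point_def Let_def split: prod.split)

section \<open>The constructions as arithmetic functions\<close>

context cost_model
begin

definition arith_vec :: "nat \<Rightarrow> ('f list \<Rightarrow> 'f ^ 'n) \<Rightarrow> bool" where
  "arith_vec k V \<longleftrightarrow> (\<forall>i. arith k (\<lambda>xs. V xs $ i))"

text \<open>Functions of forms are defined by matching on the tuple, so the six coefficient
  functions are exposed for their equations to be applicable.\<close>

definition arith_form :: "nat \<Rightarrow> ('f list \<Rightarrow> 'f qform) \<Rightarrow> bool" where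
  "arith_form k Q \<longleftrightarrow> (\<exists>a b c d e f. arith k a \<and> arith k b \<and> arith k c \<and> arith k d \<and> arith k e \<and> arith k f \<and>
     Q = (\<lambda>xs. (a xs, b xs, c xs, d xs, e xs, f xs)))"

lemma arith_nth: "arith_vec k V \<Longrightarrow> arith k (\<lambda>xs. V xs $ i)"
  by (simp add: arith_vec_def)

lemmas arith_ops = arith_const arith_var arith_add arith_diff arith_mult arith_uminus arith_power2
  arith_divide arith_if_zero arith_if

lemmas arith_intros = arith_ops arith_nth

lemma arith_vec_intros:
  "arith_vec k (\<lambda>_. v)"
  "arith_vec k V \<Longrightarrow> arith_vec k W \<Longrightarrow> arith_vec k (\<lambda>xs. V xs + W xs)"
  "arith_vec k V \<Longrightarrow> arith_vec k W \<Longrightarrow> arith_vec k (\<lambda>xs. V xs - W xs)"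
  "arith k F \<Longrightarrow> arith_vec k V \<Longrightarrow> arith_vec k (\<lambda>xs. F xs *s V xs)"
  "arith k F \<Longrightarrow> arith_vec k V \<Longrightarrow> arith_vec k W \<Longrightarrow> arith_vec k (\<lambda>xs. if F xs = 0 then V xs else W xs)"
  "arith_vec k V \<Longrightarrow> arith_vec k W \<Longrightarrow> arith_vec k (\<lambda>xs. if c then V xs else W xs)"
  unfolding arith_vec_def by (auto simp: if_distrib[of "\<lambda>v. v $ _"] intro!: arith_ops)

lemma arith_vec3: "arith k F \<Longrightarrow> arith k G \<Longrightarrow> arith k H \<Longrightarrow> arith_vec k (\<lambda>xs. vec3 (F xs) (G xs) (H xs))"
  by (simp add: arith_vec_def forall_3)

lemma arith_vec4:
  "arith k E \<Longrightarrow> arith k F \<Longrightarrow> arith k G \<Longrightarrow> arith k H \<Longrightarrow> arith_vec k (\<lambda>xs. vec4 (E xs) (F xs) (G xs) (H xs))"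
  by (simp add: arith_vec_def forall_4)

lemma arith_quat_mult:
  "arith k a \<Longrightarrow> arith k b \<Longrightarrow> arith_vec k V \<Longrightarrow> arith_vec k W \<Longrightarrow> arith_vec k (\<lambda>xs. quat_mult (a xs) (b xs) (V xs) (W xs))"
  unfolding arith_vec_def forall_4 quat_mult_nth
  by (intro conjI arith_intros; simp add: arith_vec_def forall_4)

lemma arith_quat_trd: "arith_vec k V \<Longrightarrow> arith k (\<lambda>xs. quat_trd (V xs))"
  unfolding quat_trd_def by (intro arith_intros)

lemma arith_quat_nrd: "arith k a \<Longrightarrow> arith k b \<Longrightarrow> arith_vec k V \<Longrightarrow> arith k (\<lambda>xs. quat_nrd (a xs) (b xs) (V xs))"
  unfolding quat_nrd_def by (intro arith_intros)

lemma arith_quat_pure: "arith_vec k V \<Longrightarrow> arith_vec k (\<lambda>xs. quat_pure (V xs))"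
  unfolding quat_pure_def by (intro arith_vec_intros arith_vec4 arith_intros)

lemma arith_nilpotent_partner:
  "arith k a \<Longrightarrow> arith k b \<Longrightarrow> arith_vec k V \<Longrightarrow> arith_vec k (\<lambda>xs. nilpotent_partner (a xs) (b xs) (V xs))"
  unfolding nilpotent_partner_def quat_dual_def Let_def
  by (intro arith_quat_mult arith_vec_intros arith_quat_nrd arith_quat_trd arith_divide arith_const)

lemma arith_split_map:
  assumes "arith k a" "arith k b" "arith_vec k V" "arith_vec k W"
  shows "arith k (\<lambda>xs. split_map (a xs) (b xs) (V xs) (W xs) x $ i $ j)"
proof -
  have ij: "(i = 1 \<or> i = 2) \<and> (j = 1 \<or> j = 2)" using exhaust_2 by blast
  note intros = arith_quat_trd arith_quat_mult arith_vec_intros assms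
  have "arith k (\<lambda>xs. split_map (a xs) (b xs) (V xs) (W xs) x $ 1 $ 1)"
    "arith k (\<lambda>xs. split_map (a xs) (b xs) (V xs) (W xs) x $ 1 $ 2)"
    "arith k (\<lambda>xs. split_map (a xs) (b xs) (V xs) (W xs) x $ 2 $ 1)"
    "arith k (\<lambda>xs. split_map (a xs) (b xs) (V xs) (W xs) x $ 2 $ 2)"
    unfolding split_map_def Let_def mat2_nth by (intro intros)+
  then show ?thesis using ij by auto
qed

lemma arith_qeval: "arith_form k Q \<Longrightarrow> arith_vec k V \<Longrightarrow> arith k (\<lambda>xs. qeval (Q xs) (V xs))"
  by (auto simp: arith_form_def intro!: arith_intros)

lemma arith_qpolar:
  "arith_form k Q \<Longrightarrow> arith_vec k V \<Longrightarrow> arith_vec k W \<Longrightarrow> arith k (\<lambda>xs. qpolar (Q xs) (V xs) (W xs))"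
  by (auto simp: arith_form_def intro!: arith_intros)

lemma arith_binary_disc:
  "arith_form k Q \<Longrightarrow> arith_vec k V \<Longrightarrow> arith_vec k W \<Longrightarrow> arith k (\<lambda>xs. binary_disc (Q xs) (V xs) (W xs))"
  unfolding binary_disc_def by (intro arith_intros arith_qeval arith_qpolar)

lemma arith_qdisc: "arith_form k Q \<Longrightarrow> arith k (\<lambda>xs. qdisc (Q xs))"
  by (auto simp: arith_form_def intro!: arith_intros)

lemma arith_cross: "arith_vec k V \<Longrightarrow> arith_vec k W \<Longrightarrow> arith_vec k (\<lambda>xs. cross (V xs) (W xs))"
  unfolding cross_def by (intro arith_vec3 arith_intros)

lemma arith_qnormal:
  assumes "arith_form k Q" "arith_vec k V" "arith_vec k W" shows "arith_vec k (\<lambda>xs. qnormal (Q xs) (V xs) (W xs))"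
proof -
  have "arith_vec k (\<lambda>xs. cross (V xs) (W xs))" using assms by (intro arith_cross)
  then show ?thesis
    using assms(1) unfolding qnormal_def arith_form_def by (auto intro!: arith_vec3 arith_intros)
qed

lemma arith_pick_pair:
  assumes "arith_form k Q"
  shows "arith_vec k (\<lambda>xs. fst (pick_pair (Q xs) ps)) \<and> arith_vec k (\<lambda>xs. snd (pick_pair (Q xs) ps))"
proof (induction ps)
  case Nil
  show ?case by (simp add: arith_vec_intros)
next
  case (Cons p ps)
  obtain u v where p: "p = (u, v)" by fastforce
  have "arith k (\<lambda>xs. qeval (Q xs) u * binary_disc (Q xs) u v)"
    using assms by (intro arith_mult arith_qeval arith_binary_disc arith_vec_intros)
  then show ?case
    unfolding p pick_pair.simps if_distrib[of fst] if_distrib[of snd] fst_conv snd_conv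
    using Cons.IH by (intro conjI arith_vec_intros) auto
qed

lemma arith_conic_pair:
  assumes "arith_form k Q"
  shows "arith k (\<lambda>xs. fst (conic_pair (Q xs)))" "arith k (\<lambda>xs. snd (conic_pair (Q xs)))"
  unfolding fst_conic_pair snd_conic_pair Let_def
  by (intro arith_if arith_divide arith_mult arith_power2 arith_uminus arith_qeval arith_qpolar arith_qdisc
      arith_binary_disc assms arith_pick_pair[THEN conjunct1] arith_pick_pair[THEN conjunct2])+

lemma arith_conic_point:
  assumes "arith_form k Q" "arith_vec k V"
  shows "arith_vec k (\<lambda>xs. conic_point (Q xs) (V xs))"
  unfolding conic_point_alt Let_def
  by (intro arith_vec_intros arith_divide arith_mult arith_uminus arith_const arith_nth arith_qeval arith_qpolar
      arith_qnormal assms arith_conic_pair arith_pick_pair[THEN conjunct1] arith_pick_pair[THEN conjunct2])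

end

section \<open>Instances and answers as lists of field elements\<close>

fun form_list :: "'a qform \<Rightarrow> 'a list" where
  "form_list (a, b, c, d, e, f) = [a, b, c, d, e, f]"

definition list_form :: "'a list \<Rightarrow> 'a qform" where
  "list_form xs = (xs ! 0, xs ! 1, xs ! 2, xs ! 3, xs ! 4, xs ! 5)"

text \<open>
  The pure quaternions are spanned by the basis vectors number 1, 3, 4 in characteristic 2 and 2, 3, 4
  otherwise; the entries of the image of basis vector \<open>k\<close> start at index \<open>4 (k - 1)\<close>.
\<close>

definition entries_point :: "(nat \<Rightarrow> 'f::field) \<Rightarrow> 'f ^ 3" where
  "entries_point E = (let i = (if (2::'f) = 0 then 0 else 4)
     in cross (vec3 (E (i + 2)) (E 10) (E 14)) (vec3 (E i) (E 8) (E 12)))"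

lemma entries_point: "entries_point (\<lambda>i. map_entries \<phi> ! i) = splitting_point \<phi>"
proof -
  have pure: "quat_pure (axis 1 1) = axis (if (2::'a) = 0 then 1 else 2) (1::'a)"
    "quat_pure (axis 2 1) = axis 3 (1::'a)" "quat_pure (axis 3 1) = axis 4 (1::'a)"
    by (simp_all add: quat_pure_def axis_def vec4_eq_iff)
  show ?thesis
    by (simp add: entries_point_def splitting_point_def pure map_entries_def matrix_entries_def)
qed

lemma length_map_entries: "length (map_entries \<phi>) = 16"
  by (simp add: map_entries_def matrix_entries_def)

text \<open>An element may have many codes, but a code has one element; hence an instance determines
  the algebra or form that its defining set only asserts to exist.\<close>

lemma codes_unique: "codes K ws xs \<Longrightarrow> codes K ws ys \<Longrightarrow> xs = ys"
  by (auto simp: codes_def list_all2_conv_all_nth intro!: nth_equalityI)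

lemma algebra_instancesE:
  assumes "ws \<in> algebra_instances K"
  obtains a b where "codes K ws [a, b]" "standard_pair a b"
  using assms by (auto simp: algebra_instances_def)

lemma conic_instancesE:
  assumes "ws \<in> conic_instances K"
  obtains Q where "codes K ws (form_list Q)" "Q \<in> conics"
  using assms by (fastforce simp: conic_instances_def)

lemma algebra_instances_iff: "codes K ws [a, b] \<Longrightarrow> ws \<in> algebra_instances K \<longleftrightarrow> standard_pair a b"
  by (auto simp: algebra_instances_def dest: codes_unique)

lemma codes_form_iff:
  assumes "codes K ws (form_list (a, b, c, d, e, f))"
  shows "codes K ws [a', b', c', d', e', f'] \<longleftrightarrow> a' = a \<and> b' = b \<and> c' = c \<and> d' = d \<and> e' = e \<and> f' = f"
  using assms codes_unique[of K ws] by auto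

lemma conic_instances_iff:
  assumes "codes K ws (form_list Q)" shows "ws \<in> conic_instances K \<longleftrightarrow> Q \<in> conics"
proof -
  obtain a b c d e f where Q: "Q = (a, b, c, d, e, f)" by (metis prod_cases6)
  show ?thesis unfolding conic_instances_def mem_Collect_eq codes_form_iff[OF assms[unfolded Q]] Q by auto
qed

lemma IsMatrixRing_iff:
  "codes K ws [a, b] \<Longrightarrow> standard_pair a b \<Longrightarrow> ws \<in> snd (IsMatrixRing K) \<longleftrightarrow> (\<exists>\<phi>. splitting a b \<phi>)"
  by (auto simp: IsMatrixRing_def dest: codes_unique)

lemma HasPoint_iff:
  assumes "codes K ws (form_list Q)" "Q \<in> conics"
  shows "ws \<in> snd (HasPoint K) \<longleftrightarrow> (\<exists>v. rational_point Q v)"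
proof -
  obtain a b c d e f where Q: "Q = (a, b, c, d, e, f)" by (metis prod_cases6)
  show ?thesis
    using assms(2) unfolding HasPoint_def snd_conv mem_Collect_eq codes_form_iff[OF assms(1)[unfolded Q]] Q by auto
qed

lemma ExhibitMatrixRing_answers:
  assumes "codes K ws [a, b]"
  shows "snd (ExhibitMatrixRing K) ws =
    {[True] # zs | zs \<phi>. splitting a b \<phi> \<and> codes K zs (map_entries \<phi>)} \<union>
    (if \<exists>\<phi>. splitting a b \<phi> then {} else {[[False]]})"
  using assms by (auto simp: ExhibitMatrixRing_def dest: codes_unique)

lemma ExhibitPoint_answers:
  assumes "codes K ws (form_list Q)"
  shows "snd (ExhibitPoint K) ws =
    {[True] # zs | zs v. rational_point Q v \<and> codes K zs [v $ 1, v $ 2, v $ 3]} \<union>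
    (if \<exists>v. rational_point Q v then {} else {[[False]]})"
proof -
  obtain a b c d e f where Q: "Q = (a, b, c, d, e, f)" by (metis prod_cases6)
  show ?thesis
    unfolding ExhibitPoint_def snd_conv codes_form_iff[OF assms[unfolded Q]] Q by auto
qed

context cost_model
begin

lemma arith_formI:
  assumes "arith k a" "arith k b" "arith k c" "arith k d" "arith k e" "arith k f"
  shows "arith_form k (\<lambda>xs. (a xs, b xs, c xs, d xs, e xs, f xs))"
  unfolding arith_form_def using assms
  by (intro exI[of _ a] exI[of _ b] exI[of _ c] exI[of _ d] exI[of _ e] exI[of _ f]) simp

lemma arith_list_form:
  assumes "6 \<le> k" shows "arith_form k list_form"
proof -
  have "list_form = (\<lambda>xs :: 'f list. (xs ! 0, xs ! 1, xs ! 2, xs ! 3, xs ! 4, xs ! 5))"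
    by (simp add: list_form_def fun_eq_iff)
  then show ?thesis
    using assms arith_formI[of k "\<lambda>xs. xs ! 0" "\<lambda>xs. xs ! 1" "\<lambda>xs. xs ! 2" "\<lambda>xs. xs ! 3"
        "\<lambda>xs. xs ! 4" "\<lambda>xs. xs ! 5"] by (simp add: arith_var)
qed

lemma compute_quat_form:
  "\<exists>p (P::nat poly). \<forall>ws a b. codes K ws [a, b] \<longrightarrow>
     (\<exists>n zs. outputs U p ws n zs \<and> codes K zs (form_list (quat_form a b)) \<and> n \<le> poly P (len ws))"
proof -
  let ?Fs = "map (\<lambda>i xs. form_list (quat_form (xs ! 0) (xs ! 1 :: 'f)) ! i) [0..<6]"
  have "\<forall>F\<in>set ?Fs. arith 2 F"
  proof
    fix F assume "F \<in> set ?Fs"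
    then obtain i where i: "i < 6" and F: "F = (\<lambda>xs. form_list (quat_form (xs ! 0) (xs ! 1)) ! i)" by auto
    have "i = 0 \<or> i = 1 \<or> i = 2 \<or> i = 3 \<or> i = 4 \<or> i = 5" using i by linarith
    then show "arith 2 F"
      unfolding F by (cases "(2::'f) = 0") (auto simp: quat_form_def intro!: arith_intros)
  qed
  then obtain p P where p: "\<forall>ws xs. codes K ws xs \<longrightarrow> length xs = 2 \<longrightarrow>
     (\<exists>n zs. outputs U p ws n zs \<and> codes K zs (map (\<lambda>F. F xs) ?Fs) \<and> n \<le> poly P (len ws))"
    using outputs_arith by blast
  have F: "map (\<lambda>F. F [a, b]) ?Fs = form_list (quat_form a b)" for a b
  proof -
    have "length (form_list (quat_form a b)) = 6" by (cases "quat_form a b") simp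
    then show ?thesis by (intro nth_equalityI) simp_all
  qed
  show ?thesis
  proof (intro exI[of _ p] exI[of _ P] allI impI)
    fix ws a b assume "codes K ws [a, b]"
    then have "\<exists>n zs. outputs U p ws n zs \<and> codes K zs (map (\<lambda>F. F [a, b]) ?Fs) \<and> n \<le> poly P (len ws)"
      using p by simp
    then show "\<exists>n zs. outputs U p ws n zs \<and> codes K zs (form_list (quat_form a b)) \<and> n \<le> poly P (len ws)"
      unfolding F .
  qed
qed

lemma list_form_list: "list_form (form_list Q @ zs) = Q" "list_form (form_list Q) = Q"
  by (cases Q; simp add: list_form_def)+

lemma length_form_list: "length (form_list Q) = 6"
  by (cases Q) simp

lemma compute_conic_pair:
  "\<exists>p (P::nat poly). \<forall>ws Q. codes K ws (form_list Q) \<longrightarrow>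
     (\<exists>n zs. outputs U p ws n zs \<and> codes K zs [fst (conic_pair Q), snd (conic_pair Q)] \<and> n \<le> poly P (len ws))"
proof -
  let ?Fs = "[\<lambda>xs. fst (conic_pair (list_form xs)), \<lambda>xs :: 'f list. snd (conic_pair (list_form xs))]"
  have "\<forall>F\<in>set ?Fs. arith 6 F"
    using arith_conic_pair[OF arith_list_form] by simp
  then obtain p P where p: "\<forall>ws xs. codes K ws xs \<longrightarrow> length xs = 6 \<longrightarrow>
     (\<exists>n zs. outputs U p ws n zs \<and> codes K zs (map (\<lambda>F. F xs) ?Fs) \<and> n \<le> poly P (len ws))"
    using outputs_arith by blast
  have F: "map (\<lambda>F. F (form_list Q)) ?Fs = [fst (conic_pair Q), snd (conic_pair Q)]" for Q
    by (simp add: list_form_list)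
  show ?thesis
  proof (intro exI[of _ p] exI[of _ P] allI impI)
    fix ws and Q :: "'f qform" assume "codes K ws (form_list Q)"
    then have "\<exists>n zs. outputs U p ws n zs \<and> codes K zs (map (\<lambda>F. F (form_list Q)) ?Fs) \<and> n \<le> poly P (len ws)"
      using p length_form_list by blast
    then show "\<exists>n zs. outputs U p ws n zs \<and> codes K zs [fst (conic_pair Q), snd (conic_pair Q)] \<and> n \<le> poly P (len ws)"
      unfolding F .
  qed
qed

section \<open>The four reductions\<close>

lemma decision_reducible_matrix_ring:
  "decision_reducible U len (IsMatrixRing K) (HasPoint K)"
proof -
  obtain p P where p: "\<And>ws a b. codes K ws [a, b] \<Longrightarrow>
     \<exists>n zs. outputs U p ws n zs \<and> codes K zs (form_list (quat_form a b)) \<and> n \<le> poly P (len ws)"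
    using compute_quat_form by blast
  have "\<exists>n y. outputs U p ws n y \<and> n \<le> poly P (len ws) \<and> y \<in> conic_instances K \<and>
      (y \<in> snd (HasPoint K) \<longleftrightarrow> ws \<in> snd (IsMatrixRing K))" if ws: "ws \<in> algebra_instances K" for ws
  proof -
    obtain a b where ab: "codes K ws [a, b]" "standard_pair a b" using ws by (rule algebra_instancesE)
    obtain n zs where "outputs U p ws n zs" "codes K zs (form_list (quat_form a b))" "n \<le> poly P (len ws)"
      using p[OF ab(1)] by blast
    then show ?thesis
      using ab quat_form_conic[OF ab(2)] conic_instances_iff HasPoint_iff IsMatrixRing_iff splitting_iff_point by metis
  qed
  then have "\<forall>ws\<in>algebra_instances K. \<exists>n y. outputs U p ws n y \<and> n \<le> poly P (len ws) \<and> y \<in> conic_instances K \<and>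
      (y \<in> snd (HasPoint K) \<longleftrightarrow> ws \<in> snd (IsMatrixRing K))" by blast
  then show ?thesis
    unfolding decision_reducible_def IsMatrixRing_def HasPoint_def snd_conv prod.case
    by (intro exI[of _ p] exI[of _ P])
qed

lemma decision_reducible_point:
  "decision_reducible U len (HasPoint K) (IsMatrixRing K)"
proof -
  obtain p P where p: "\<And>ws Q. codes K ws (form_list Q) \<Longrightarrow>
     \<exists>n zs. outputs U p ws n zs \<and> codes K zs [fst (conic_pair Q), snd (conic_pair Q)] \<and> n \<le> poly P (len ws)"
    using compute_conic_pair by blast
  have "\<exists>n y. outputs U p ws n y \<and> n \<le> poly P (len ws) \<and> y \<in> algebra_instances K \<and>
      (y \<in> snd (IsMatrixRing K) \<longleftrightarrow> ws \<in> snd (HasPoint K))" if ws: "ws \<in> conic_instances K" for ws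
  proof -
    obtain Q where Q: "codes K ws (form_list Q)" "Q \<in> conics" using ws by (rule conic_instancesE)
    obtain a b where ab: "conic_pair Q = (a, b)" by fastforce
    obtain n zs where "outputs U p ws n zs" "codes K zs [a, b]" "n \<le> poly P (len ws)"
      using p[OF Q(1)] ab by auto
    then show ?thesis
      using Q algebra_instances_iff HasPoint_iff IsMatrixRing_iff has_point_iff[OF Q(2) ab]
        conic_pair_similar(1)[OF qdisc_conic[OF Q(2)] ab] by metis
  qed
  then have "\<forall>ws\<in>conic_instances K. \<exists>n y. outputs U p ws n y \<and> n \<le> poly P (len ws) \<and> y \<in> algebra_instances K \<and>
      (y \<in> snd (IsMatrixRing K) \<longleftrightarrow> ws \<in> snd (HasPoint K))" by blast
  then show ?thesis
    unfolding decision_reducible_def IsMatrixRing_def HasPoint_def snd_conv prod.case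
    by (intro exI[of _ p] exI[of _ P])
qed

lemma search_reducible_matrix_ring:
  "search_reducible U len (ExhibitMatrixRing K) (ExhibitPoint K)"
proof -
  obtain p P where p: "\<And>ws a b. codes K ws [a, b] \<Longrightarrow>
     \<exists>n zs. outputs U p ws n zs \<and> codes K zs (form_list (quat_form a b)) \<and> n \<le> poly P (len ws)"
    using compute_quat_form by blast
  \<comment> \<open>The list consists of \<open>a, b\<close> from the instance followed by the three
    coordinates of the point from the answer.\<close>
  define \<Phi> where "\<Phi> xs = split_map (xs ! 0) (xs ! 1) (quat_pure (vec3 (xs ! 2) (xs ! 3) (xs ! 4)))
    (nilpotent_partner (xs ! 0) (xs ! 1) (quat_pure (vec3 (xs ! 2) (xs ! 3) (xs ! 4))))" for xs :: "'f list"
  let ?Fs = "concat (map (\<lambda>k. [\<lambda>xs. \<Phi> xs (axis k 1) $ 1 $ 1, \<lambda>xs. \<Phi> xs (axis k 1) $ 1 $ 2,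
      \<lambda>xs. \<Phi> xs (axis k 1) $ 2 $ 1, \<lambda>xs. \<Phi> xs (axis k 1) $ 2 $ 2]) [1, 2, 3, 4 :: 4])"
  have "arith (2 + 3) (\<lambda>xs. \<Phi> xs x $ i $ j)" for x i j
    unfolding \<Phi>_def by (intro arith_split_map arith_nilpotent_partner arith_quat_pure arith_vec3 arith_var) simp_all
  then have "\<forall>F\<in>set ?Fs. arith (2 + 3) F" by simp
  then obtain q R where q: "\<And>ws xs. codes K ws xs \<Longrightarrow> length xs = 2 \<Longrightarrow>
     (\<forall>us ys. codes K us ys \<longrightarrow> length ys = 3 \<longrightarrow>
        (\<exists>n zs. outputs U q (ws @ [True] # us) n ([True] # zs) \<and> codes K zs (map (\<lambda>F. F (xs @ ys)) ?Fs) \<and>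
           n \<le> poly R (len (ws @ [True] # us)))) \<and>
     (\<exists>n. outputs U q (ws @ [[False]]) n [[False]] \<and> n \<le> poly R (len (ws @ [[False]])))"
    using outputs_arith_answer by blast
  have F: "map (\<lambda>F. F xs) ?Fs = map_entries (\<Phi> xs)" for xs
    by (simp add: map_entries_def matrix_entries_def)
  \<comment> \<open>A single polynomial has to bound the translation of the instance and that of the
    answer.\<close>
  let ?S = "poly (P + R)"
  have "\<exists>n y. outputs U p ws n y \<and> n \<le> ?S (len ws) \<and> y \<in> conic_instances K \<and>
      (\<forall>w\<in>snd (ExhibitPoint K) y. \<exists>m z. outputs U q (ws @ w) m z \<and> m \<le> ?S (len (ws @ w)) \<and>
         z \<in> snd (ExhibitMatrixRing K) ws)" if ws: "ws \<in> algebra_instances K" for ws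
  proof -
    obtain a b where ab: "codes K ws [a, b]" "standard_pair a b" using ws by (rule algebra_instancesE)
    obtain n y where y: "outputs U p ws n y" "codes K y (form_list (quat_form a b))" "n \<le> poly P (len ws)"
      using p[OF ab(1)] by blast
    have "\<exists>m z. outputs U q (ws @ w) m z \<and> m \<le> ?S (len (ws @ w)) \<and> z \<in> snd (ExhibitMatrixRing K) ws"
      if w: "w \<in> snd (ExhibitPoint K) y" for w
    proof (cases "\<exists>us v. w = [True] # us \<and> rational_point (quat_form a b) v \<and> codes K us [v $ 1, v $ 2, v $ 3]")
      case True
      then obtain us v where v: "w = [True] # us" "rational_point (quat_form a b) v" "codes K us [v $ 1, v $ 2, v $ 3]"
        by blast
      obtain m zs where m: "outputs U q (ws @ w) m ([True] # zs)"
        "codes K zs (map_entries (\<Phi> ([a, b] @ [v $ 1, v $ 2, v $ 3])))" "m \<le> poly R (len (ws @ w))"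
        using q[OF ab(1)] v(1,3) unfolding F by fastforce
      have "vec3 (v $ 1) (v $ 2) (v $ 3) = v" by (simp add: vec3_eq_iff)
      then have "splitting a b (\<Phi> ([a, b] @ [v $ 1, v $ 2, v $ 3]))"
        using splitting_of_point[OF ab(2) v(2)] by (simp add: \<Phi>_def)
      then show ?thesis
        using m unfolding ExhibitMatrixRing_answers[OF ab(1)] by (intro exI[of _ m] exI[of _ "[True] # zs"]) auto
    next
      case False
      then have "w = [[False]]" "\<nexists>v. rational_point (quat_form a b) v"
        using w unfolding ExhibitPoint_answers[OF y(2)] by (auto split: if_splits)
      moreover obtain m where "outputs U q (ws @ [[False]]) m [[False]]" "m \<le> poly R (len (ws @ [[False]]))"
        using q[OF ab(1)] by auto
      ultimately show ?thesis
        using splitting_iff_point[OF ab(2)] unfolding ExhibitMatrixRing_answers[OF ab(1)]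
        by (intro exI[of _ m] exI[of _ "[[False]]"]) auto
    qed
    then show ?thesis
      using y quat_form_conic[OF ab(2)] conic_instances_iff[OF y(2)] by (intro exI[of _ n] exI[of _ y]) auto
  qed
  then have "\<forall>ws\<in>algebra_instances K. \<exists>n y. outputs U p ws n y \<and> n \<le> ?S (len ws) \<and> y \<in> conic_instances K \<and>
      (\<forall>w\<in>snd (ExhibitPoint K) y. \<exists>m z. outputs U q (ws @ w) m z \<and> m \<le> ?S (len (ws @ w)) \<and>
         z \<in> snd (ExhibitMatrixRing K) ws)" by blast
  then show ?thesis
    unfolding search_reducible_def ExhibitMatrixRing_def ExhibitPoint_def snd_conv prod.case
    by (intro exI[of _ p] exI[of _ q] exI[of _ "P + R"])
qed

lemma search_reducible_point:
  "search_reducible U len (ExhibitPoint K) (ExhibitMatrixRing K)"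
proof -
  obtain p P where p: "\<And>ws Q. codes K ws (form_list Q) \<Longrightarrow>
     \<exists>n zs. outputs U p ws n zs \<and> codes K zs [fst (conic_pair Q), snd (conic_pair Q)] \<and> n \<le> poly P (len ws)"
    using compute_conic_pair by blast
  \<comment> \<open>The program for answers is given the original conic and not its translation, so
    the plane and the pair \<open>a, b\<close> are computed again from the six coefficients; the 16
    matrix entries follow at offset 6.\<close>
  define V where "V xs = conic_point (list_form xs) (entries_point (\<lambda>i. xs ! (6 + i)))" for xs :: "'f list"
  let ?Fs = "[\<lambda>xs. V xs $ 1, \<lambda>xs. V xs $ 2, \<lambda>xs. V xs $ 3]"
  have "arith_vec (6 + 16) V"
    unfolding V_def entries_point_def Let_def
    by (intro arith_conic_point arith_list_form arith_cross arith_vec3 arith_var) auto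
  then have "\<forall>F\<in>set ?Fs. arith (6 + 16) F" by (simp add: arith_nth)
  then obtain q R where q: "\<And>ws xs. codes K ws xs \<Longrightarrow> length xs = 6 \<Longrightarrow>
     (\<forall>us ys. codes K us ys \<longrightarrow> length ys = 16 \<longrightarrow>
        (\<exists>n zs. outputs U q (ws @ [True] # us) n ([True] # zs) \<and> codes K zs (map (\<lambda>F. F (xs @ ys)) ?Fs) \<and>
           n \<le> poly R (len (ws @ [True] # us)))) \<and>
     (\<exists>n. outputs U q (ws @ [[False]]) n [[False]] \<and> n \<le> poly R (len (ws @ [[False]])))"
    using outputs_arith_answer by blast
  let ?S = "poly (P + R)"
  have "\<exists>n y. outputs U p ws n y \<and> n \<le> ?S (len ws) \<and> y \<in> algebra_instances K \<and>
      (\<forall>w\<in>snd (ExhibitMatrixRing K) y. \<exists>m z. outputs U q (ws @ w) m z \<and> m \<le> ?S (len (ws @ w)) \<and>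
         z \<in> snd (ExhibitPoint K) ws)" if ws: "ws \<in> conic_instances K" for ws
  proof -
    obtain Q where Q: "codes K ws (form_list Q)" "Q \<in> conics" using ws by (rule conic_instancesE)
    obtain a b where ab: "conic_pair Q = (a, b)" by fastforce
    obtain n y where y: "outputs U p ws n y" "codes K y [a, b]" "n \<le> poly P (len ws)"
      using p[OF Q(1)] ab by auto
    have std: "standard_pair a b" by (rule conic_pair_similar(1)[OF qdisc_conic[OF Q(2)] ab])
    have "\<exists>m z. outputs U q (ws @ w) m z \<and> m \<le> ?S (len (ws @ w)) \<and> z \<in> snd (ExhibitPoint K) ws"
      if w: "w \<in> snd (ExhibitMatrixRing K) y" for w
    proof (cases "\<exists>us \<phi>. w = [True] # us \<and> splitting a b \<phi> \<and> codes K us (map_entries \<phi>)")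
      case True
      then obtain us \<phi> where \<phi>: "w = [True] # us" "splitting a b \<phi>" "codes K us (map_entries \<phi>)" by blast
      have "\<exists>m zs. outputs U q (ws @ w) m ([True] # zs) \<and>
        codes K zs (map (\<lambda>F. F (form_list Q @ map_entries \<phi>)) ?Fs) \<and> m \<le> poly R (len (ws @ w))"
        using q[OF Q(1) length_form_list] \<phi>(1,3) length_map_entries by blast
      moreover have "V (form_list Q @ map_entries \<phi>) = conic_point Q (splitting_point \<phi>)"
        by (simp add: V_def list_form_list nth_append length_form_list entries_point)
      ultimately obtain m zs where m: "outputs U q (ws @ w) m ([True] # zs)"
        "codes K zs [conic_point Q (splitting_point \<phi>) $ 1, conic_point Q (splitting_point \<phi>) $ 2,
           conic_point Q (splitting_point \<phi>) $ 3]" "m \<le> poly R (len (ws @ w))"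
        by auto
      have "rational_point Q (conic_point Q (splitting_point \<phi>))"
        by (rule rational_point_conic_point[OF Q(2) ab rational_point_of_splitting[OF \<phi>(2)]])
      then show ?thesis
        using m unfolding ExhibitPoint_answers[OF Q(1)] by (intro exI[of _ m] exI[of _ "[True] # zs"]) auto
    next
      case False
      then have "w = [[False]]" "\<nexists>\<phi>. splitting a b \<phi>"
        using w unfolding ExhibitMatrixRing_answers[OF y(2)] by (auto split: if_splits)
      moreover obtain m where "outputs U q (ws @ [[False]]) m [[False]]" "m \<le> poly R (len (ws @ [[False]]))"
        using q[OF Q(1) length_form_list] by auto
      ultimately show ?thesis
        using has_point_iff[OF Q(2) ab] unfolding ExhibitPoint_answers[OF Q(1)]
        by (intro exI[of _ m] exI[of _ "[[False]]"]) auto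
    qed
    then show ?thesis
      using y std algebra_instances_iff[OF y(2)] by (intro exI[of _ n] exI[of _ y]) auto
  qed
  then have "\<forall>ws\<in>conic_instances K. \<exists>n y. outputs U p ws n y \<and> n \<le> ?S (len ws) \<and> y \<in> algebra_instances K \<and>
      (\<forall>w\<in>snd (ExhibitMatrixRing K) y. \<exists>m z. outputs U q (ws @ w) m z \<and> m \<le> ?S (len (ws @ w)) \<and>
         z \<in> snd (ExhibitPoint K) ws)" by blast
  then show ?thesis
    unfolding search_reducible_def ExhibitMatrixRing_def ExhibitPoint_def snd_conv prod.case
    by (intro exI[of _ p] exI[of _ q] exI[of _ "P + R"])
qed

lemmas problems_equivalent =
  decision_equivalent_def[of U len "IsMatrixRing K" "HasPoint K", simplified decision_reducible_matrix_ring decision_reducible_point]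
  search_equivalent_def[of U len "ExhibitMatrixRing K" "ExhibitPoint K", simplified search_reducible_matrix_ring search_reducible_point]

end

text \<open>Polynomial time over a computable field has two readings. Counting field operations, it
  is unconditional; counting bit operations, it presupposes that the field operations themselves run
  in polynomial time. Both follow from the same programs, with register size 1 or word
  length.\<close>

theorem proposition4p8:
  fixes K :: "'f::field presentation"
  assumes "computable_field K"
  shows
    "bij_betw (\<lambda>\<B>. conic_iso `` {Q. \<exists>B\<in>\<B>. associated_conic B Q})
       (quaternion_algebras // (quaternion_iso :: ('f algebra4 \<times> 'f algebra4) set))
       (conics // conic_iso) \<and>
     decision_equivalent (field_algorithms K) length (IsMatrixRing K) (HasPoint K) \<and>
     search_equivalent (field_algorithms K) length (ExhibitMatrixRing K) (ExhibitPoint K) \<and>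
     (poly_time_field K \<longrightarrow>
        decision_equivalent {} bit_size (IsMatrixRing K) (HasPoint K) \<and>
        search_equivalent {} bit_size (ExhibitMatrixRing K) (ExhibitPoint K))"
proof -
  interpret arithmetic: cost_model "field_algorithms K" "\<lambda>_. 1" K
    using assms by (rule cost_model_arithmetic)
  have "arithmetic.len ws = length ws" for ws
    unfolding arithmetic.len_def by (induction ws) simp_all
  then have len: "arithmetic.len = length" by blast
  have bit: "decision_equivalent {} bit_size (IsMatrixRing K) (HasPoint K) \<and>
        search_equivalent {} bit_size (ExhibitMatrixRing K) (ExhibitPoint K)" if poly: "poly_time_field K"
  proof -
    interpret bit: cost_model "{}" length K
      using assms poly by (rule cost_model_bit)
    have "bit.len = bit_size" by (simp add: fun_eq_iff bit.len_def bit_size_def)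
    then show ?thesis using bit.problems_equivalent by simp
  qed
  show ?thesis using conic_bijection arithmetic.problems_equivalent bit unfolding len by simp
qed

end
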